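(* Let $G\subset\mathbb{R}^d$ be a bounded domain with $\partial G\in C^{4,\epsilon}$ for some $\epsilon\in(0,1)$, let $T>0$, $Q=(0,T)\times G$, $S=(0,T)\times\partial G$, and let $\nu(z)$ be the inward unit normal at $z\in\partial G$. Let $b:\bar Q\to\mathbb{R}^d$, $\sigma:\bar Q\to\mathbb{R}^{d\times d}$, $c,g:\bar Q\to\mathbb{R}$ be in $C^{1+\epsilon,2+\epsilon}(\bar Q)$, let $\gamma,\psi:\bar S\to\mathbb{R}$ be in $C^{1+\epsilon,2+\epsilon}(\bar S)$, let $\mu\in C^{2+\epsilon}(\partial G)$ with $\mu(z)>0$ for all $z\in\partial G$, and let $\varphi\in C^{4+\epsilon}(\bar G)$. Put $a=\sigma\sigma^{\top}$ and $\mathcal{A}v=\frac12\sum_{i,j=1}^d a^{ij}\frac{\partial^2 v}{\partial x^i\partial x^j}+\sum_{i=1}^d b^i\frac{\partial v}{\partial x^i}$. Assume that the boundary value problem $$\frac{\partial u}{\partial t}+\mathcal{A}u+c(t,x)u+g(t,x)=0\ \text{ on }[0,T]\times\bar G,\qquad u(T,x)=\varphi(x)\ \text{ on }\bar G,$$ $$-\mu(z)\,\mathcal{A}u(t,z)+(\nu(z)\cdot\nabla u(t,z))+\gamma(t,z)u(t,z)=\psi(t,z)\ \text{ on }[0,T]\times\partial G$$ has a unique solution $u$, and that $u\in C^{4,\epsilon}(\bar Q)$. Let $t_0\in[0,T)$ and $x\in G$, and for $h\in(0,1)$ let $(t_k,X_k,Y_k,Z_k)_{k=0}^{\chi}$ be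 the Markov chain generated by the projected Euler method (described in the context) with step $h$ started at $(t_0,X_0,Y_0,Z_0)=(t_0,x,1,0)$. Then there is a constant $C>0$ independent of $h$ such that, for all sufficiently small $h$, $$\big|\mathbb{E}\big(\varphi(X_\chi)Y_\chi+Z_\chi\big)-u(t_0,X_0)\big|\le Ch^{1/2} .$$
   Context: Function spaces: $C^{1+\epsilon,2+\epsilon}$ denotes the parabolic Hölder space of order $2+\epsilon$ (functions $v$ for which all derivatives $\partial_t^i\partial_x^j v$ with $2i+|j|<2+\epsilon$ are continuous up to the closure with finite parabolic Hölder norm of order $2+\epsilon$). $C^{2+\epsilon}(\partial G)$, $C^{4+\epsilon}(\bar G)$ are the usual Hölder spaces. $C^{4,\epsilon}(\bar Q)$ denotes functions of $(t,x)$ all of whose partial derivatives up to order 4 are continuous on $\bar Q$, those of order 4 being $\epsilon$-Hölder. Projected Euler method. Let $\xi_{k+1}=(\xi_{k+1}^1,\dots,\xi_{k+1}^d)$, $k\ge0$, where all components, for all $k$, are independent and take the values $\pm1$ with probability $1/2$ each. While $t_k<T$: (a) if $X_k\in\bar G$, then $$X_{k+1}=X_k+hb(t_k,X_k)+h^{1/2}\sigma(t_k,X_k)\xi_{k+1},\quad t_{k+1}=t_k+h,$$ $$Y_{k+1}=Y_k+hc(t_k,X_k)Y_k,\quad Z_{k+1}=Z_k+hg(t_k,X_k)Y_k;$$ (b) if $X_k\notin\bar G$, let $r_k=\operatorname{dist}(X_k,\partial G)$ and let $X_{k+1}\in\partial G$ be the projection of $X_k$ on $\partial G$, i.e. $X_{k+1}=X_k+r_k\nu(X_{k+1})$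 (it exists and is unique for small $h$, with $r_k=O(h^{1/2})$), and $$t_{k+1}=t_k+r_k\mu(X_{k+1}),$$ $$Y_{k+1}=Y_k+r_k\gamma(t_k,X_{k+1})Y_k+r_k\mu(X_{k+1})c(t_k,X_{k+1})Y_k,$$ $$Z_{k+1}=Z_k-r_k\psi(t_k,X_{k+1})Y_k+r_k\mu(X_{k+1})g(t_k,X_{k+1})Y_k .$$ The method stops at the first index $k=:\chi$ with $t_k\ge T$ (so $t_\chi$ may exceed $T$). Since $X_\chi$ may lie outside $\bar G$ (at distance $O(h^{1/2})$), $\varphi$ denotes also a fixed extension of $\varphi$ to a neighbourhood of $\bar G$, of class $C^4$ with bounded derivatives. *)

theory Defs
  imports "HOL-Probability.Probability"
begin

section \<open>Hoelder spaces on the closure of an open set\<close>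

text \<open>
  \<open>U\<close> is always open. A list \<open>js\<close> of basis vectors stands for an iterated partial derivative,
  the head of the list being the direction differentiated last. Functions are differentiated in
  \<open>U\<close> only; a partial derivative at a point of \<open>closure U - U\<close> is the continuous extension.
\<close>

definition partials ::
    "nat \<Rightarrow> 'a::euclidean_space set \<Rightarrow> ('a \<Rightarrow> real) \<Rightarrow> ('a list \<Rightarrow> 'a \<Rightarrow> real) \<Rightarrow> bool" where
  "partials k U f D \<longleftrightarrow> D [] = f \<and>
     (\<forall>js. set js \<subseteq> Basis \<and> length js < k \<longrightarrow>
       (\<forall>e\<in>Basis. \<forall>x\<in>U. ((\<lambda>s. D js (x + s *\<^sub>R e)) has_real_derivative D (e # js) x) (at 0)))"

definition holder_cont :: "real \<Rightarrow> 'a::metric_space set \<Rightarrow> ('a \<Rightarrow> real) \<Rightarrow> bool" where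
  "holder_cont \<epsilon> A f \<longleftrightarrow> (\<exists>K. \<forall>x\<in>A. \<forall>y\<in>A. \<bar>f x - f y\<bar> \<le> K * dist x y powr \<epsilon>)"

text \<open>
  The space of functions with \<open>k\<close>-th order derivatives that are \<open>\<epsilon>\<close>-Hoelder on \<open>closure U\<close>. All
  sets \<open>U\<close> used below are bounded, so that boundedness of the derivatives is automatic.
\<close>

definition holder_space :: "nat \<Rightarrow> real \<Rightarrow> 'a::euclidean_space set \<Rightarrow> ('a \<Rightarrow> real) \<Rightarrow> bool" where
  "holder_space k \<epsilon> U f \<longleftrightarrow> (\<exists>D. partials k U f D \<and>
     (\<forall>js. set js \<subseteq> Basis \<and> length js \<le> k \<longrightarrow> continuous_on (closure U) (D js)) \<and>
     (\<forall>js. set js \<subseteq> Basis \<and> length js = k \<longrightarrow> holder_cont \<epsilon> (closure U) (D js)))"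

definition Ck_bounded_derivs :: "nat \<Rightarrow> 'a::euclidean_space set \<Rightarrow> ('a \<Rightarrow> real) \<Rightarrow> bool" where
  "Ck_bounded_derivs k U f \<longleftrightarrow> (\<exists>D. partials k U f D \<and>
     (\<forall>js. set js \<subseteq> Basis \<and> length js \<le> k \<longrightarrow> continuous_on U (D js)) \<and>
     (\<forall>js. set js \<subseteq> Basis \<and> 1 \<le> length js \<and> length js \<le> k \<longrightarrow> bounded (D js ` U)))"

text \<open>
  \<open>vt\<close>, \<open>vx\<close>, \<open>vxx\<close> are the time derivative, spatial gradient and spatial Hessian of \<open>v\<close> in
  \<open>(0,T) \<times> U\<close>, all continuous up to \<open>[0,T] \<times> closure U\<close>.
\<close>

definition C12_derivs ::
    "real \<Rightarrow> (real^'d) set \<Rightarrow> (real \<Rightarrow> real^'d \<Rightarrow> real) \<Rightarrow>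
     (real \<Rightarrow> real^'d \<Rightarrow> real) \<Rightarrow> (real \<Rightarrow> real^'d \<Rightarrow> real^'d) \<Rightarrow> (real \<Rightarrow> real^'d \<Rightarrow> real^'d^'d) \<Rightarrow> bool"
  where
  "C12_derivs T U v vt vx vxx \<longleftrightarrow>
     (\<forall>t\<in>{0<..<T}. \<forall>x\<in>U.
        ((\<lambda>s. v s x) has_real_derivative vt t x) (at t) \<and>
        (\<forall>i. ((\<lambda>s. v t (x + s *\<^sub>R axis i 1)) has_real_derivative vx t x $ i) (at 0)) \<and>
        (\<forall>i j. ((\<lambda>s. vx t (x + s *\<^sub>R axis j 1) $ i) has_real_derivative vxx t x $ i $ j) (at 0))) \<and>
     continuous_on ({0..T} \<times> closure U) (\<lambda>(t, x). v t x) \<and>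
     continuous_on ({0..T} \<times> closure U) (\<lambda>(t, x). vt t x) \<and>
     continuous_on ({0..T} \<times> closure U) (\<lambda>(t, x). vx t x) \<and>
     continuous_on ({0..T} \<times> closure U) (\<lambda>(t, x). vxx t x)"

definition parabolic_cont :: "real \<Rightarrow> real \<Rightarrow> (real^'d) set \<Rightarrow> (real \<Rightarrow> real^'d \<Rightarrow> real) \<Rightarrow> bool" where
  "parabolic_cont \<epsilon> T A w \<longleftrightarrow> (\<exists>K. \<forall>t\<in>{0..T}. \<forall>s\<in>{0..T}. \<forall>x\<in>A. \<forall>y\<in>A.
     \<bar>w t x - w s y\<bar> \<le> K * (dist x y powr \<epsilon> + \<bar>t - s\<bar> powr (\<epsilon> / 2)))"

text \<open>
  The parabolic Hoelder space of order \<open>2 + \<epsilon>\<close> on \<open>[0,T] \<times> closure U\<close>, for bounded \<open>U\<close>. The last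
  conjunct is the part of the norm concerning the first-order spatial derivatives: these have
  parabolic order 1 and are Hoelder in time with exponent \<open>(2 + \<epsilon> - 1) / 2\<close>.
\<close>

definition parabolic_holder ::
    "real \<Rightarrow> real \<Rightarrow> (real^'d) set \<Rightarrow> (real \<Rightarrow> real^'d \<Rightarrow> real) \<Rightarrow> bool" where
  "parabolic_holder \<epsilon> T U v \<longleftrightarrow> (\<exists>vt vx vxx. C12_derivs T U v vt vx vxx \<and>
     parabolic_cont \<epsilon> T (closure U) vt \<and>
     (\<forall>i j. parabolic_cont \<epsilon> T (closure U) (\<lambda>t x. vxx t x $ i $ j)) \<and>
     (\<forall>i. \<exists>K. \<forall>t\<in>{0..T}. \<forall>s\<in>{0..T}. \<forall>x\<in>closure U.
        \<bar>vx t x $ i - vx s x $ i\<bar> \<le> K * \<bar>t - s\<bar> powr ((1 + \<epsilon>) / 2)))"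

section \<open>Smooth boundaries and functions on them\<close>

text \<open>
  Near \<open>z\<close>, the set \<open>G\<close> is the region above the graph of \<open>f\<close>, where \<open>f\<close> is a function of the
  coordinates other than the \<open>i\<close>-th (written as a function on the whole space that does not depend
  on the \<open>i\<close>-th coordinate), and the \<open>i\<close>-th axis is reversed if \<open>s = -1\<close>.
\<close>

definition local_graph ::
    "nat \<Rightarrow> real \<Rightarrow> (real^'d) set \<Rightarrow> real^'d \<Rightarrow> real \<Rightarrow> 'd \<Rightarrow> real \<Rightarrow> (real^'d \<Rightarrow> real) \<Rightarrow> bool" where
  "local_graph k \<epsilon> G z r i s f \<longleftrightarrow> r > 0 \<and> s \<in> {-1, 1} \<and>
     (\<forall>x y. (\<forall>j. j \<noteq> i \<longrightarrow> x $ j = y $ j) \<longrightarrow> f x = f y) \<and>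
     holder_space k \<epsilon> (ball z r) f \<and>
     G \<inter> ball z r = {x \<in> ball z r. f x < s * x $ i}"

definition holder_boundary :: "nat \<Rightarrow> real \<Rightarrow> (real^'d) set \<Rightarrow> bool" where
  "holder_boundary k \<epsilon> G \<longleftrightarrow> (\<forall>z\<in>frontier G. \<exists>r i s f. local_graph k \<epsilon> G z r i s f)"

definition graph_point :: "'d \<Rightarrow> real \<Rightarrow> (real^'d \<Rightarrow> real) \<Rightarrow> real^'d \<Rightarrow> real^'d" where
  "graph_point i s f x = (\<chi> j. if j = i then s * f x else x $ j)"

text \<open>
  Functions on \<open>frontier G\<close> are measured in local coordinates. The radius \<open>\<rho>\<close> may be taken so small
  that \<open>graph_point i s f\<close> maps \<open>ball z \<rho>\<close> into \<open>frontier G\<close>; the values of the functions away from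
  \<open>frontier G\<close> are therefore irrelevant.
\<close>

definition boundary_holder :: "nat \<Rightarrow> real \<Rightarrow> (real^'d) set \<Rightarrow> (real^'d \<Rightarrow> real) \<Rightarrow> bool" where
  "boundary_holder k \<epsilon> G v \<longleftrightarrow> (\<forall>z\<in>frontier G. \<exists>r i s f. local_graph k \<epsilon> G z r i s f \<and>
     (\<exists>\<rho>>0. holder_space k \<epsilon> (ball z \<rho>) (\<lambda>x. v (graph_point i s f x))))"

definition boundary_parabolic_holder ::
    "real \<Rightarrow> real \<Rightarrow> (real^'d) set \<Rightarrow> (real \<Rightarrow> real^'d \<Rightarrow> real) \<Rightarrow> bool" where
  "boundary_parabolic_holder \<epsilon> T G v \<longleftrightarrow>
     (\<forall>z\<in>frontier G. \<exists>r i s f. local_graph 2 \<epsilon> G z r i s f \<and>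
       (\<exists>\<rho>>0. parabolic_holder \<epsilon> T (ball z \<rho>) (\<lambda>t x. v t (graph_point i s f x))))"

definition tangent_vectors :: "(real^'d) set \<Rightarrow> real^'d \<Rightarrow> (real^'d) set" where
  "tangent_vectors G z = {w. \<exists>p. p 0 = z \<and> (\<forall>s::real. p s \<in> frontier G) \<and>
     (p has_vector_derivative w) (at 0)}"

definition inward_unit_normal :: "(real^'d) set \<Rightarrow> real^'d \<Rightarrow> real^'d \<Rightarrow> bool" where
  "inward_unit_normal G z n \<longleftrightarrow> norm n = 1 \<and> (\<forall>w\<in>tangent_vectors G z. n \<bullet> w = 0) \<and>
     (\<exists>\<delta>>0. \<forall>s\<in>{0<..<\<delta>}. z + s *\<^sub>R n \<in> G)"

section \<open>The boundary value problem\<close>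

text \<open>The second-order operator at \<open>(t, x)\<close>, for a function with gradient \<open>p\<close> and Hessian \<open>H\<close> there.\<close>

definition gen ::
    "(real \<Rightarrow> real^'d \<Rightarrow> real^'d) \<Rightarrow> (real \<Rightarrow> real^'d \<Rightarrow> real^'d^'d) \<Rightarrow>
     real \<Rightarrow> real^'d \<Rightarrow> real^'d \<Rightarrow> real^'d^'d \<Rightarrow> real" where
  "gen b \<sigma> t x p H =
     1/2 * (\<Sum>i\<in>UNIV. \<Sum>j\<in>UNIV. (\<sigma> t x ** transpose (\<sigma> t x)) $ i $ j * H $ i $ j)
     + (\<Sum>i\<in>UNIV. b t x $ i * p $ i)"

text \<open>
  Since the equations are imposed on closed sets, a solution is a function that has the derivatives
  occurring in the equations continuous up to the boundary.
\<close>

definition bvp_solution ::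
    "real \<Rightarrow> (real^'d) set \<Rightarrow> (real^'d \<Rightarrow> real^'d) \<Rightarrow>
     (real \<Rightarrow> real^'d \<Rightarrow> real^'d) \<Rightarrow> (real \<Rightarrow> real^'d \<Rightarrow> real^'d^'d) \<Rightarrow>
     (real \<Rightarrow> real^'d \<Rightarrow> real) \<Rightarrow> (real \<Rightarrow> real^'d \<Rightarrow> real) \<Rightarrow> (real^'d \<Rightarrow> real) \<Rightarrow>
     (real \<Rightarrow> real^'d \<Rightarrow> real) \<Rightarrow> (real \<Rightarrow> real^'d \<Rightarrow> real) \<Rightarrow> (real^'d \<Rightarrow> real) \<Rightarrow>
     (real \<Rightarrow> real^'d \<Rightarrow> real) \<Rightarrow> bool" where
  "bvp_solution T G \<nu> b \<sigma> c g \<mu> \<gamma> \<psi> \<phi> v \<longleftrightarrow> (\<exists>vt vx vxx. C12_derivs T G v vt vx vxx \<and>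
     (\<forall>t\<in>{0..T}. \<forall>x\<in>closure G.
        vt t x + gen b \<sigma> t x (vx t x) (vxx t x) + c t x * v t x + g t x = 0) \<and>
     (\<forall>x\<in>closure G. v T x = \<phi> x) \<and>
     (\<forall>t\<in>{0..T}. \<forall>z\<in>frontier G.
        - \<mu> z * gen b \<sigma> t z (vx t z) (vxx t z) + \<nu> z \<bullet> vx t z + \<gamma> t z * v t z = \<psi> t z))"

section \<open>The projected Euler method\<close>

definition sign_noise :: "'w measure \<Rightarrow> (nat \<Rightarrow> 'w \<Rightarrow> real^'d) \<Rightarrow> bool" where
  "sign_noise M \<xi> \<longleftrightarrow> prob_space M \<and>
     prob_space.indep_vars M (\<lambda>_. borel) (\<lambda>(k, i) \<omega>. \<xi> k \<omega> $ i) ({1..} \<times> UNIV) \<and>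
     (\<forall>k\<ge>1. \<forall>i. (\<forall>\<omega>\<in>space M. \<xi> k \<omega> $ i \<in> {-1, 1}) \<and>
        measure M {\<omega> \<in> space M. \<xi> k \<omega> $ i = 1} = 1/2 \<and>
        measure M {\<omega> \<in> space M. \<xi> k \<omega> $ i = -1} = 1/2)"

definition pe_step ::
    "(real^'d) set \<Rightarrow> (real \<Rightarrow> real^'d \<Rightarrow> real^'d) \<Rightarrow> (real \<Rightarrow> real^'d \<Rightarrow> real^'d^'d) \<Rightarrow>
     (real \<Rightarrow> real^'d \<Rightarrow> real) \<Rightarrow> (real \<Rightarrow> real^'d \<Rightarrow> real) \<Rightarrow> (real^'d \<Rightarrow> real) \<Rightarrow>
     (real \<Rightarrow> real^'d \<Rightarrow> real) \<Rightarrow> (real \<Rightarrow> real^'d \<Rightarrow> real) \<Rightarrow> real \<Rightarrow> real^'d \<Rightarrow>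
     real \<times> (real^'d) \<times> real \<times> real \<Rightarrow> real \<times> (real^'d) \<times> real \<times> real" where
  "pe_step G b \<sigma> c g \<mu> \<gamma> \<psi> h e = (\<lambda>(t, X, Y, Z).
     if X \<in> closure G then
       (t + h,
        X + h *\<^sub>R b t X + sqrt h *\<^sub>R (\<sigma> t X *v e),
        Y + h * c t X * Y,
        Z + h * g t X * Y)
     else
       (let r = infdist X (frontier G); P = closest_point (frontier G) X in
         (t + r * \<mu> P,
          P,
          Y + r * \<gamma> t P * Y + r * \<mu> P * c t P * Y,
          Z - r * \<psi> t P * Y + r * \<mu> P * g t P * Y)))"

text \<open>
  The recursion below is continued past the stopping index, where it evaluates the coefficients
  outside their domain; only the values up to the stopping index are ever used.
\<close>

primrec pe_chain ::
    "(real^'d) set \<Rightarrow> (real \<Rightarrow> real^'d \<Rightarrow> real^'d) \<Rightarrow> (real \<Rightarrow> real^'d \<Rightarrow> real^'d^'d) \<Rightarrow>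
     (real \<Rightarrow> real^'d \<Rightarrow> real) \<Rightarrow> (real \<Rightarrow> real^'d \<Rightarrow> real) \<Rightarrow> (real^'d \<Rightarrow> real) \<Rightarrow>
     (real \<Rightarrow> real^'d \<Rightarrow> real) \<Rightarrow> (real \<Rightarrow> real^'d \<Rightarrow> real) \<Rightarrow> real \<Rightarrow> (nat \<Rightarrow> real^'d) \<Rightarrow>
     real \<Rightarrow> real^'d \<Rightarrow> nat \<Rightarrow> real \<times> (real^'d) \<times> real \<times> real" where
  "pe_chain G b \<sigma> c g \<mu> \<gamma> \<psi> h e t0 x 0 = (t0, x, 1, 0)"
| "pe_chain G b \<sigma> c g \<mu> \<gamma> \<psi> h e t0 x (Suc k) =
     pe_step G b \<sigma> c g \<mu> \<gamma> \<psi> h (e (Suc k)) (pe_chain G b \<sigma> c g \<mu> \<gamma> \<psi> h e t0 x k)"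

definition stop_index :: "real \<Rightarrow> (nat \<Rightarrow> real \<times> 'b) \<Rightarrow> nat" where
  "stop_index T chain = (LEAST k. T \<le> fst (chain k))"

definition pe_terminal :: "real \<Rightarrow> (real^'d \<Rightarrow> real) \<Rightarrow> (nat \<Rightarrow> real \<times> (real^'d) \<times> real \<times> real) \<Rightarrow> real"
  where
  "pe_terminal T \<phi> chain = (case chain (stop_index T chain) of (t, X, Y, Z) \<Rightarrow> \<phi> X * Y + Z)"

end

theory Submission
  imports Defs "HOL-Real_Asymp.Real_Asymp"
begin

text \<open>
  Extend \<open>u\<close> past the boundary by \<open>V(t,X)\<close>, the second-order Taylor polynomial of \<open>u\<close> in \<open>(t,x)\<close> about
  \<open>(t,P)\<close>, where \<open>P\<close> is the projection of \<open>X\<close>, evaluated at \<open>(t,X)\<close>. The derivative of the Taylor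
  polynomial with respect to its base point contains third-order terms only, and the domain is locally
  quasiconvex, so changing the base point costs the cube of the distances involved.

  Put \<open>W\<^sub>k = V(t\<^sub>k,X\<^sub>k) Y\<^sub>k + Z\<^sub>k\<close>. By the differential equation, an Euler step changes \<open>W\<close> by a term of
  mean zero plus \<open>O(h\<^bsup>3/2\<^esup>)\<close>. By the boundary condition, in which \<open>-\<A> u\<close> is replaced by
  \<open>u\<^sub>t + c u + g\<close>, a projection over the distance \<open>r = O(h\<^bsup>1/2\<^esup>)\<close> changes \<open>W\<close> by \<open>O(r\<^sup>2)\<close> only. As \<open>\<mu>\<close> is
  bounded away from zero, either error is at most \<open>h\<^bsup>1/2\<^esup>\<close> times the elapsed time of the step; these times sum to
  at most \<open>T\<close>, so the accumulated error is \<open>O(h\<^bsup>1/2\<^esup>)\<close> along every path. The last step, which may pass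
  the time \<open>T\<close> and leave the domain, costs another \<open>O(h\<^bsup>1/2\<^esup>)\<close>.
\<close>

section \<open>Taylor polynomials with a varying base point\<close>

text \<open>The mean zero terms are subtracted path by path, and what remains is bounded for every
  sequence of signs. Conditional expectations and optional stopping are thus avoided: elapsed time
  bounds the number of steps, and only finitely many products of independent signs have to be
  integrated. The quadratic noise of an Euler step has mean zero because every sign has square 1, so
  that its diagonal is exactly the trace in the generator. The obstacle is that \<open>u\<close>
  lives on the closed cylinder while the chain leaves it. All that is asked of the extension
  \<open>V\<close> is a comparison of Taylor polynomials at two base points, so its smoothness
  across the boundary is never at stake. All displacements in an Euler step, the way to the
  projection included, are of order \<open>h^(1/2)\<close>, so a cubic error is \<open>h\<close>
  times \<open>h^(1/2)\<close>. A projection has no such reserve, as its elapsed time may be far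
  below \<open>h\<close>: the first-order terms in \<open>r\<close> have to cancel, and in
  \<open>r^2\<close> one factor is \<open>O(h^(1/2))\<close> and the other at most a multiple of the
  elapsed time.\<close>

text \<open>The step from \<open>x\<close> to \<open>x + v\<close> is made one coordinate at a time.
  The mean value theorem gives on each leg the value of a partial derivative at a point near
  \<open>x\<close>, which continuity replaces by the value at \<open>x\<close>.\<close>

lemma has_derivative_continuous_partials:
  fixes f :: "'a::euclidean_space \<Rightarrow> real"
  assumes U: "open U" "x \<in> U"
    and deriv: "\<And>b y. b \<in> Basis \<Longrightarrow> y \<in> U \<Longrightarrow> ((\<lambda>s. f (y + s *\<^sub>R b)) has_real_derivative F b y) (at 0)"
    and cont: "\<And>b. b \<in> Basis \<Longrightarrow> continuous_on U (F b)"
  shows "(f has_derivative (\<lambda>v. \<Sum>b\<in>Basis. (v \<bullet> b) * F b x)) (at x)"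
  unfolding has_derivative_at_alt
proof (intro conjI allI impI)
  show "bounded_linear (\<lambda>v. \<Sum>b\<in>Basis. (v \<bullet> b) * F b x)"
    by (intro bounded_linear_sum bounded_linear_mult_const bounded_linear_inner_left)
next
  fix e :: real assume "e > 0"
  define \<epsilon> where "\<epsilon> = e / DIM('a)"
  have "\<epsilon> > 0" using \<open>e > 0\<close> by (simp add: \<epsilon>_def)
  obtain r where r: "r > 0" "ball x r \<subseteq> U" using U openE by blast
  have "\<exists>d>0. \<forall>y\<in>U. dist y x < d \<longrightarrow> dist (F b y) (F b x) < \<epsilon>" if "b \<in> Basis" for b
    using cont[OF that] U(2) \<open>\<epsilon> > 0\<close> unfolding continuous_on_iff by blast
  then obtain dd where dd: "\<And>b. b \<in> Basis \<Longrightarrow> dd b > 0"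
    "\<And>b y. b \<in> Basis \<Longrightarrow> y \<in> U \<Longrightarrow> dist y x < dd b \<Longrightarrow> dist (F b y) (F b x) < \<epsilon>" by metis
  define d where "d = min r (Min (dd ` Basis))"
  have "d > 0" using dd r by (auto simp: d_def)
  have dle: "d \<le> r" "\<And>b. b \<in> Basis \<Longrightarrow> d \<le> dd b" by (auto simp: d_def min_le_iff_disj)
  \<comment> \<open>\<open>B\<close> is the set of coordinates already changed; the induction adds
    them one by one.\<close>
  have main: "\<bar>f (x + (\<Sum>b\<in>B. (v \<bullet> b) *\<^sub>R b)) - f x - (\<Sum>b\<in>B. (v \<bullet> b) * F b x)\<bar> \<le> (\<Sum>b\<in>B. \<epsilon> * \<bar>v \<bullet> b\<bar>)"
    if v: "norm v < d" and "B \<subseteq> Basis" for v B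
    using finite_subset[OF \<open>B \<subseteq> Basis\<close> finite_Basis] \<open>B \<subseteq> Basis\<close>
  proof (induction B rule: finite_induct)
    case empty then show ?case by simp
  next
    case (insert b B)
    let ?p = "x + (\<Sum>b\<in>B. (v \<bullet> b) *\<^sub>R b)"
    define s where "s = v \<bullet> b"
    have b: "b \<in> Basis" "B \<subseteq> Basis" using insert by auto
    \<comment> \<open>Every coordinate of the intermediate displacement is in absolute value at most
      that of \<open>v\<close>, so the whole leg stays in the ball.\<close>
    have near: "?p + \<tau> *\<^sub>R b \<in> ball x d" if "\<bar>\<tau>\<bar> \<le> \<bar>s\<bar>" for \<tau>
    proof -
      have "norm ((\<Sum>b\<in>B. (v \<bullet> b) *\<^sub>R b) + \<tau> *\<^sub>R b) \<le> norm v"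
      proof (rule norm_le_componentwise)
        fix c :: 'a assume c: "c \<in> Basis"
        have "(\<Sum>b\<in>B. (v \<bullet> b) *\<^sub>R b) \<bullet> c = (if c \<in> B then v \<bullet> c else 0)"
        proof -
          have "(\<Sum>b\<in>B. (v \<bullet> b) *\<^sub>R b) \<bullet> c = (\<Sum>b\<in>B. if b = c then v \<bullet> c else 0)"
            unfolding inner_sum_left using b c by (intro sum.cong) (auto simp: inner_Basis)
          also have "\<dots> = (if c \<in> B then v \<bullet> c else 0)" using insert(1) by (simp add: sum.delta)
          finally show ?thesis .
        qed
        then show "\<bar>((\<Sum>b\<in>B. (v \<bullet> b) *\<^sub>R b) + \<tau> *\<^sub>R b) \<bullet> c\<bar> \<le> \<bar>v \<bullet> c\<bar>"
          using insert(2) that c b by (auto simp: inner_add_left inner_Basis s_def)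
      qed
      then have "norm ((\<Sum>b\<in>B. (v \<bullet> b) *\<^sub>R b) + \<tau> *\<^sub>R b) < d" using v by linarith
      moreover have "x - (?p + \<tau> *\<^sub>R b) = - ((\<Sum>b\<in>B. (v \<bullet> b) *\<^sub>R b) + \<tau> *\<^sub>R b)" by simp
      ultimately show ?thesis unfolding mem_ball dist_norm by (simp only: norm_minus_cancel)
    qed
    have dline: "((\<lambda>\<tau>. f (?p + \<tau> *\<^sub>R b)) has_real_derivative F b (?p + \<tau> *\<^sub>R b)) (at \<tau>)"
      if "\<bar>\<tau>\<bar> \<le> \<bar>s\<bar>" for \<tau>
    proof -
      have "?p + \<tau> *\<^sub>R b \<in> U" using near[OF that] dle r by auto
      from deriv[OF b(1) this]
      have "((\<lambda>s. f (?p + (s + \<tau>) *\<^sub>R b)) has_real_derivative F b (?p + \<tau> *\<^sub>R b)) (at 0)"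
        by (simp add: algebra_simps)
      then show ?thesis using DERIV_shift[of "\<lambda>s. f (?p + s *\<^sub>R b)" "F b (?p + \<tau> *\<^sub>R b)" 0 \<tau>] by simp
    qed
    have "\<exists>\<tau>. \<bar>\<tau>\<bar> \<le> \<bar>s\<bar> \<and> f (?p + s *\<^sub>R b) - f ?p = s * F b (?p + \<tau> *\<^sub>R b)"
    proof (cases "s = 0")
      case True then show ?thesis by auto
    next
      case False
      consider "s > 0" | "s < 0" using False by linarith
      then show ?thesis
      proof cases
        case 1
        obtain z where "0 < z" "z < s"
          "f (?p + s *\<^sub>R b) - f (?p + 0 *\<^sub>R b) = (s - 0) * F b (?p + z *\<^sub>R b)"
          using MVT2[of 0 s "\<lambda>\<tau>. f (?p + \<tau> *\<^sub>R b)" "\<lambda>\<tau>. F b (?p + \<tau> *\<^sub>R b)"] 1 dline by auto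
        then show ?thesis by (intro exI[of _ z]) auto
      next
        case 2
        obtain z where "s < z" "z < 0"
          "f (?p + 0 *\<^sub>R b) - f (?p + s *\<^sub>R b) = (0 - s) * F b (?p + z *\<^sub>R b)"
          using MVT2[of s 0 "\<lambda>\<tau>. f (?p + \<tau> *\<^sub>R b)" "\<lambda>\<tau>. F b (?p + \<tau> *\<^sub>R b)"] 2 dline by auto
        then show ?thesis by (intro exI[of _ z]) auto
      qed
    qed
    then obtain \<tau> where \<tau>: "\<bar>\<tau>\<bar> \<le> \<bar>s\<bar>" "f (?p + s *\<^sub>R b) - f ?p = s * F b (?p + \<tau> *\<^sub>R b)" by blast
    have "?p + \<tau> *\<^sub>R b \<in> U" "dist (?p + \<tau> *\<^sub>R b) x < dd b"
      using near[OF \<tau>(1)] dle(1) dle(2)[OF b(1)] r by (auto simp: dist_commute)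
    then have "\<bar>F b (?p + \<tau> *\<^sub>R b) - F b x\<bar> < \<epsilon>" using dd(2)[OF b(1)] by (auto simp: dist_real_def)
    then have "\<bar>s * F b (?p + \<tau> *\<^sub>R b) - s * F b x\<bar> \<le> \<epsilon> * \<bar>s\<bar>"
      unfolding right_diff_distrib[symmetric] abs_mult
      by (subst mult.commute) (intro mult_right_mono, auto)
    moreover have "f (x + (\<Sum>b\<in>insert b B. (v \<bullet> b) *\<^sub>R b)) = f (?p + s *\<^sub>R b)"
      using insert by (simp add: s_def algebra_simps)
    moreover have "\<bar>f ?p - f x - (\<Sum>b\<in>B. (v \<bullet> b) * F b x)\<bar> \<le> (\<Sum>b\<in>B. \<epsilon> * \<bar>v \<bullet> b\<bar>)"
      using insert b by auto
    moreover have "(\<Sum>b\<in>insert b B. (v \<bullet> b) * F b x) = s * F b x + (\<Sum>b\<in>B. (v \<bullet> b) * F b x)"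
      "(\<Sum>b\<in>insert b B. \<epsilon> * \<bar>v \<bullet> b\<bar>) = \<epsilon> * \<bar>s\<bar> + (\<Sum>b\<in>B. \<epsilon> * \<bar>v \<bullet> b\<bar>)"
      using insert by (simp_all add: s_def)
    ultimately show ?case using \<tau>(2) by linarith
  qed
  show "\<exists>d>0. \<forall>y. norm (y - x) < d \<longrightarrow>
      norm (f y - f x - (\<Sum>b\<in>Basis. ((y - x) \<bullet> b) * F b x)) \<le> e * norm (y - x)"
  proof (intro exI conjI allI impI)
    show "d > 0" by fact
    fix y assume y: "norm (y - x) < d"
    have "\<bar>f y - f x - (\<Sum>b\<in>Basis. ((y - x) \<bullet> b) * F b x)\<bar> \<le> (\<Sum>b\<in>Basis. \<epsilon> * \<bar>(y - x) \<bullet> b\<bar>)"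
      using main[OF y order_refl] by (simp add: euclidean_representation)
    also have "\<dots> \<le> (\<Sum>b\<in>(Basis::'a set). \<epsilon> * norm (y - x))"
      using \<open>\<epsilon> > 0\<close> by (intro sum_mono mult_left_mono Basis_le_norm) auto
    also have "\<dots> = e * norm (y - x)" by (simp add: \<epsilon>_def)
    finally show "norm (f y - f x - (\<Sum>b\<in>Basis. ((y - x) \<bullet> b) * F b x)) \<le> e * norm (y - x)" by simp
  qed
qed

lemma partials_has_derivative:
  assumes "open U" "partials k U f D"
    and "\<And>js. set js \<subseteq> Basis \<Longrightarrow> length js \<le> k \<Longrightarrow> continuous_on U (D js)"
    and "set js \<subseteq> Basis" "length js < k" "x \<in> U"
  shows "(D js has_derivative (\<lambda>v. \<Sum>b\<in>Basis. (v \<bullet> b) * D (b # js) x)) (at x)"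
proof (rule has_derivative_continuous_partials[where F="\<lambda>b. D (b # js)" and f="D js", OF assms(1,6)])
  show "((\<lambda>s. D js (y + s *\<^sub>R b)) has_real_derivative D (b # js) y) (at 0)"
    if "b \<in> Basis" "y \<in> U" for b y
    using assms(2,4,5) that unfolding partials_def by blast
  show "continuous_on U (D (b # js))" if "b \<in> Basis" for b
    using assms(4,5) that by (intro assms(3)) auto
qed

text \<open>\<open>partials\<close> speaks of derivatives at parameter 0 only; a shift gives them
  along the whole line.\<close>

lemma partials_line:
  assumes "partials k U f D" "set js \<subseteq> Basis" "length js < k" "e \<in> Basis" "y + s *\<^sub>R e \<in> U"
  shows "((\<lambda>s. D js (y + s *\<^sub>R e)) has_real_derivative D (e # js) (y + s *\<^sub>R e)) (at s)"
proof -
  have "((\<lambda>\<tau>. D js ((y + s *\<^sub>R e) + \<tau> *\<^sub>R e)) has_real_derivative D (e # js) (y + s *\<^sub>R e)) (at 0)"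
    using assms unfolding partials_def by blast
  then have "((\<lambda>\<tau>. D js (y + (\<tau> + s) *\<^sub>R e)) has_real_derivative D (e # js) (y + s *\<^sub>R e)) (at 0)"
    by (simp add: algebra_simps)
  then show ?thesis using DERIV_shift[of "\<lambda>s. D js (y + s *\<^sub>R e)" "D (e # js) (y + s *\<^sub>R e)" 0 s] by simp
qed

text \<open>The mean value theorem is used twice: in direction \<open>a\<close> for the difference
  in direction \<open>b\<close>, then in direction \<open>b\<close> for the derivative along
  \<open>a\<close>. The point \<open>p\<close> depends on this order, the second difference does
  not.\<close>

lemma partials_second_difference:
  assumes "partials k U f D" "2 \<le> k" and e: "a \<in> Basis" "b \<in> Basis"
    and r: "ball x r \<subseteq> U" "0 < s" "2 * s < r"
  shows "\<exists>p. dist p x \<le> 2 * s \<and>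
    f (x + s *\<^sub>R a + s *\<^sub>R b) - f (x + s *\<^sub>R a) - f (x + s *\<^sub>R b) + f x = s\<^sup>2 * D [b, a] p"
proof -
  have D0: "D [] = f" using assms(1) by (simp add: partials_def)
  have near: "dist (x + \<tau> *\<^sub>R a + \<tau>' *\<^sub>R b) x \<le> 2 * s" if "\<tau> \<in> {0..s}" "\<tau>' \<in> {0..s}" for \<tau> \<tau>'
  proof -
    have "dist (x + \<tau> *\<^sub>R a + \<tau>' *\<^sub>R b) x = norm (\<tau> *\<^sub>R a + \<tau>' *\<^sub>R b)" by (simp add: dist_norm algebra_simps)
    also have "\<dots> \<le> \<bar>\<tau>\<bar> * norm a + \<bar>\<tau>'\<bar> * norm b" by (metis norm_scaleR norm_triangle_ineq)
    also have "\<dots> \<le> 2 * s" using that e by simp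
    finally show ?thesis .
  qed
  have inU: "x + \<tau> *\<^sub>R a + \<tau>' *\<^sub>R b \<in> U" if "\<tau> \<in> {0..s}" "\<tau>' \<in> {0..s}" for \<tau> \<tau>'
    using near[OF that] r by (auto simp: dist_commute subset_iff)
  have inU0: "x + \<tau> *\<^sub>R a \<in> U" if "\<tau> \<in> {0..s}" for \<tau>
    using inU[OF that, of 0] r by auto
  have d: "((\<lambda>\<tau>. f (x + \<tau> *\<^sub>R a + s *\<^sub>R b) - f (x + \<tau> *\<^sub>R a)) has_real_derivative
      D [a] (x + \<tau> *\<^sub>R a + s *\<^sub>R b) - D [a] (x + \<tau> *\<^sub>R a)) (at \<tau>)" if "\<tau> \<in> {0..s}" for \<tau>
  proof (intro DERIV_diff)
    have "((\<lambda>\<tau>. D [] ((x + s *\<^sub>R b) + \<tau> *\<^sub>R a)) has_real_derivative D [a] ((x + s *\<^sub>R b) + \<tau> *\<^sub>R a)) (at \<tau>)"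
      using inU[OF that, of s] r e assms(2) by (intro partials_line[OF assms(1)]) (auto simp: algebra_simps)
    then show "((\<lambda>\<tau>. f (x + \<tau> *\<^sub>R a + s *\<^sub>R b)) has_real_derivative D [a] (x + \<tau> *\<^sub>R a + s *\<^sub>R b)) (at \<tau>)"
      by (simp add: D0 algebra_simps)
    show "((\<lambda>\<tau>. f (x + \<tau> *\<^sub>R a)) has_real_derivative D [a] (x + \<tau> *\<^sub>R a)) (at \<tau>)"
      unfolding D0[symmetric] using inU0[OF that] e assms(2) by (intro partials_line[OF assms(1)]) auto
  qed
  obtain t1 where t1: "0 < t1" "t1 < s"
    "(f (x + s *\<^sub>R a + s *\<^sub>R b) - f (x + s *\<^sub>R a)) - (f (x + 0 *\<^sub>R a + s *\<^sub>R b) - f (x + 0 *\<^sub>R a)) =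
      (s - 0) * (D [a] (x + t1 *\<^sub>R a + s *\<^sub>R b) - D [a] (x + t1 *\<^sub>R a))"
    using MVT2[of 0 s "\<lambda>\<tau>. f (x + \<tau> *\<^sub>R a + s *\<^sub>R b) - f (x + \<tau> *\<^sub>R a)"
        "\<lambda>\<tau>. D [a] (x + \<tau> *\<^sub>R a + s *\<^sub>R b) - D [a] (x + \<tau> *\<^sub>R a)"] d r(2) by auto
  have d': "((\<lambda>\<tau>'. D [a] (x + t1 *\<^sub>R a + \<tau>' *\<^sub>R b)) has_real_derivative
      D [b, a] (x + t1 *\<^sub>R a + \<tau>' *\<^sub>R b)) (at \<tau>')" if "\<tau>' \<in> {0..s}" for \<tau>'
    using inU[OF _ that, of t1] t1 e assms(2) by (intro partials_line[OF assms(1)]) auto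
  obtain t2 where t2: "0 < t2" "t2 < s"
    "D [a] (x + t1 *\<^sub>R a + s *\<^sub>R b) - D [a] (x + t1 *\<^sub>R a + 0 *\<^sub>R b) =
      (s - 0) * D [b, a] (x + t1 *\<^sub>R a + t2 *\<^sub>R b)"
    using MVT2[of 0 s "\<lambda>\<tau>. D [a] (x + t1 *\<^sub>R a + \<tau> *\<^sub>R b)"
        "\<lambda>\<tau>. D [b, a] (x + t1 *\<^sub>R a + \<tau> *\<^sub>R b)"] d' r(2) by auto
  show ?thesis
    using t1 t2 near[of t1 t2] by (intro exI[of _ "x + t1 *\<^sub>R a + t2 *\<^sub>R b"]) (auto simp: power2_eq_square)
qed

text \<open>Schwarz's theorem: by the symmetry of the second difference, the two mixed derivatives
  agree at two points that both tend to \<open>x\<close> with the step size.\<close>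

lemma partials_symmetric:
  assumes "open U" "partials k U f D" "2 \<le> k"
    and cont: "\<And>js. set js \<subseteq> Basis \<Longrightarrow> length js \<le> k \<Longrightarrow> continuous_on U (D js)"
    and e: "a \<in> Basis" "b \<in> Basis" and x: "x \<in> U"
  shows "D [a, b] x = D [b, a] x"
proof -
  obtain r where r: "r > 0" "ball x r \<subseteq> U" using assms(1) x openE by blast
  have cab: "isCont (D [a, b]) x" "isCont (D [b, a]) x"
    using cont[of "[a, b]"] cont[of "[b, a]"] e assms(1,3) x
    by (auto simp: continuous_on_eq_continuous_at)
  \<comment> \<open>Any step sizes tending to 0 with \<open>2 * s n < r\<close> would do.\<close>
  define s where "s n = r / (4 + real n)" for n
  have s: "0 < s n" "2 * s n < r" for n
  proof -
    show "0 < s n" using r by (simp add: s_def)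
    have "2 * r < r * (4 + real n)" using r mult_strict_left_mono[of 2 "4 + real n" r] by (simp add: mult.commute)
    then show "2 * s n < r" using r by (simp add: s_def field_simps)
  qed
  have "\<exists>p q. dist p x \<le> 2 * s n \<and> dist q x \<le> 2 * s n \<and> D [a, b] p = D [b, a] q" for n
  proof -
    obtain p where p: "dist p x \<le> 2 * s n" "f (x + s n *\<^sub>R a + s n *\<^sub>R b) - f (x + s n *\<^sub>R a) - f (x + s n *\<^sub>R b) + f x = (s n)\<^sup>2 * D [b, a] p"
      using partials_second_difference[OF assms(2,3) e r(2) s] by blast
    obtain q where q: "dist q x \<le> 2 * s n" "f (x + s n *\<^sub>R b + s n *\<^sub>R a) - f (x + s n *\<^sub>R b) - f (x + s n *\<^sub>R a) + f x = (s n)\<^sup>2 * D [a, b] q"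
      using partials_second_difference[OF assms(2,3) e(2,1) r(2) s] by blast
    have "(s n)\<^sup>2 * D [a, b] q = (s n)\<^sup>2 * D [b, a] p"
      unfolding p(2)[symmetric] q(2)[symmetric] by (simp add: algebra_simps)
    then show ?thesis using p(1) q(1) s(1)[of n] by auto
  qed
  then obtain p q where pq: "\<And>n. dist (p n) x \<le> 2 * s n" "\<And>n. dist (q n) x \<le> 2 * s n"
    "\<And>n. D [a, b] (p n) = D [b, a] (q n)" by metis
  have s0: "(\<lambda>n. 2 * s n) \<longlonglongrightarrow> 0" unfolding s_def by real_asymp
  have "p \<longlonglongrightarrow> x" "q \<longlonglongrightarrow> x"
    using pq(1,2) by (auto intro!: metric_tendsto_imp_tendsto[OF s0] always_eventually simp: s(1) less_imp_le)
  then have "(\<lambda>n. D [a, b] (p n)) \<longlonglongrightarrow> D [a, b] x" "(\<lambda>n. D [b, a] (q n)) \<longlonglongrightarrow> D [b, a] x"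
    using cab by (auto intro: isCont_tendsto_compose)
  then show ?thesis unfolding pq(3) by (rule LIMSEQ_unique)
qed

section \<open>Jets and Taylor polynomials\<close>

text \<open>The differentials of order 1, 2 and 3 as multilinear forms. They are built from the
  family \<open>D\<close> and not from the function, so that they make sense on the boundary, where
  \<open>D\<close> is a continuous extension.\<close>

definition jet1 :: "('a list \<Rightarrow> 'a \<Rightarrow> real) \<Rightarrow> 'a::euclidean_space \<Rightarrow> 'a \<Rightarrow> real" where
  "jet1 D z v = (\<Sum>b\<in>Basis. (v \<bullet> b) * D [b] z)"

definition jet2 :: "('a list \<Rightarrow> 'a \<Rightarrow> real) \<Rightarrow> 'a::euclidean_space \<Rightarrow> 'a \<Rightarrow> 'a \<Rightarrow> real" where
  "jet2 D z v w = (\<Sum>b\<in>Basis. \<Sum>c\<in>Basis. (v \<bullet> b) * (w \<bullet> c) * D [c, b] z)"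

definition jet3 :: "('a list \<Rightarrow> 'a \<Rightarrow> real) \<Rightarrow> 'a::euclidean_space \<Rightarrow> 'a \<Rightarrow> 'a \<Rightarrow> 'a \<Rightarrow> real" where
  "jet3 D z v w y = (\<Sum>b\<in>Basis. \<Sum>c\<in>Basis. \<Sum>a\<in>Basis. (v \<bullet> b) * (w \<bullet> c) * (y \<bullet> a) * D [a, c, b] z)"

definition taylor2 :: "('a list \<Rightarrow> 'a \<Rightarrow> real) \<Rightarrow> 'a::euclidean_space \<Rightarrow> 'a \<Rightarrow> real" where
  "taylor2 D z y = D [] z + jet1 D z (y - z) + jet2 D z (y - z) (y - z) / 2"

lemma jet3_bound:
  fixes z :: "'a::euclidean_space"
  assumes "\<And>js. set js \<subseteq> Basis \<Longrightarrow> length js = 3 \<Longrightarrow> \<bar>D js z\<bar> \<le> M"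
  shows "\<bar>jet3 D z v w y\<bar> \<le> real DIM('a) ^ 3 * M * norm v * norm w * norm y"
proof -
  have "\<bar>jet3 D z v w y\<bar> \<le> (\<Sum>b\<in>(Basis::'a set). \<Sum>c\<in>(Basis::'a set). \<Sum>a\<in>(Basis::'a set). norm v * norm w * norm y * M)"
    unfolding jet3_def
  proof (intro order_trans[OF sum_abs] sum_mono)
    fix a b c :: 'a assume bas: "a \<in> Basis" "b \<in> Basis" "c \<in> Basis"
    show "\<bar>(v \<bullet> b) * (w \<bullet> c) * (y \<bullet> a) * D [a, c, b] z\<bar> \<le> norm v * norm w * norm y * M"
      unfolding abs_mult using bas by (intro mult_mono Basis_le_norm assms) auto
  qed
  also have "\<dots> = real DIM('a) ^ 3 * M * norm v * norm w * norm y"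
    by (simp add: power3_eq_cube algebra_simps)
  finally show ?thesis .
qed

text \<open>All derivatives of order below three cancel.\<close>

lemma taylor2_base_derivative:
  assumes U: "open U" "p \<in> U" and D: "partials k U f D" "3 \<le> k"
    and cont: "\<And>js. set js \<subseteq> Basis \<Longrightarrow> length js \<le> k \<Longrightarrow> continuous_on U (D js)"
  shows "((\<lambda>p. taylor2 D p y) has_derivative (\<lambda>v. jet3 D p (y - p) (y - p) v / 2)) (at p)"
proof -
  note hd = partials_has_derivative[OF U(1) D(1) cont _ _ U(2)]
  have 0: "(D [] has_derivative (\<lambda>v. \<Sum>b\<in>Basis. (v \<bullet> b) * D [b] p)) (at p)"
    using D(2) by (intro hd) auto
  have 1: "(D [b] has_derivative (\<lambda>v. \<Sum>c\<in>Basis. (v \<bullet> c) * D [c, b] p)) (at p)" if "b \<in> Basis" for b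
    using D(2) that by (intro hd) auto
  have 2: "(D [c, b] has_derivative (\<lambda>v. \<Sum>a\<in>Basis. (v \<bullet> a) * D [a, c, b] p)) (at p)"
    if "b \<in> Basis" "c \<in> Basis" for b c
    using D(2) that by (intro hd) auto
  let ?w = "y - p"
  have I: "((\<lambda>p. (y - p) \<bullet> b) has_derivative (\<lambda>v. - (v \<bullet> b))) (at p)" for b
    by (auto intro!: derivative_eq_intros)
  have J1: "((\<lambda>p. jet1 D p (y - p)) has_derivative
      (\<lambda>v. \<Sum>b\<in>Basis. (?w \<bullet> b) * (\<Sum>c\<in>Basis. (v \<bullet> c) * D [c, b] p) + (- (v \<bullet> b)) * D [b] p)) (at p)"
    unfolding jet1_def by (intro has_derivative_sum has_derivative_mult I 1)
  have J2: "((\<lambda>p. jet2 D p (y - p) (y - p)) has_derivative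
      (\<lambda>v. \<Sum>b\<in>Basis. \<Sum>c\<in>Basis. ((?w \<bullet> b) * (?w \<bullet> c)) * (\<Sum>a\<in>Basis. (v \<bullet> a) * D [a, c, b] p)
         + ((?w \<bullet> b) * (- (v \<bullet> c)) + (- (v \<bullet> b)) * (?w \<bullet> c)) * D [c, b] p)) (at p)"
    unfolding jet2_def by (intro has_derivative_sum has_derivative_mult I 2)
  \<comment> \<open>Differentiating the quadratic term puts \<open>v\<close> into either slot, with
    weight one half each. Only by symmetry do the two together cancel the second-order part that the
    linear term produces.\<close>
  have sym: "(\<Sum>b\<in>Basis. \<Sum>c\<in>Basis. (v \<bullet> b) * (?w \<bullet> c) * D [c, b] p) =
      (\<Sum>b\<in>Basis. \<Sum>c\<in>Basis. (?w \<bullet> b) * (v \<bullet> c) * D [c, b] p)" for v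
  proof (subst sum.swap, intro sum.cong refl)
    fix b c :: 'a assume bc: "b \<in> Basis" "c \<in> Basis"
    then show "(v \<bullet> c) * (?w \<bullet> b) * D [b, c] p = (?w \<bullet> b) * (v \<bullet> c) * D [c, b] p"
      using partials_symmetric[OF U(1) D(1) _ cont _ _ U(2), of b c] D(2) by (simp add: mult_ac)
  qed
  show ?thesis
    unfolding taylor2_def
  proof (rule has_derivative_eq_rhs[OF has_derivative_add[OF has_derivative_add[OF 0 J1]
          bounded_linear.has_derivative[OF bounded_linear_divide[of 2] J2]]])
    show "(\<lambda>v. (\<Sum>b\<in>Basis. (v \<bullet> b) * D [b] p)
        + (\<Sum>b\<in>Basis. (?w \<bullet> b) * (\<Sum>c\<in>Basis. (v \<bullet> c) * D [c, b] p) + (- (v \<bullet> b)) * D [b] p)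
        + (\<Sum>b\<in>Basis. \<Sum>c\<in>Basis. ((?w \<bullet> b) * (?w \<bullet> c)) * (\<Sum>a\<in>Basis. (v \<bullet> a) * D [a, c, b] p)
         + ((?w \<bullet> b) * (- (v \<bullet> c)) + (- (v \<bullet> b)) * (?w \<bullet> c)) * D [c, b] p) / 2)
      = (\<lambda>v. jet3 D p ?w ?w v / 2)" (is "?L = _")
    proof
      fix v
      have "?L v = (\<Sum>b\<in>Basis. \<Sum>c\<in>Basis. (?w \<bullet> b) * (v \<bullet> c) * D [c, b] p)
          + (jet3 D p ?w ?w v - (\<Sum>b\<in>Basis. \<Sum>c\<in>Basis. (?w \<bullet> b) * (v \<bullet> c) * D [c, b] p)
             - (\<Sum>b\<in>Basis. \<Sum>c\<in>Basis. (v \<bullet> b) * (?w \<bullet> c) * D [c, b] p)) / 2"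
        unfolding jet3_def
        by (simp add: sum.distrib sum_subtractf sum_negf sum_distrib_left sum_distrib_right
             left_diff_distrib right_diff_distrib distrib_left distrib_right mult_ac
             del: inner_diff_left inner_diff_right)
      then show "?L v = jet3 D p ?w ?w v / 2" using sym[of v] by (simp add: field_simps)
    qed
  qed
qed

text \<open>Quasiconvexity at small distances, in an explicit form: both points are pushed by the
  same vector \<open>l\<close>, so the detour consists of three segments, and the middle one is a
  translate of the direct one.\<close>

definition segment_connected :: "real \<Rightarrow> real \<Rightarrow> 'a::euclidean_space set \<Rightarrow> bool" where
  "segment_connected \<delta> K U \<longleftrightarrow> (\<forall>x\<in>U. \<forall>y\<in>U. dist x y < \<delta> \<longrightarrow> (\<exists>l. norm l \<le> K * dist x y \<and>
     closed_segment x (x + l) \<subseteq> U \<and> closed_segment (x + l) (y + l) \<subseteq> U \<and> closed_segment (y + l) y \<subseteq> U))"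

lemma continuous_on_taylor2:
  assumes "\<And>js. set js \<subseteq> Basis \<Longrightarrow> length js \<le> 2 \<Longrightarrow> continuous_on S (D js)"
  shows "continuous_on S (\<lambda>p. taylor2 D p y)"
  unfolding taylor2_def jet1_def jet2_def
  using assms by (intro continuous_intros) auto

text \<open>By \<open>taylor2_base_derivative\<close>, moving the base point along a segment costs
  its length times the square of its greatest distance to \<open>y\<close>. Applied to the three
  segments of a detour this gives a cube. Boundary points are reached by limits, since
  differentiation takes place in \<open>U\<close>.\<close>

lemma taylor2_base_change:
  fixes U :: "'a::euclidean_space set"
  assumes U: "open U" and D: "partials k U f D" "3 \<le> k"
    and cont: "\<And>js. set js \<subseteq> Basis \<Longrightarrow> length js \<le> k \<Longrightarrow> continuous_on (closure U) (D js)"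
    and bd: "bounded U"
    and con: "segment_connected \<delta> K U" "0 < \<delta>" "0 \<le> K"
  shows "\<exists>C\<ge>0. \<forall>z\<in>closure U. \<forall>p\<in>closure U. \<forall>y. dist z p < \<delta> \<longrightarrow>
    \<bar>taylor2 D z y - taylor2 D p y\<bar> \<le> C * (dist z p + dist p y) ^ 3"
proof -
  have cpt: "compact (closure U)" using bd by simp
  let ?J = "{js::'a list. set js \<subseteq> Basis \<and> length js = 3}"
  have finJ: "finite ?J" by (rule finite_lists_length_eq) simp
  have "\<exists>B. \<forall>z\<in>closure U. \<bar>D js z\<bar> \<le> B" if "js \<in> ?J" for js
  proof -
    have "compact (D js ` closure U)"
      using that D(2) by (intro compact_continuous_image cont cpt) auto
    then show ?thesis using compact_imp_bounded[of "D js ` closure U"] by (auto simp: bounded_iff)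
  qed
  then obtain B where B: "\<And>js z. js \<in> ?J \<Longrightarrow> z \<in> closure U \<Longrightarrow> \<bar>D js z\<bar> \<le> B js" by metis
  define M where "M = (\<Sum>js\<in>?J. \<bar>B js\<bar>)"
  have M: "\<bar>D js z\<bar> \<le> M" if "set js \<subseteq> Basis" "length js = 3" "z \<in> U" for js z
  proof -
    have "\<bar>D js z\<bar> \<le> \<bar>B js\<bar>" using B[of js z] that closure_subset by fastforce
    also have "\<dots> \<le> M" unfolding M_def using that finJ by (intro member_le_sum) auto
    finally show ?thesis .
  qed
  have M0: "M \<ge> 0" by (auto simp: M_def intro: sum_nonneg)
  \<comment> \<open>The bound of \<open>jet3_bound\<close>, halved as in
    \<open>taylor2_base_derivative\<close>.\<close>
  define N where "N = real DIM('a) ^ 3 * M / 2"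
  have N0: "N \<ge> 0" using M0 by (simp add: N_def)
  have contU: "continuous_on U (D js)" if "set js \<subseteq> Basis" "length js \<le> k" for js
    using cont[OF that] continuous_on_subset closure_subset by blast
  have seg: "\<bar>taylor2 D p y - taylor2 D q y\<bar> \<le> N * R\<^sup>2 * dist p q"
    if "closed_segment p q \<subseteq> U" "\<And>w. w \<in> closed_segment p q \<Longrightarrow> dist w y \<le> R" for p q y R
  proof -
    have "norm (taylor2 D p y - taylor2 D q y) \<le> N * R\<^sup>2 * norm (p - q)"
    proof (rule differentiable_bound[where S="closed_segment p q" and f'="\<lambda>p v. jet3 D p (y - p) (y - p) v / 2"])
      fix w assume w: "w \<in> closed_segment p q"
      then have wU: "w \<in> U" using that by auto
      show "((\<lambda>p. taylor2 D p y) has_derivative (\<lambda>v. jet3 D w (y - w) (y - w) v / 2)) (at w within closed_segment p q)"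
        using taylor2_base_derivative[OF U wU D contU] by (auto intro: has_derivative_at_withinI)
      show "onorm (\<lambda>v. jet3 D w (y - w) (y - w) v / 2) \<le> N * R\<^sup>2"
      proof (rule onorm_le)
        fix v
        have nR: "norm (y - w) \<le> R" using that(2)[OF w] by (simp add: dist_norm norm_minus_commute)
        have "\<bar>jet3 D w (y - w) (y - w) v\<bar> \<le> real DIM('a) ^ 3 * M * norm (y - w) * norm (y - w) * norm v"
          by (rule jet3_bound) (use M wU in auto)
        also have "\<dots> \<le> real DIM('a) ^ 3 * M * R * R * norm v"
          using M0 nR order_trans[OF norm_ge_zero nR] by (intro mult_mono) auto
        finally show "norm (jet3 D w (y - w) (y - w) v / 2) \<le> N * R\<^sup>2 * norm v"
          by (simp add: N_def power2_eq_square)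
      qed
    qed auto
    then show ?thesis by (simp add: dist_norm)
  qed
  \<comment> \<open>A detour has length at most \<open>(2 * K + 1) * dist z p\<close>, and its
    points lie within \<open>(K + 2) * \<rho>\<close> of \<open>y\<close>; this distance enters
    squared.\<close>
  define C where "C = N * (K + 2)\<^sup>2 * (2 * K + 1)"
  have C0: "C \<ge> 0" using N0 con by (simp add: C_def)
  have inner: "\<bar>taylor2 D z y - taylor2 D p y\<bar> \<le> C * (dist z p + dist p y) ^ 3"
    if zp: "z \<in> U" "p \<in> U" "dist z p < \<delta>" for z p y
  proof -
    obtain l where l: "norm l \<le> K * dist z p" "closed_segment z (z + l) \<subseteq> U"
      "closed_segment (z + l) (p + l) \<subseteq> U" "closed_segment (p + l) p \<subseteq> U"
      using con(1) zp unfolding segment_connected_def by blast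
    define \<rho> where "\<rho> = dist z p + dist p y"
    have \<rho>0: "\<rho> \<ge> 0" "dist z p \<le> \<rho>" "dist p y \<le> \<rho>" by (auto simp: \<rho>_def)
    have R: "dist w y \<le> (K + 2) * \<rho>" if "dist w p \<le> (K + 2) * dist z p" for w
    proof -
      have "dist w y \<le> (K + 2) * dist z p + dist p y" using dist_triangle[of w y p] that by linarith
      also have "\<dots> \<le> (K + 2) * dist z p + (K + 2) * dist p y"
        using con(3) mult_right_mono[of 1 "K + 2" "dist p y"] by simp
      also have "\<dots> = (K + 2) * \<rho>" by (simp add: \<rho>_def algebra_simps)
      finally show ?thesis .
    qed
    have zl: "dist z p + norm l \<le> (K + 2) * dist z p" and l2: "norm l \<le> (K + 2) * dist z p"
      using l(1) zero_le_dist[of z p] distrib_right[of K 2 "dist z p"] by linarith+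
    \<comment> \<open>Balls are convex, so only the ends of the three segments have to be
      checked.\<close>
    have far: "dist w p \<le> (K + 2) * dist z p" if "w \<in> closed_segment a b" "dist a p \<le> (K + 2) * dist z p" "dist b p \<le> (K + 2) * dist z p" for w a b
    proof -
      have "closed_segment a b \<subseteq> cball p ((K + 2) * dist z p)"
        using that by (intro closed_segment_subset) (auto simp: dist_commute)
      then show ?thesis using that(1) by (auto simp: dist_commute)
    qed
    have dz: "dist z p \<le> (K + 2) * dist z p" using zl norm_ge_zero[of l] by linarith
    have dzl: "dist (z + l) p \<le> (K + 2) * dist z p"
      using zl norm_triangle_ineq[of "z - p" l] by (simp add: dist_norm algebra_simps)
    have dpl: "dist (p + l) p \<le> (K + 2) * dist z p" using l2 by (simp add: dist_norm)
    have dp: "dist p p \<le> (K + 2) * dist z p" using con by simp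
    have s1: "\<bar>taylor2 D z y - taylor2 D (z + l) y\<bar> \<le> N * ((K + 2) * \<rho>)\<^sup>2 * dist z (z + l)"
      by (intro seg l R far[OF _ dz dzl])
    have s2: "\<bar>taylor2 D (z + l) y - taylor2 D (p + l) y\<bar> \<le> N * ((K + 2) * \<rho>)\<^sup>2 * dist (z + l) (p + l)"
      by (intro seg l R far[OF _ dzl dpl])
    have s3: "\<bar>taylor2 D (p + l) y - taylor2 D p y\<bar> \<le> N * ((K + 2) * \<rho>)\<^sup>2 * dist (p + l) p"
      by (intro seg l R far[OF _ dpl dp])
    have "\<bar>taylor2 D z y - taylor2 D p y\<bar> \<le> N * ((K + 2) * \<rho>)\<^sup>2 * (norm l + dist z p + norm l)"
      using s1 s2 s3 by (simp add: dist_norm algebra_simps)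
    also have "\<dots> \<le> N * ((K + 2) * \<rho>)\<^sup>2 * ((2 * K + 1) * \<rho>)"
    proof (intro mult_left_mono)
      have "norm l + dist z p + norm l \<le> (2 * K + 1) * dist z p" using l(1) by (simp add: algebra_simps)
      also have "\<dots> \<le> (2 * K + 1) * \<rho>" using con \<rho>0 by (intro mult_left_mono) auto
      finally show "norm l + dist z p + norm l \<le> (2 * K + 1) * \<rho>" .
    qed (use N0 in auto)
    also have "\<dots> = C * \<rho> ^ 3" by (simp add: C_def power2_eq_square power3_eq_cube)
    finally show ?thesis by (simp add: \<rho>_def)
  qed
  \<comment> \<open>Approximation from inside: as \<open>dist z p < \<delta>\<close> is strict, the
    approximating pairs satisfy it eventually.\<close>
  have "\<bar>taylor2 D z y - taylor2 D p y\<bar> \<le> C * (dist z p + dist p y) ^ 3"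
    if zp: "z \<in> closure U" "p \<in> closure U" "dist z p < \<delta>" for z p y
  proof -
    obtain zs where zs: "\<And>n. zs n \<in> U" "zs \<longlonglongrightarrow> z" using zp(1) closure_sequential by blast
    obtain ps where ps: "\<And>n. ps n \<in> U" "ps \<longlonglongrightarrow> p" using zp(2) closure_sequential by blast
    have c: "continuous_on (closure U) (\<lambda>p. taylor2 D p y)"
      using D by (intro continuous_on_taylor2 cont) auto
    have L: "(\<lambda>n. \<bar>taylor2 D (zs n) y - taylor2 D (ps n) y\<bar>) \<longlonglongrightarrow> \<bar>taylor2 D z y - taylor2 D p y\<bar>"
      using zs ps zp closure_subset
      by (intro tendsto_intros continuous_on_tendsto_compose[OF c]) (auto intro!: always_eventually)
    have R: "(\<lambda>n. C * (dist (zs n) (ps n) + dist (ps n) y) ^ 3) \<longlonglongrightarrow> C * (dist z p + dist p y) ^ 3"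
      by (intro tendsto_intros zs ps)
    have "(\<lambda>n. dist (zs n) (ps n)) \<longlonglongrightarrow> dist z p" by (intro tendsto_intros zs ps)
    then have "eventually (\<lambda>n. dist (zs n) (ps n) < \<delta>) sequentially" using zp(3) by (rule order_tendstoD)
    then have "eventually (\<lambda>n. \<bar>taylor2 D (zs n) y - taylor2 D (ps n) y\<bar> \<le> C * (dist (zs n) (ps n) + dist (ps n) y) ^ 3) sequentially"
      by eventually_elim (intro inner zs ps)
    then show ?thesis using tendsto_le[OF _ R L] by simp
  qed
  then show ?thesis using C0 by blast
qed

section \<open>Domains with smooth boundary\<close>

lemma bounded_partials_lipschitz:
  fixes f :: "'a::euclidean_space \<Rightarrow> real"
  assumes "convex S" and f: "\<And>w. w \<in> S \<Longrightarrow> (f has_derivative (\<lambda>v. \<Sum>b\<in>Basis. (v \<bullet> b) * F b w)) (at w)"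
    and B: "\<And>b w. b \<in> Basis \<Longrightarrow> w \<in> S \<Longrightarrow> \<bar>F b w\<bar> \<le> B b"
    and "x \<in> S" "y \<in> S"
  shows "\<bar>f x - f y\<bar> \<le> (\<Sum>b\<in>Basis. \<bar>B b\<bar>) * dist x y"
proof -
  have "norm (f x - f y) \<le> (\<Sum>b\<in>Basis. \<bar>B b\<bar>) * norm (x - y)"
  proof (rule differentiable_bound[OF assms(1)])
    fix w assume w: "w \<in> S"
    show "(f has_derivative (\<lambda>v. \<Sum>b\<in>Basis. (v \<bullet> b) * F b w)) (at w within S)"
      using f[OF w] by (rule has_derivative_at_withinI)
    show "onorm (\<lambda>v. \<Sum>b\<in>Basis. (v \<bullet> b) * F b w) \<le> (\<Sum>b\<in>Basis. \<bar>B b\<bar>)"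
    proof (rule onorm_le)
      fix v :: 'a
      have "\<bar>\<Sum>b\<in>Basis. (v \<bullet> b) * F b w\<bar> \<le> (\<Sum>b\<in>Basis. norm v * \<bar>B b\<bar>)"
      proof (intro order_trans[OF sum_abs] sum_mono)
        fix b :: 'a assume b: "b \<in> Basis"
        have "\<bar>F b w\<bar> \<le> \<bar>B b\<bar>" using B[OF b w] by linarith
        then show "\<bar>v \<bullet> b * F b w\<bar> \<le> norm v * \<bar>B b\<bar>"
          unfolding abs_mult using b by (intro mult_mono Basis_le_norm) auto
      qed
      then show "norm (\<Sum>b\<in>Basis. (v \<bullet> b) * F b w) \<le> (\<Sum>b\<in>Basis. \<bar>B b\<bar>) * norm v"
        by (simp add: sum_distrib_left mult.commute)
    qed
  qed fact+
  then show ?thesis by (simp add: dist_norm)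
qed

lemma local_graph_derivative:
  fixes f :: "real^'d \<Rightarrow> real"
  assumes "local_graph k \<epsilon> G z r i s f" "1 \<le> k"
  obtains F where "\<And>x. x \<in> ball z r \<Longrightarrow> (f has_derivative (\<lambda>v. \<Sum>b\<in>Basis. (v \<bullet> b) * F b x)) (at x)"
    "\<And>b. b \<in> Basis \<Longrightarrow> continuous_on (cball z r) (F b)"
proof -
  have r: "r > 0" using assms by (simp add: local_graph_def)
  obtain D where D: "partials k (ball z r) f D"
    "\<And>js. set js \<subseteq> Basis \<Longrightarrow> length js \<le> k \<Longrightarrow> continuous_on (closure (ball z r)) (D js)"
    using assms unfolding local_graph_def holder_space_def by blast
  have D0: "D [] = f" using D by (simp add: partials_def)
  show ?thesis
  proof (rule that[where F="\<lambda>b. D [b]"])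
    show "(f has_derivative (\<lambda>v. \<Sum>b\<in>Basis. (v \<bullet> b) * D [b] x)) (at x)" if "x \<in> ball z r" for x
      unfolding D0[symmetric]
      using that assms(2) continuous_on_subset[OF D(2) closure_subset]
      by (intro partials_has_derivative[OF open_ball D(1)]) auto
    show "continuous_on (cball z r) (D [b])" if "b \<in> Basis" for b
      using D(2)[of "[b]"] that assms(2) r by simp
  qed
qed

lemma local_graph_lipschitz:
  fixes f :: "real^'d \<Rightarrow> real"
  assumes "local_graph k \<epsilon> G z r i s f" "1 \<le> k"
  shows "\<exists>L\<ge>0. \<forall>x\<in>ball z r. \<forall>y\<in>ball z r. \<bar>f x - f y\<bar> \<le> L * dist x y"
proof -
  obtain F where F: "\<And>x. x \<in> ball z r \<Longrightarrow> (f has_derivative (\<lambda>v. \<Sum>b\<in>Basis. (v \<bullet> b) * F b x)) (at x)"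
    "\<And>b. b \<in> Basis \<Longrightarrow> continuous_on (cball z r) (F b)"
    using local_graph_derivative[OF assms] by blast
  have "\<exists>B. \<forall>x\<in>cball z r. \<bar>F b x\<bar> \<le> B" if "b \<in> Basis" for b
    using compact_imp_bounded[OF compact_continuous_image[OF F(2)[OF that] compact_cball]]
    by (auto simp: bounded_iff)
  then obtain B where B: "\<And>b x. b \<in> Basis \<Longrightarrow> x \<in> cball z r \<Longrightarrow> \<bar>F b x\<bar> \<le> B b" by metis
  define L where "L = (\<Sum>b\<in>(Basis::(real^'d) set). \<bar>B b\<bar>)"
  show ?thesis
  proof (intro exI[of _ L] conjI ballI)
    show "0 \<le> L" by (simp add: L_def sum_nonneg)
    fix x y assume "x \<in> ball z r" "y \<in> ball z r"
    then show "\<bar>f x - f y\<bar> \<le> L * dist x y"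
      unfolding L_def by (rule bounded_partials_lipschitz[OF convex_ball[of z r] F(1) B, rotated -2]) auto
  qed
qed

text \<open>Along the segment from \<open>x\<close> to \<open>y\<close> the graph of an
  \<open>L\<close>-Lipschitz function rises by at most \<open>L * dist x y\<close> and the height
  drops by at most \<open>dist x y\<close>, so a lift by \<open>(L + 1) * dist x y\<close> clears
  the graph. The vertical moves lead away from the graph.\<close>

lemma local_graph_segments:
  fixes G :: "(real^'d) set"
  assumes "local_graph k \<epsilon> G z r i s f" "1 \<le> k"
  shows "\<exists>\<rho>>0. \<exists>K\<ge>0. \<forall>x\<in>G \<inter> ball z \<rho>. \<forall>y\<in>G \<inter> ball z \<rho>. \<exists>l. norm l \<le> K * dist x y \<and>
     closed_segment x (x + l) \<subseteq> G \<and> closed_segment (x + l) (y + l) \<subseteq> G \<and> closed_segment (y + l) y \<subseteq> G"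
proof -
  obtain L where L: "0 \<le> L" "\<And>x y. x \<in> ball z r \<Longrightarrow> y \<in> ball z r \<Longrightarrow> \<bar>f x - f y\<bar> \<le> L * dist x y"
    using local_graph_lipschitz[OF assms] by blast
  have r: "r > 0" and s: "s = -1 \<or> s = 1"
    and flat: "\<And>x y. (\<And>j. j \<noteq> i \<Longrightarrow> x $ j = y $ j) \<Longrightarrow> f x = f y"
    and G: "G \<inter> ball z r = {x \<in> ball z r. f x < s * x $ i}"
    using assms unfolding local_graph_def by blast+
  \<comment> \<open>The upward direction of the chart, with sign \<open>s\<close>.\<close>
  let ?e = "axis i s :: real^'d"
  have ne: "norm ?e = 1" using s by (auto simp: norm_eq_1 inner_axis)
  have fe: "f (x + c *\<^sub>R ?e) = f x" for x c by (rule flat) (auto simp: axis_def)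
  have se: "s * (x + c *\<^sub>R ?e) $ i = s * x $ i + c" for x c using s by (auto simp: axis_def algebra_simps)
  have GI: "x + c *\<^sub>R ?e \<in> G" if "x + c *\<^sub>R ?e \<in> ball z r" "f x < s * x $ i + c" for x c
  proof -
    have "f (x + c *\<^sub>R ?e) < s * (x + c *\<^sub>R ?e) $ i" unfolding fe se by (rule that(2))
    then show ?thesis using that(1) G by blast
  qed
  \<comment> \<open>Points of the ball of radius \<open>\<rho>\<close> are less than
    \<open>2 * \<rho>\<close> apart, so the lift is below \<open>(2 * L + 2) * \<rho>\<close> and
    ends inside \<open>ball z r\<close>.\<close>
  define \<rho> where "\<rho> = r / (2 * L + 4)"
  have \<rho>: "\<rho> > 0" "(2 * L + 4) * \<rho> = r" using r L by (auto simp: \<rho>_def field_simps add_pos_nonneg)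
  have "\<exists>l. norm l \<le> (L + 1) * dist x y \<and>
     closed_segment x (x + l) \<subseteq> G \<and> closed_segment (x + l) (y + l) \<subseteq> G \<and> closed_segment (y + l) y \<subseteq> G"
    if xy: "x \<in> G \<inter> ball z \<rho>" "y \<in> G \<inter> ball z \<rho>" for x y
  proof -
    define d where "d = dist x y"
    define l where "l = ((L + 1) * d) *\<^sub>R ?e"
    have nl: "norm l = (L + 1) * d" using L ne by (simp add: l_def d_def)
    have "\<rho> \<le> r" using \<rho>(2) mult_right_mono[of 1 "2 * L + 4" \<rho>] L \<rho>(1) by auto
    then have inr: "x \<in> ball z r" "y \<in> ball z r" using xy by auto
    have "d < 2 * \<rho>" using xy dist_triangle2[of x y z] by (auto simp: d_def dist_commute)
    then have "(L + 1) * d \<le> (L + 1) * (2 * \<rho>)" using L by (intro mult_left_mono) auto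
    then have room: "(L + 1) * d + \<rho> \<le> r" using \<rho> by (simp add: algebra_simps)
    have ball: "w + c *\<^sub>R ?e \<in> ball z r" if "w \<in> ball z \<rho>" "0 \<le> c" "c \<le> (L + 1) * d" for w c
    proof -
      have "dist z (w + c *\<^sub>R ?e) \<le> dist z w + c"
        using dist_triangle[of z "w + c *\<^sub>R ?e" w] that ne by (simp add: dist_norm)
      then show ?thesis using that room by simp
    qed
    have vertical: "closed_segment w (w + l) \<subseteq> G" if "w \<in> G \<inter> ball z \<rho>" for w
    proof
      fix q assume "q \<in> closed_segment w (w + l)"
      then obtain \<theta> where \<theta>: "0 \<le> \<theta>" "\<theta> \<le> 1" "q = w + \<theta> *\<^sub>R l"
        unfolding closed_segment_def by (auto simp: algebra_simps)
      define c where "c = \<theta> * ((L + 1) * d)"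
      have c: "0 \<le> c" "c \<le> (L + 1) * d" using \<theta> L by (auto simp: c_def d_def mult_left_le_one_le)
      have q: "q = w + c *\<^sub>R ?e" by (simp add: \<theta> l_def c_def)
      have "w \<in> ball z r" using that \<open>\<rho> \<le> r\<close> by auto
      then have "f w < s * w $ i" using G that by blast
      then show "q \<in> G" unfolding q using ball[OF _ c, of w] that c by (intro GI) auto
    qed
    have "closed_segment (x + l) (y + l) \<subseteq> G"
    proof
      fix q assume "q \<in> closed_segment (x + l) (y + l)"
      then obtain \<theta> where \<theta>: "0 \<le> \<theta>" "\<theta> \<le> 1" "q = x + \<theta> *\<^sub>R (y - x) + l"
        unfolding closed_segment_def by (auto simp: algebra_simps)
      define w where "w = x + \<theta> *\<^sub>R (y - x)"
      have "w \<in> closed_segment x y" unfolding in_segment w_def using \<theta> by (intro exI[of _ \<theta>]) (auto simp: algebra_simps)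
      then have wb: "w \<in> ball z \<rho>" using xy closed_segment_subset[OF _ _ convex_ball, of x z \<rho> y] by blast
      have dxw: "dist w x \<le> d"
        using \<theta> mult_right_mono[of \<theta> 1 "norm (y - x)"] by (simp add: w_def d_def dist_norm norm_minus_commute)
      have "f w \<le> f x + L * dist w x" using L(2)[of w x] wb \<open>\<rho> \<le> r\<close> inr by auto
      also have "\<dots> \<le> f x + L * d" using dxw L by (simp add: mult_left_mono)
      also have "\<dots> < s * x $ i + L * d"
      proof -
        have "f x < s * x $ i" using G xy inr by blast
        then show ?thesis by simp
      qed
      finally have "f w < s * x $ i + L * d" .
      moreover have "s * x $ i - d \<le> s * w $ i"
      proof -
        have "\<bar>w $ i - x $ i\<bar> \<le> d" using component_le_norm_cart[of "w - x" i] dxw by (simp add: dist_norm)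
        then show ?thesis using s by auto
      qed
      ultimately have "f w < s * w $ i + (L + 1) * d" by (simp add: algebra_simps)
      moreover have "w + ((L + 1) * d) *\<^sub>R ?e \<in> ball z r"
        using L by (intro ball[OF wb]) (auto simp: d_def)
      moreover have "q = w + ((L + 1) * d) *\<^sub>R ?e" by (simp add: \<theta>(3) w_def l_def)
      ultimately show "q \<in> G" using GI by simp
    qed
    then show ?thesis using vertical[OF xy(1)] vertical[OF xy(2)] nl
      by (intro exI[of _ l]) (auto simp: d_def closed_segment_commute)
  qed
  then show ?thesis using \<rho> L by (intro exI[of _ \<rho>] conjI exI[of _ "L + 1"]) auto
qed

text \<open>A Lebesgue number argument: \<open>closure G\<close> is covered by finitely many balls
  of half the admissible radius, and two points closer than the least of these half radii lie in one
  ball of full radius. Around a point of \<open>G\<close> the ball is convex and the lift is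
  zero.\<close>

lemma holder_boundary_segment_connected:
  fixes G :: "(real^'d) set"
  assumes G: "open G" "bounded G" and k: "holder_boundary k \<epsilon> G" "1 \<le> k"
  obtains \<delta> K where "0 < \<delta>" "0 \<le> K" "segment_connected \<delta> K G"
proof -
  let ?P = "\<lambda>K x y. \<exists>l. norm l \<le> K * dist x y \<and>
     closed_segment x (x + l) \<subseteq> G \<and> closed_segment (x + l) (y + l) \<subseteq> G \<and> closed_segment (y + l) y \<subseteq> G"
  have "\<exists>\<rho>>0. \<exists>K\<ge>0. \<forall>x\<in>G \<inter> ball z \<rho>. \<forall>y\<in>G \<inter> ball z \<rho>. ?P K x y" if z: "z \<in> closure G" for z
  proof (cases "z \<in> G")
    case True
    then obtain \<rho> where \<rho>: "\<rho> > 0" "ball z \<rho> \<subseteq> G" using G openE by blast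
    have "?P 0 x y" if "x \<in> ball z \<rho>" "y \<in> ball z \<rho>" for x y
    proof (intro exI[of _ 0] conjI)
      show "closed_segment (x + 0) (y + 0) \<subseteq> G"
        using \<rho> that closed_segment_subset[OF that convex_ball] by simp
    qed (use \<rho> that in auto)
    then show ?thesis using \<rho> by (intro exI[of _ \<rho>] conjI exI[of _ 0]) auto
  next
    case False
    then have "z \<in> frontier G" using z G by (simp add: frontier_def interior_open)
    then obtain r i s f where "local_graph k \<epsilon> G z r i s f" using k unfolding holder_boundary_def by blast
    from local_graph_segments[OF this k(2)] show ?thesis .
  qed
  then have "\<forall>z\<in>closure G. \<exists>q. fst q > 0 \<and> snd q \<ge> 0 \<and>
      (\<forall>x\<in>G \<inter> ball z (fst q). \<forall>y\<in>G \<inter> ball z (fst q). ?P (snd q) x y)" by simp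
  from bchoice[OF this] obtain q where q: "\<forall>z\<in>closure G. fst (q z) > 0 \<and> snd (q z) \<ge> 0 \<and>
      (\<forall>x\<in>G \<inter> ball z (fst (q z)). \<forall>y\<in>G \<inter> ball z (fst (q z)). ?P (snd (q z)) x y)" by blast
  define \<rho> where "\<rho> z = fst (q z)" for z
  define K where "K z = snd (q z)" for z
  have \<rho>: "\<rho> z > 0" and K: "0 \<le> K z" if "z \<in> closure G" for z using q that by (auto simp: \<rho>_def K_def)
  have P: "?P (K z) x y"
    if "z \<in> closure G" "x \<in> G \<inter> ball z (\<rho> z)" "y \<in> G \<inter> ball z (\<rho> z)" for z x y
    using q that unfolding \<rho>_def K_def by blast
  have cpt: "compact (closure G)" using G by simp
  have cover: "closure G \<subseteq> (\<Union>z\<in>closure G. ball z (\<rho> z / 2))" using \<rho> by force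
  obtain F where F: "F \<subseteq> closure G" "finite F" "closure G \<subseteq> (\<Union>z\<in>F. ball z (\<rho> z / 2))"
    by (rule compactE_image[OF cpt _ cover]) auto
  \<comment> \<open>The 1 keeps the set nonempty when the cover is empty.\<close>
  define \<delta> where "\<delta> = Min (insert 1 ((\<lambda>z. \<rho> z / 2) ` F))"
  define KK where "KK = (\<Sum>z\<in>F. K z)"
  have \<delta>: "\<delta> > 0" using F \<rho> by (auto simp: \<delta>_def)
  have \<delta>le: "\<delta> \<le> \<rho> z / 2" if "z \<in> F" for z unfolding \<delta>_def using F that by (intro Min_le) auto
  have KK: "\<And>z. z \<in> F \<Longrightarrow> K z \<le> KK" unfolding KK_def using F K by (intro member_le_sum) auto
  have "segment_connected \<delta> KK G"
    unfolding segment_connected_def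
  proof (intro ballI impI)
    fix x y assume xy: "x \<in> G" "y \<in> G" "dist x y < \<delta>"
    then obtain z where z: "z \<in> F" "dist z x < \<rho> z / 2" using F(3) closure_subset[of G] by fastforce
    have "dist z y < \<rho> z" using dist_triangle[of z y x] z xy \<delta>le[OF z(1)] by linarith
    then have "?P (K z) x y"
      using z xy F(1) \<rho>[of z] by (intro P) auto
    then obtain l where "norm l \<le> K z * dist x y" and l:
     "closed_segment x (x + l) \<subseteq> G \<and> closed_segment (x + l) (y + l) \<subseteq> G \<and> closed_segment (y + l) y \<subseteq> G" by blast
    moreover have "K z * dist x y \<le> KK * dist x y" using KK[OF z(1)] by (intro mult_right_mono) auto
    ultimately show "?P KK x y" by (intro exI[of _ l]) auto
  qed
  moreover have "0 \<le> KK" unfolding KK_def using F K by (intro sum_nonneg) auto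
  ultimately show ?thesis using that \<delta> by blast
qed

text \<open>Only the space component is lifted: up at the first time, across in space and time
  together, down at the second time.\<close>

lemma segment_connected_Times:
  fixes A :: "'a::euclidean_space set" and G :: "'b::euclidean_space set"
  assumes "convex A" "segment_connected \<delta> K G" "0 \<le> K"
  shows "segment_connected \<delta> K (A \<times> G)"
  unfolding segment_connected_def
proof (intro ballI impI)
  fix z w :: "'a \<times> 'b" assume zw: "z \<in> A \<times> G" "w \<in> A \<times> G" "dist z w < \<delta>"
  obtain t x where z: "z = (t, x)" by (cases z)
  obtain s y where w: "w = (s, y)" by (cases w)
  have d: "dist x y \<le> dist z w" using dist_snd_le[of z w] by (simp add: z w)
  then obtain l where l: "norm l \<le> K * dist x y"
     "closed_segment x (x + l) \<subseteq> G" "closed_segment (x + l) (y + l) \<subseteq> G" "closed_segment (y + l) y \<subseteq> G"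
    using assms(2) zw unfolding segment_connected_def by (force simp: z w)
  have prod: "closed_segment (a, b) (c, d) \<subseteq> A \<times> G"
    if "a \<in> A" "c \<in> A" "closed_segment b d \<subseteq> G" for a b c d
    using closed_segment_subset[OF that(1,2) assms(1)] that(3) by (auto dest!: closed_segment_PairD)
  have "K * dist x y \<le> K * dist z w" using d assms by (intro mult_left_mono)
  then show "\<exists>l. norm l \<le> K * dist z w \<and> closed_segment z (z + l) \<subseteq> A \<times> G \<and>
      closed_segment (z + l) (w + l) \<subseteq> A \<times> G \<and> closed_segment (w + l) w \<subseteq> A \<times> G"
    using zw l prod[of t t x "x + l"] prod[of t s "x + l" "y + l"] prod[of s s "y + l" y]
    by (intro exI[of _ "(0, l)"] conjI) (simp_all add: z w norm_Pair)
qed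

section \<open>Boundary charts, tangents and normals\<close>

lemma graph_point_eq: "graph_point i s f x = x + (s * f x - x $ i) *\<^sub>R axis i 1"
  by (auto simp: graph_point_def vec_eq_iff axis_def)

lemma graph_point_nth: "graph_point i s f x $ j = (if j = i then s * f x else x $ j)"
  by (simp add: graph_point_def)

lemma local_graph_continuous:
  assumes "local_graph k \<epsilon> G z r i s f"
  shows "continuous_on (ball z r) f"
proof -
  obtain D where D: "partials k (ball z r) f D"
    "\<And>js. set js \<subseteq> Basis \<Longrightarrow> length js \<le> k \<Longrightarrow> continuous_on (closure (ball z r)) (D js)"
    using assms unfolding local_graph_def holder_space_def by blast
  have D0: "D [] = f" using D by (simp add: partials_def)
  show ?thesis using continuous_on_subset[OF D(2)[of "[]"] closure_subset] unfolding D0 by simp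
qed

text \<open>The chart describes \<open>G\<close> alone, so the frontier has to be inferred. A
  frontier point misses the open set \<open>G\<close>, which gives one inequality, and approximation
  from \<open>G\<close> gives the other. Conversely, points just above the graph lie in
  \<open>G\<close>.\<close>

lemma local_graph_frontier_iff:
  fixes G :: "(real^'d) set"
  assumes lg: "local_graph k \<epsilon> G z r i s f" and G: "open G" and p: "p \<in> ball z r"
  shows "p \<in> frontier G \<longleftrightarrow> f p = s * p $ i"
proof -
  have r: "r > 0" and s: "s = -1 \<or> s = 1"
    and flat: "\<And>x y. (\<And>j. j \<noteq> i \<Longrightarrow> x $ j = y $ j) \<Longrightarrow> f x = f y"
    and Geq: "G \<inter> ball z r = {x \<in> ball z r. f x < s * x $ i}"
    using lg unfolding local_graph_def by blast+
  have memG: "q \<in> G \<longleftrightarrow> f q < s * q $ i" if "q \<in> ball z r" for q using Geq that by blast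
  have fr: "p \<in> frontier G \<longleftrightarrow> p \<in> closure G \<and> p \<notin> G" using G by (simp add: frontier_def interior_open)
  show ?thesis
  proof
    assume "p \<in> frontier G"
    then have pc: "p \<in> closure G" "p \<notin> G" using fr by auto
    have ge: "f p \<ge> s * p $ i" using pc(2) memG[OF p] by simp
    obtain q where q: "\<And>n. q n \<in> G" "q \<longlonglongrightarrow> p" using pc(1) closure_sequential by blast
    have ev: "eventually (\<lambda>n. q n \<in> ball z r) sequentially"
      using q(2) open_ball p by (rule topological_tendstoD)
    have "isCont f p" using local_graph_continuous[OF lg] p by (simp add: continuous_on_eq_continuous_at)
    then have "(\<lambda>n. f (q n)) \<longlonglongrightarrow> f p" using q(2) by (rule isCont_tendsto_compose)
    moreover have "(\<lambda>n. s * q n $ i) \<longlonglongrightarrow> s * p $ i" by (intro tendsto_intros q)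
    moreover have "eventually (\<lambda>n. f (q n) \<le> s * q n $ i) sequentially"
      using ev
    proof eventually_elim
      case (elim n)
      then show ?case using memG q by force
    qed
    ultimately have "f p \<le> s * p $ i" by (intro tendsto_le[OF sequentially_bot])
    then show "f p = s * p $ i" using ge by simp
  next
    assume eq: "f p = s * p $ i"
    have "p \<notin> G" using memG[OF p] eq by simp
    moreover have "p \<in> closure G"
      unfolding closure_approachable
    proof (intro allI impI)
      fix e :: real assume "e > 0"
      define c where "c = min e (r - dist z p) / 2"
      have c: "c > 0" "c < e" "c < r - dist z p" using \<open>e > 0\<close> p by (auto simp: c_def)
      let ?q = "p + c *\<^sub>R axis i s"
      have "norm (axis i s :: real^'d) = 1" using s by (auto simp: norm_eq_1 inner_axis)
      then have d: "dist p ?q = c" using c by (simp add: dist_norm)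
      have "?q \<in> ball z r" using dist_triangle[of z ?q p] d c by simp
      moreover have "f ?q = f p" by (rule flat) (auto simp: axis_def)
      moreover have "s * ?q $ i = s * p $ i + c" using s by (auto simp: axis_def algebra_simps)
      ultimately have "?q \<in> G" using memG[of ?q] eq c by simp
      then show "\<exists>y\<in>G. dist y p < e" using d c by (intro bexI[of _ ?q]) (auto simp: dist_commute)
    qed
    ultimately show "p \<in> frontier G" using fr by simp
  qed
qed

text \<open>This is why the definitions of boundary regularity say something about the function
  itself: on the frontier near \<open>z\<close>, composing it with the chart changes
  nothing.\<close>

lemma local_graph_graph_point:
  assumes lg: "local_graph k \<epsilon> G z r i s f" and G: "open G" and p: "p \<in> frontier G \<inter> ball z r"
  shows "graph_point i s f p = p"
proof -
  have "s * s = 1" using lg by (auto simp: local_graph_def)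
  moreover have "f p = s * p $ i" using local_graph_frontier_iff[OF lg G] p by blast
  ultimately have "s * f p = p $ i" by (metis mult.assoc mult_1)
  then show ?thesis by (simp add: graph_point_eq)
qed

text \<open>The straight line through \<open>z\<close> in direction \<open>w\<close> is lifted to
  the graph. By the condition on \<open>w\<close> the correction along axis \<open>i\<close> has
  derivative 0, so the lifted curve still has velocity \<open>w\<close>.\<close>

lemma local_graph_tangent:
  fixes G :: "(real^'d) set"
  assumes lg: "local_graph k \<epsilon> G z r i s f" and G: "open G" and z: "z \<in> frontier G"
    and f': "(f has_derivative f') (at z)" and w: "f' w = s * w $ i"
  shows "w \<in> tangent_vectors G z"
proof -
  have r: "r > 0" and s: "s = -1 \<or> s = 1"
    and flat: "\<And>x y. (\<And>j. j \<noteq> i \<Longrightarrow> x $ j = y $ j) \<Longrightarrow> f x = f y"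
    using lg unfolding local_graph_def by blast+
  define q where "q \<tau> = graph_point i s f (z + \<tau> *\<^sub>R w)" for \<tau> :: real
  have gz: "graph_point i s f z = z" using local_graph_graph_point[OF lg G] z r by simp
  have q0: "q 0 = z" using gz by (simp add: q_def)
  have dl: "((\<lambda>\<tau>. z + \<tau> *\<^sub>R w) has_derivative (\<lambda>\<tau>. \<tau> *\<^sub>R w)) (at 0)" by (auto intro!: derivative_eq_intros)
  have df: "((\<lambda>\<tau>. f (z + \<tau> *\<^sub>R w)) has_derivative (\<lambda>\<tau>. f' (\<tau> *\<^sub>R w))) (at 0)"
    using diff_chain_at[OF dl, of f f'] f' by (simp add: o_def)
  have lin: "f' (\<tau> *\<^sub>R w) = \<tau> * f' w" for \<tau>
    using has_derivative_linear[OF f'] by (simp add: linear_cmul)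
  have "((\<lambda>\<tau>. f (z + \<tau> *\<^sub>R w)) has_real_derivative f' w) (at 0)"
    using df by (rule has_derivative_imp_has_field_derivative) (simp add: lin mult.commute)
  then have "((\<lambda>\<tau>. s * f (z + \<tau> *\<^sub>R w) - (z + \<tau> *\<^sub>R w) $ i) has_real_derivative s * f' w - w $ i) (at 0)"
    by (auto intro!: derivative_eq_intros)
  moreover have "s * f' w - w $ i = 0" using w s by auto
  ultimately have dn: "((\<lambda>\<tau>. s * f (z + \<tau> *\<^sub>R w) - (z + \<tau> *\<^sub>R w) $ i) has_real_derivative 0) (at 0)" by simp
  have dq: "(q has_vector_derivative w) (at 0)"
  proof -
    have "((\<lambda>\<tau>. z + \<tau> *\<^sub>R w) has_vector_derivative w) (at 0)"
      using dl by (simp add: has_vector_derivative_def)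
    from has_vector_derivative_add[OF this has_vector_derivative_scaleR[OF dn has_vector_derivative_const[of "axis i 1 :: real^'d"]]]
    show ?thesis unfolding q_def graph_point_eq by simp
  qed
  have cq: "continuous (at 0) q" by (rule has_vector_derivative_continuous[OF dq])
  have "eventually (\<lambda>\<tau>. q \<tau> \<in> ball z r) (nhds 0)"
  proof -
    have "(q \<longlongrightarrow> q 0) (at 0)" using cq by (simp add: continuous_within)
    then have "eventually (\<lambda>\<tau>. q \<tau> \<in> ball z r) (at 0)"
      by (rule topological_tendstoD) (use q0 r in auto)
    then show ?thesis using q0 r by (auto simp: eventually_at_filter elim!: eventually_mono)
  qed
  then obtain \<eta> where \<eta>: "\<eta> > 0" "\<And>\<tau>. dist \<tau> 0 < \<eta> \<Longrightarrow> q \<tau> \<in> ball z r"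
    unfolding eventually_nhds_metric by blast
  \<comment> \<open>\<open>tangent_vectors\<close> asks for a curve on the frontier at all real
    times; outside a short interval this one rests at \<open>z\<close>.\<close>
  define p where "p \<tau> = (if \<tau> \<in> ball 0 \<eta> then q \<tau> else z)" for \<tau>
  have "p \<tau> \<in> frontier G" for \<tau>
  proof (cases "\<tau> \<in> ball 0 \<eta>")
    case True
    then have "q \<tau> \<in> ball z r" using \<eta> by (auto simp: dist_commute)
    moreover have "f (q \<tau>) = f (z + \<tau> *\<^sub>R w)" by (rule flat) (simp add: q_def graph_point_nth)
    moreover have "s * q \<tau> $ i = f (z + \<tau> *\<^sub>R w)" using s by (auto simp: q_def graph_point_nth)
    ultimately show ?thesis using local_graph_frontier_iff[OF lg G] True by (simp add: p_def)
  qed (use z in \<open>auto simp: p_def\<close>)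
  moreover have "p 0 = z" using q0 \<eta> by (simp add: p_def)
  moreover have "(p has_vector_derivative w) (at 0)"
    using dq by (rule has_vector_derivative_transform_within_open[of _ _ _ "ball 0 \<eta>"]) (use \<eta> in \<open>auto simp: p_def\<close>)
  ultimately show ?thesis unfolding tangent_vectors_def by blast
qed

text \<open>The squared distance to \<open>X\<close> along a boundary curve through \<open>P\<close>
  is least at parameter 0, where its derivative is therefore 0.\<close>

lemma nearest_orthogonal_tangent:
  assumes P: "P \<in> frontier G" "\<And>y. y \<in> frontier G \<Longrightarrow> dist X P \<le> dist X y"
    and w: "w \<in> tangent_vectors G P"
  shows "(X - P) \<bullet> w = 0"
proof -
  obtain p where p: "p 0 = P" "\<And>s::real. p s \<in> frontier G" "(p has_vector_derivative w) (at 0)"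
    using w unfolding tangent_vectors_def by blast
  have "((\<lambda>s. X - p s) has_derivative (\<lambda>s. - (s *\<^sub>R w))) (at 0)"
    using p(3) unfolding has_vector_derivative_def by (auto intro!: derivative_eq_intros)
  from has_derivative_inner[OF this this]
  have "((\<lambda>s. (X - p s) \<bullet> (X - p s)) has_real_derivative - 2 * ((X - P) \<bullet> w)) (at 0)"
    by (rule has_derivative_imp_has_field_derivative) (simp add: p(1) inner_commute algebra_simps)
  moreover have "(X - p 0) \<bullet> (X - p 0) \<le> (X - p s) \<bullet> (X - p s)" for s
  proof -
    have "norm (X - p 0) \<le> norm (X - p s)" using P(2)[OF p(2)[of s]] p(1) by (simp add: dist_norm)
    then show ?thesis by (simp add: dot_square_norm power_mono)
  qed
  ultimately have "- 2 * ((X - P) \<bullet> w) = 0"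
    by (intro DERIV_local_min[of "\<lambda>s. (X - p s) \<bullet> (X - p s)" _ 0 1]) auto
  then show ?thesis by linarith
qed

text \<open>The vector \<open>a\<close> minus its component along \<open>N\<close> is orthogonal to
  \<open>N\<close>, hence to \<open>a\<close>, hence to itself. For \<open>N = 0\<close> the
  quotient is 0 and the argument persists.\<close>

lemma parallel_of_orthogonal:
  fixes a N :: "'a::real_inner"
  assumes "\<And>w. w \<bullet> N = 0 \<Longrightarrow> a \<bullet> w = 0"
  shows "a = (a \<bullet> N / (N \<bullet> N)) *\<^sub>R N"
proof -
  define w where "w = a - (a \<bullet> N / (N \<bullet> N)) *\<^sub>R N"
  have "w \<bullet> N = 0" by (cases "N = 0") (auto simp: w_def inner_diff_left)
  moreover have "w \<bullet> w = a \<bullet> w - (a \<bullet> N / (N \<bullet> N)) * (N \<bullet> w)"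
    by (subst (1) w_def) (simp add: inner_diff_left)
  ultimately have "w \<bullet> w = 0" using assms[of w] by (simp add: inner_commute)
  then show ?thesis by (simp add: w_def)
qed

text \<open>Both \<open>X - P\<close> and \<open>n\<close> are orthogonal to the tangent hyperplane,
  hence parallel. If they pointed the same way, a point of \<open>G\<close> slightly inward from
  \<open>P\<close> would be nearer to \<open>X\<close> than \<open>P\<close>, and the ball around
  \<open>X\<close> of radius \<open>dist X P\<close> would meet the frontier in its
  interior.\<close>

lemma exterior_point_eq_normal_shift:
  fixes G :: "(real^'d) set"
  assumes G: "open G" and k: "holder_boundary k \<epsilon> G" "1 \<le> k" and X: "X \<notin> closure G"
    and P: "P \<in> frontier G" "\<And>y. y \<in> frontier G \<Longrightarrow> dist X P \<le> dist X y"
    and n: "inward_unit_normal G P n"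
  shows "X = P - dist X P *\<^sub>R n"
proof -
  obtain r i s f where lg: "local_graph k \<epsilon> G P r i s f" using k P unfolding holder_boundary_def by blast
  obtain F where F: "\<And>x. x \<in> ball P r \<Longrightarrow> (f has_derivative (\<lambda>v. \<Sum>b\<in>Basis. (v \<bullet> b) * F b x)) (at x)"
    by (rule local_graph_derivative[OF lg k(2)]) blast
  have r: "r > 0" using lg by (simp add: local_graph_def)
  \<comment> \<open>The gradient at \<open>P\<close> of the height \<open>s * x $ i - f x\<close>
    above the graph; vectors orthogonal to it are tangent.\<close>
  define N where "N = axis i s - (\<Sum>b\<in>Basis. F b P *\<^sub>R b)"
  have tan: "w \<in> tangent_vectors G P" if "w \<bullet> N = 0" for w
  proof (rule local_graph_tangent[OF lg G P(1) F])
    show "P \<in> ball P r" using r by simp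
    have "w \<bullet> axis i s = (\<Sum>b\<in>Basis. (w \<bullet> b) * F b P)"
      using that by (simp add: N_def inner_diff_right inner_sum_right mult.commute)
    then show "(\<Sum>b\<in>Basis. (w \<bullet> b) * F b P) = s * w $ i" by (simp add: inner_axis mult.commute)
  qed
  have "norm n = 1" and ntan: "\<And>w. w \<in> tangent_vectors G P \<Longrightarrow> n \<bullet> w = 0"
    using n unfolding inward_unit_normal_def by blast+
  obtain \<delta> where \<delta>: "\<delta> > 0" "\<And>s. 0 < s \<Longrightarrow> s < \<delta> \<Longrightarrow> P + s *\<^sub>R n \<in> G"
    using n unfolding inward_unit_normal_def by auto
  define \<beta> where "\<beta> = n \<bullet> N / (N \<bullet> N)"
  define \<alpha> where "\<alpha> = (X - P) \<bullet> N / (N \<bullet> N)"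
  have n\<beta>: "n = \<beta> *\<^sub>R N" unfolding \<beta>_def by (rule parallel_of_orthogonal) (simp add: ntan tan)
  have X\<alpha>: "X - P = \<alpha> *\<^sub>R N"
    unfolding \<alpha>_def by (rule parallel_of_orthogonal) (rule nearest_orthogonal_tangent[OF P tan])
  have "\<beta> \<noteq> 0" using n\<beta> \<open>norm n = 1\<close> by auto
  define \<theta> where "\<theta> = \<alpha> / \<beta>"
  have Xn: "X - P = \<theta> *\<^sub>R n" using X\<alpha> n\<beta> \<open>\<beta> \<noteq> 0\<close> by (simp add: \<theta>_def)
  then have \<theta>: "\<bar>\<theta>\<bar> = dist X P" using \<open>norm n = 1\<close> by (simp add: dist_norm)
  have "\<not> \<theta> > 0"
  proof
    assume pos: "\<theta> > 0"
    \<comment> \<open>Small enough for the inward point to be in \<open>G\<close> and not to go past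
      \<open>X\<close>.\<close>
    define \<tau> where "\<tau> = min \<delta> \<theta> / 2"
    have \<tau>: "0 < \<tau>" "\<tau> < \<delta>" "\<tau> < \<theta>" using \<delta> pos by (auto simp: \<tau>_def)
    have "X - (P + \<tau> *\<^sub>R n) = (\<theta> - \<tau>) *\<^sub>R n" using Xn by (simp add: algebra_simps)
    then have "dist X (P + \<tau> *\<^sub>R n) = \<theta> - \<tau>" using \<tau> \<open>norm n = 1\<close> by (simp add: dist_norm)
    then have "P + \<tau> *\<^sub>R n \<in> ball X \<theta> \<inter> G" using \<tau> \<delta> by auto
    moreover have "X \<in> ball X \<theta> - G" using X pos closure_subset by auto
    ultimately have "ball X \<theta> \<inter> frontier G \<noteq> {}"
      using connected_Int_frontier[OF connected_ball[of X \<theta>], of G] by blast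
    then obtain y where "y \<in> frontier G" "dist X y < \<theta>" by auto
    then show False using P(2)[of y] \<theta> pos by simp
  qed
  then have "\<theta> = - dist X P" using \<theta> by linarith
  then show ?thesis using Xn by (simp add: algebra_simps)
qed

text \<open>The segment from \<open>X\<close> to \<open>x\<close> has to meet the frontier. Hence an
  Euler step that leaves the domain overshoots by no more than its own length.\<close>

lemma infdist_frontier_le:
  fixes G :: "'a::euclidean_space set"
  assumes x: "x \<in> closure G" and X: "X \<notin> closure G"
  shows "infdist X (frontier G) \<le> dist X x"
proof -
  have "closed_segment X x \<inter> frontier G \<noteq> {}"
  proof (cases "x \<in> interior G")
    case True
    then show ?thesis using X closure_subset interior_subset
      by (intro connected_Int_frontier connected_segment) blast+
  next
    case False
    then show ?thesis using x by (auto simp: frontier_def)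
  qed
  then obtain y where y: "y \<in> closed_segment X x" "y \<in> frontier G" by blast
  have "infdist X (frontier G) \<le> dist X y" using y by (intro infdist_le)
  also have "\<dots> \<le> dist X x" using segment_bound(1)[OF y(1)] by (simp add: dist_norm norm_minus_commute)
  finally show ?thesis .
qed

lemma infdist_closest_point:
  assumes "closed S" "S \<noteq> {}"
  shows "infdist x S = dist x (closest_point S x)"
proof (rule antisym)
  show "infdist x S \<le> dist x (closest_point S x)"
    using closest_point_in_set[OF assms] by (rule infdist_le)
  show "dist x (closest_point S x) \<le> infdist x S"
    unfolding infdist_notempty[OF assms(2)] using assms closest_point_le
    by (intro cINF_greatest) auto
qed

section \<open>Continuity of boundary data\<close>

lemma continuous_on_Times_local:
  fixes S :: "'a::metric_space set" and A :: "'b::metric_space set"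
  assumes "\<And>z. z \<in> S \<Longrightarrow> \<exists>\<rho>>0. continuous_on (A \<times> (S \<inter> ball z \<rho>)) F"
  shows "continuous_on (A \<times> S) F"
  unfolding continuous_on_eq_continuous_within
proof (rule ballI)
  fix p assume p: "p \<in> A \<times> S"
  obtain t z where tz: "p = (t, z)" "t \<in> A" "z \<in> S" using p by auto
  obtain \<rho> where \<rho>: "\<rho> > 0" "continuous_on (A \<times> (S \<inter> ball z \<rho>)) F" using assms tz by blast
  then have "continuous (at p within (A \<times> (S \<inter> ball z \<rho>))) F"
    using tz by (auto simp: continuous_on_eq_continuous_within)
  moreover have "at p within (A \<times> (S \<inter> ball z \<rho>)) = at p within (A \<times> S)"
    by (rule at_within_nhd[of p "UNIV \<times> ball z \<rho>"]) (use tz \<rho> in \<open>auto intro: open_Times\<close>)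
  ultimately show "continuous (at p within (A \<times> S)) F" by simp
qed

text \<open>Near \<open>z\<close> the composition with the chart is continuous and, on the frontier,
  equal to \<open>v\<close>. Each of the two facts has its own radius, whence
  \<open>min r \<rho>\<close>.\<close>

lemma boundary_parabolic_holder_continuous:
  assumes v: "boundary_parabolic_holder \<epsilon> T G v" and G: "open G"
  shows "continuous_on ({0..T} \<times> frontier G) (\<lambda>(t, x). v t x)"
proof (rule continuous_on_Times_local)
  fix z assume z: "z \<in> frontier G"
  obtain r i s f \<rho> where lg: "local_graph 2 \<epsilon> G z r i s f" and \<rho>: "\<rho> > 0"
    and ph: "parabolic_holder \<epsilon> T (ball z \<rho>) (\<lambda>t x. v t (graph_point i s f x))"
    using v z unfolding boundary_parabolic_holder_def by blast
  have r: "r > 0" using lg by (simp add: local_graph_def)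
  have "continuous_on ({0..T} \<times> closure (ball z \<rho>)) (\<lambda>(t, x). v t (graph_point i s f x))"
    using ph unfolding parabolic_holder_def C12_derivs_def by blast
  then have "continuous_on ({0..T} \<times> (frontier G \<inter> ball z (min r \<rho>))) (\<lambda>(t, x). v t (graph_point i s f x))"
    by (rule continuous_on_subset) (use closure_subset in fastforce)
  then have "continuous_on ({0..T} \<times> (frontier G \<inter> ball z (min r \<rho>))) (\<lambda>(t, x). v t x)"
    by (rule continuous_on_eq) (auto simp: local_graph_graph_point[OF lg G])
  then show "\<exists>\<rho>>0. continuous_on ({0..T} \<times> (frontier G \<inter> ball z \<rho>)) (\<lambda>(t, x). v t x)"
    using r \<rho> by (intro exI[of _ "min r \<rho>"]) auto
qed

lemma boundary_holder_continuous:
  assumes v: "boundary_holder k \<epsilon> G v" and G: "open G"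
  shows "continuous_on (frontier G) v"
proof -
  \<comment> \<open>A dummy time makes the local criterion for products applicable.\<close>
  have "continuous_on ({0::real} \<times> frontier G) (\<lambda>(t, x). v x)"
  proof (rule continuous_on_Times_local)
    fix z assume z: "z \<in> frontier G"
    obtain r i s f \<rho> where lg: "local_graph k \<epsilon> G z r i s f" and \<rho>: "\<rho> > 0"
      and hs: "holder_space k \<epsilon> (ball z \<rho>) (\<lambda>x. v (graph_point i s f x))"
      using v z unfolding boundary_holder_def by blast
    have r: "r > 0" using lg by (simp add: local_graph_def)
    obtain D where D: "partials k (ball z \<rho>) (\<lambda>x. v (graph_point i s f x)) D"
      "\<And>js. set js \<subseteq> Basis \<Longrightarrow> length js \<le> k \<Longrightarrow> continuous_on (closure (ball z \<rho>)) (D js)"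
      using hs unfolding holder_space_def by blast
    have "continuous_on (closure (ball z \<rho>)) (\<lambda>x. v (graph_point i s f x))"
      using D(1) D(2)[of "[]"] by (simp add: partials_def)
    then have "continuous_on (frontier G \<inter> ball z (min r \<rho>)) (\<lambda>x. v (graph_point i s f x))"
      by (rule continuous_on_subset) (use closure_subset in fastforce)
    then have "continuous_on (frontier G \<inter> ball z (min r \<rho>)) v"
      by (rule continuous_on_eq) (auto simp: local_graph_graph_point[OF lg G])
    then have "continuous_on ({0::real} \<times> (frontier G \<inter> ball z (min r \<rho>))) (\<lambda>p. v (snd p))"
      by (rule continuous_on_compose2) (auto intro!: continuous_intros)
    then show "\<exists>\<rho>>0. continuous_on ({0::real} \<times> (frontier G \<inter> ball z \<rho>)) (\<lambda>(t, x). v x)"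
      using r \<rho> by (intro exI[of _ "min r \<rho>"]) (auto simp: case_prod_beta)
  qed
  then have "continuous_on (frontier G) (\<lambda>x. (\<lambda>(t, x). v x) (0::real, x))"
    by (rule continuous_on_compose2) (auto intro!: continuous_intros)
  then show ?thesis by simp
qed

section \<open>Independent signs\<close>

text \<open>Exactly one pattern \<open>s\<close> of signs is realised at \<open>\<omega>\<close>;
  its product of indicators is 1 and the others vanish. An arbitrary function of finitely many signs
  thus becomes a finite linear combination of products of functions of single signs, which settles
  integrability and lets independence act.\<close>

lemma sign_noise_expansion:
  fixes \<xi> :: "nat \<Rightarrow> 'w \<Rightarrow> real^'d" and F :: "(nat \<Rightarrow> real^'d) \<Rightarrow> real"
  assumes \<xi>: "sign_noise M \<xi>" and J: "finite J" "J \<subseteq> {1..} \<times> UNIV"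
    and F: "\<And>e e'. (\<And>k i. (k, i) \<in> J \<Longrightarrow> e k $ i = e' k $ i) \<Longrightarrow> F e = F e'"
    and \<omega>: "\<omega> \<in> space M"
  shows "F (\<lambda>k. \<xi> k \<omega>) = (\<Sum>s\<in>PiE J (\<lambda>_. {-1, 1}). F (\<lambda>k. \<chi> i. s (k, i)) *
           (\<Prod>p\<in>J. indicator {s p} (\<xi> (fst p) \<omega> $ snd p)))"
proof -
  define s0 where "s0 = restrict (\<lambda>(k, i). \<xi> k \<omega> $ i) J"
  have s0: "s0 \<in> PiE J (\<lambda>_. {-1, 1})"
    using \<xi> J(2) \<omega> unfolding sign_noise_def s0_def by fastforce
  have prod: "(\<Prod>p\<in>J. indicator {s p} (\<xi> (fst p) \<omega> $ snd p) :: real) = (if s = s0 then 1 else 0)"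
    if s: "s \<in> PiE J (\<lambda>_. {-1, 1})" for s
  proof (cases "s = s0")
    case True
    then show ?thesis by (auto simp: s0_def intro!: prod.neutral)
  next
    case False
    then obtain p where "s p \<noteq> s0 p" by blast
    then have p: "p \<in> J" using s s0 by (metis PiE_arb)
    then have "\<xi> (fst p) \<omega> $ snd p \<noteq> s p" using \<open>s p \<noteq> s0 p\<close> by (auto simp: s0_def split: prod.splits)
    then have "indicator {s p} (\<xi> (fst p) \<omega> $ snd p) = (0::real)" by simp
    then show ?thesis using False J(1) p by (auto intro!: prod_zero)
  qed
  have "finite (PiE J (\<lambda>_. {-1, 1::real}))" using J by (intro finite_PiE) auto
  then have "(\<Sum>s\<in>PiE J (\<lambda>_. {-1, 1}). F (\<lambda>k. \<chi> i. s (k, i)) *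
           (\<Prod>p\<in>J. indicator {s p} (\<xi> (fst p) \<omega> $ snd p))) = F (\<lambda>k. \<chi> i. s0 (k, i))"
    using s0 by (simp add: prod if_distrib[of "\<lambda>x. _ * x"] cong: if_cong)
  also have "\<dots> = F (\<lambda>k. \<xi> k \<omega>)" by (rule F) (simp add: s0_def)
  finally show ?thesis by simp
qed

lemma sign_noise_mean:
  fixes \<xi> :: "nat \<Rightarrow> 'w \<Rightarrow> real^'d"
  assumes \<xi>: "sign_noise M \<xi>" and k: "1 \<le> k"
  shows "integrable M (\<lambda>\<omega>. \<xi> k \<omega> $ i)" "(\<integral>\<omega>. \<xi> k \<omega> $ i \<partial>M) = 0"
proof -
  interpret prob_space M using \<xi> by (simp add: sign_noise_def)
  have "indep_vars (\<lambda>_. borel) (\<lambda>(k, i) \<omega>. \<xi> k \<omega> $ i) ({1..} \<times> UNIV)"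
    using \<xi> by (simp add: sign_noise_def)
  then have m[measurable]: "(\<lambda>\<omega>. \<xi> k \<omega> $ i) \<in> borel_measurable M"
    using k unfolding indep_vars_def by force
  \<comment> \<open>A sign is the difference of the indicators of its two values, each of
    probability one half.\<close>
  have v: "\<xi> k \<omega> $ i = indicator {\<omega> \<in> space M. \<xi> k \<omega> $ i = 1} \<omega> - indicator {\<omega> \<in> space M. \<xi> k \<omega> $ i = -1} \<omega>"
    if "\<omega> \<in> space M" for \<omega>
    using \<xi> k that unfolding sign_noise_def by (auto simp: indicator_def)
  show "integrable M (\<lambda>\<omega>. \<xi> k \<omega> $ i)"
    by (subst Bochner_Integration.integrable_cong[OF refl v], assumption,
        intro Bochner_Integration.integrable_diff integrable_real_indicator) (auto simp: less_top[symmetric])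
  have "(\<integral>\<omega>. \<xi> k \<omega> $ i \<partial>M) = measure M {\<omega> \<in> space M. \<xi> k \<omega> $ i = 1} - measure M {\<omega> \<in> space M. \<xi> k \<omega> $ i = -1}"
    by (subst Bochner_Integration.integral_cong[OF refl v], assumption,
        subst Bochner_Integration.integral_diff) (auto intro!: integrable_real_indicator simp: less_top[symmetric])
  then show "(\<integral>\<omega>. \<xi> k \<omega> $ i \<partial>M) = 0" using \<xi> k unfolding sign_noise_def by simp
qed

lemma sign_noise_integrable:
  fixes \<xi> :: "nat \<Rightarrow> 'w \<Rightarrow> real^'d" and F :: "(nat \<Rightarrow> real^'d) \<Rightarrow> real"
  assumes \<xi>: "sign_noise M \<xi>" and J: "finite J" "J \<subseteq> {1..} \<times> UNIV"
    and F: "\<And>e e'. (\<And>k i. (k, i) \<in> J \<Longrightarrow> e k $ i = e' k $ i) \<Longrightarrow> F e = F e'"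
  shows "integrable M (\<lambda>\<omega>. F (\<lambda>k. \<xi> k \<omega>))"
proof -
  interpret prob_space M using \<xi> by (simp add: sign_noise_def)
  have ind: "indep_vars (\<lambda>_. borel) (\<lambda>(k, i) \<omega>. \<xi> k \<omega> $ i) J"
    using \<xi> J by (auto simp: sign_noise_def intro: indep_vars_subset)
  have "integrable M (\<lambda>\<omega>. \<Prod>p\<in>J. indicator {s p} (\<xi> (fst p) \<omega> $ snd p) :: real)" for s
  proof (rule indep_vars_integrable[OF J(1)])
    have "indep_vars (\<lambda>_. borel) (\<lambda>p \<omega>. (indicator {s p} :: real \<Rightarrow> real) ((case p of (k, i) \<Rightarrow> \<lambda>\<omega>. \<xi> k \<omega> $ i) \<omega>)) J"
      by (rule indep_vars_compose2[OF ind]) simp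
    then show I: "indep_vars (\<lambda>_. borel) (\<lambda>p \<omega>. indicator {s p} (\<xi> (fst p) \<omega> $ snd p) :: real) J"
      by (simp add: case_prod_beta)
    show "integrable M (\<lambda>\<omega>. indicator {s p} (\<xi> (fst p) \<omega> $ snd p) :: real)" if "p \<in> J" for p
      using I that unfolding indep_vars_def by (intro integrable_const_bound[of _ 1]) (auto simp: indicator_def)
  qed
  then show ?thesis
    by (subst Bochner_Integration.integrable_cong[OF refl sign_noise_expansion[OF \<xi> J F]]) auto
qed

text \<open>After expansion of \<open>F\<close>, every term is a product over distinct independent
  signs in which the extra sign appears as a factor of mean 0.\<close>

lemma sign_noise_orthogonal:
  fixes \<xi> :: "nat \<Rightarrow> 'w \<Rightarrow> real^'d" and F :: "(nat \<Rightarrow> real^'d) \<Rightarrow> real"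
  assumes \<xi>: "sign_noise M \<xi>" and J: "finite J" "J \<subseteq> {1..} \<times> UNIV"
    and F: "\<And>e e'. (\<And>k i. (k, i) \<in> J \<Longrightarrow> e k $ i = e' k $ i) \<Longrightarrow> F e = F e'"
    and k: "1 \<le> k" "(k, i) \<notin> J"
  shows "(\<integral>\<omega>. F (\<lambda>k. \<xi> k \<omega>) * \<xi> k \<omega> $ i \<partial>M) = 0"
proof -
  interpret prob_space M using \<xi> by (simp add: sign_noise_def)
  let ?J = "insert (k, i) J"
  have ind: "indep_vars (\<lambda>_. borel) (\<lambda>(k, i) \<omega>. \<xi> k \<omega> $ i) ?J"
    using \<xi> J k by (auto simp: sign_noise_def intro: indep_vars_subset)
  have J': "finite ?J" using J by simp
  \<comment> \<open>The identity at the extra sign and indicators elsewhere, so that a single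
    product over \<open>?J\<close> carries both.\<close>
  define Y where "Y s p = (if p = (k, i) then (\<lambda>v. v) else (indicator {s p} :: real \<Rightarrow> real))" for s p
  have I: "indep_vars (\<lambda>_. borel) (\<lambda>p \<omega>. Y s p (\<xi> (fst p) \<omega> $ snd p)) ?J" for s
  proof -
    have "indep_vars (\<lambda>_. borel) (\<lambda>p \<omega>. Y s p ((case p of (k, i) \<Rightarrow> \<lambda>\<omega>. \<xi> k \<omega> $ i) \<omega>)) ?J"
      by (rule indep_vars_compose2[OF ind]) (simp add: Y_def)
    then show ?thesis by (simp add: case_prod_beta)
  qed
  have int: "integrable M (\<lambda>\<omega>. Y s p (\<xi> (fst p) \<omega> $ snd p))" if "p \<in> ?J" for s p
  proof (cases "p = (k, i)")
    case True
    then show ?thesis using sign_noise_mean[OF \<xi> k(1)] by (simp add: Y_def)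
  next
    case False
    then show ?thesis using I[of s] that unfolding indep_vars_def
      by (intro integrable_const_bound[of _ 1]) (auto simp: indicator_def Y_def)
  qed
  have zero: "(\<integral>\<omega>. (\<Prod>p\<in>?J. Y s p (\<xi> (fst p) \<omega> $ snd p)) \<partial>M) = 0" for s
    by (subst indep_vars_lebesgue_integral[OF J' I int], assumption)
       (use J k in \<open>simp add: Y_def sign_noise_mean[OF \<xi> k(1)]\<close>)
  have eq: "F (\<lambda>k. \<xi> k \<omega>) * \<xi> k \<omega> $ i = (\<Sum>s\<in>PiE J (\<lambda>_. {-1, 1}). F (\<lambda>k. \<chi> i. s (k, i)) *
      (\<Prod>p\<in>?J. Y s p (\<xi> (fst p) \<omega> $ snd p)))" if "\<omega> \<in> space M" for \<omega>
  proof -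
    have "(\<Prod>p\<in>?J. Y s p (\<xi> (fst p) \<omega> $ snd p)) = (\<Prod>p\<in>J. indicator {s p} (\<xi> (fst p) \<omega> $ snd p)) * \<xi> k \<omega> $ i" for s
    proof -
      have "(\<Prod>p\<in>J. Y s p (\<xi> (fst p) \<omega> $ snd p)) = (\<Prod>p\<in>J. indicator {s p} (\<xi> (fst p) \<omega> $ snd p))"
        using k by (intro prod.cong refl) (auto simp: Y_def)
      then show ?thesis using J k by (simp add: Y_def mult.commute)
    qed
    then show ?thesis
      by (subst sign_noise_expansion[OF \<xi> J F that]) (simp_all add: sum_distrib_right mult.assoc)
  qed
  have "(\<integral>\<omega>. F (\<lambda>k. \<xi> k \<omega>) * \<xi> k \<omega> $ i \<partial>M) =
      (\<Sum>s\<in>PiE J (\<lambda>_. {-1, 1}). F (\<lambda>k. \<chi> i. s (k, i)) * (\<integral>\<omega>. (\<Prod>p\<in>?J. Y s p (\<xi> (fst p) \<omega> $ snd p)) \<partial>M))"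
    by (subst Bochner_Integration.integral_cong[OF refl eq], assumption,
        subst Bochner_Integration.integral_sum)
       (auto simp del: prod.insert intro!: indep_vars_integrable[OF J' I int])
  also have "\<dots> = 0" by (simp only: zero) simp
  finally show ?thesis .
qed

text \<open>Adaptedness, stated for functions of the whole sequence of signs. Signs are numbered
  from 1: the step from index \<open>n\<close> to \<open>Suc n\<close> uses sign
  \<open>Suc n\<close>, and the state at index \<open>n\<close> depends on the signs 1 to
  \<open>n\<close>.\<close>

definition depends_upto :: "nat \<Rightarrow> ((nat \<Rightarrow> 'a) \<Rightarrow> 'b) \<Rightarrow> bool" where
  "depends_upto n F \<longleftrightarrow> (\<forall>e e'. (\<forall>k\<in>{1..n}. e k = e' k) \<longrightarrow> F e = F e')"

definition sign_seq :: "(nat \<Rightarrow> real^'d) \<Rightarrow> bool" where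
  "sign_seq e \<longleftrightarrow> (\<forall>k\<ge>1. \<forall>i. e k $ i \<in> {-1, 1})"

text \<open>Coefficients that depend on the signs up to \<open>n\<close> are orthogonal to one new
  sign and to the product of two different new signs; these are the two kinds of noise in an Euler
  step.\<close>

lemma sign_noise_upto:
  fixes \<xi> :: "nat \<Rightarrow> 'w \<Rightarrow> real^'d" and F :: "(nat \<Rightarrow> real^'d) \<Rightarrow> real"
  assumes \<xi>: "sign_noise M \<xi>" and F: "depends_upto n F"
  shows "integrable M (\<lambda>\<omega>. F (\<lambda>k. \<xi> k \<omega>))"
    and "(\<integral>\<omega>. F (\<lambda>k. \<xi> k \<omega>) * \<xi> (Suc n) \<omega> $ i \<partial>M) = 0"
    and "i \<noteq> j \<Longrightarrow> (\<integral>\<omega>. F (\<lambda>k. \<xi> k \<omega>) * \<xi> (Suc n) \<omega> $ i * \<xi> (Suc n) \<omega> $ j \<partial>M) = 0"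
proof -
  let ?J = "{1..n} \<times> (UNIV :: 'd set)"
  have J: "finite ?J" "?J \<subseteq> {1..} \<times> UNIV" by auto
  have dep: "F e = F e'" if "\<And>k i. (k, i) \<in> ?J \<Longrightarrow> e k $ i = e' k $ i" for e e'
  proof -
    have "\<forall>k\<in>{1..n}. e k = e' k" using that by (auto simp: vec_eq_iff)
    then show ?thesis using F unfolding depends_upto_def by blast
  qed
  show "integrable M (\<lambda>\<omega>. F (\<lambda>k. \<xi> k \<omega>))" by (rule sign_noise_integrable[OF \<xi> J dep]) auto
  show "(\<integral>\<omega>. F (\<lambda>k. \<xi> k \<omega>) * \<xi> (Suc n) \<omega> $ i \<partial>M) = 0"
    by (rule sign_noise_orthogonal[OF \<xi> J dep]) auto
  assume ij: "i \<noteq> j"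
  \<comment> \<open>One of the two new signs is absorbed into the function, and the other is
    orthogonal to the result.\<close>
  show "(\<integral>\<omega>. F (\<lambda>k. \<xi> k \<omega>) * \<xi> (Suc n) \<omega> $ i * \<xi> (Suc n) \<omega> $ j \<partial>M) = 0"
  proof (rule sign_noise_orthogonal[OF \<xi>, of "insert (Suc n, i) ?J" "\<lambda>e. F e * e (Suc n) $ i"])
    show "F e * e (Suc n) $ i = F e' * e' (Suc n) $ i"
      if h: "\<And>k l. (k, l) \<in> insert (Suc n, i) ?J \<Longrightarrow> e k $ l = e' k $ l" for e e'
    proof -
      have "F e = F e'" by (rule dep, rule h) auto
      then show ?thesis using h[of "Suc n" i] by simp
    qed
  qed (use ij in auto)
qed

lemma depends_upto_mono: "depends_upto n F \<Longrightarrow> n \<le> m \<Longrightarrow> depends_upto m F"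
  unfolding depends_upto_def by (meson atLeastAtMost_iff le_trans)

text \<open>The passage from paths to expectations: \<open>A k\<close> and \<open>B k\<close> are
  determined before sign \<open>Suc k\<close>, so the sum has mean 0 and may be subtracted under the
  integral, where the deterministic bound applies.\<close>

lemma sign_noise_expectation_bound:
  fixes \<xi> :: "nat \<Rightarrow> 'w \<Rightarrow> real^'d" and H :: "(nat \<Rightarrow> real^'d) \<Rightarrow> real"
    and A :: "nat \<Rightarrow> (nat \<Rightarrow> real^'d) \<Rightarrow> 'd \<Rightarrow> real" and B :: "nat \<Rightarrow> (nat \<Rightarrow> real^'d) \<Rightarrow> 'd \<Rightarrow> 'd \<Rightarrow> real"
  assumes \<xi>: "sign_noise M \<xi>" and H: "depends_upto N' H"
    and A: "\<And>k. depends_upto k (A k)" and B: "\<And>k. depends_upto k (B k)"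
    and R: "\<And>e. sign_seq e \<Longrightarrow> \<bar>H e - v - (\<Sum>k<N. (\<Sum>i\<in>UNIV. A k e i * e (Suc k) $ i)
        + (\<Sum>i\<in>UNIV. \<Sum>j\<in>UNIV - {i}. B k e i j * e (Suc k) $ i * e (Suc k) $ j))\<bar> \<le> R"
  shows "\<bar>(\<integral>\<omega>. H (\<lambda>k. \<xi> k \<omega>) \<partial>M) - v\<bar> \<le> R"
proof -
  interpret prob_space M using \<xi> by (simp add: sign_noise_def)
  note up = sign_noise_upto[OF \<xi>]
  let ?N = "\<lambda>e. \<Sum>k<N. (\<Sum>i\<in>UNIV. A k e i * e (Suc k) $ i)
        + (\<Sum>i\<in>UNIV. \<Sum>j\<in>UNIV - {i}. B k e i j * e (Suc k) $ i * e (Suc k) $ j)"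
  have A': "depends_upto k (\<lambda>e. A k e i)" "depends_upto k (\<lambda>e. B k e i j)" for k i j
    using A[of k] B[of k] unfolding depends_upto_def by metis+
  have Ai: "integrable M (\<lambda>\<omega>. A k (\<lambda>k. \<xi> k \<omega>) i * \<xi> (Suc k) \<omega> $ i)" for k i
    by (rule up(1)[of "Suc k" "\<lambda>e. A k e i * e (Suc k) $ i"])
       (use depends_upto_mono[OF A'(1), of k "Suc k"] in \<open>auto simp: depends_upto_def\<close>)
  have Bi: "integrable M (\<lambda>\<omega>. B k (\<lambda>k. \<xi> k \<omega>) i j * \<xi> (Suc k) \<omega> $ i * \<xi> (Suc k) \<omega> $ j)" for k i j
    by (rule up(1)[of "Suc k" "\<lambda>e. B k e i j * e (Suc k) $ i * e (Suc k) $ j"])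
       (use depends_upto_mono[OF A'(2), of k "Suc k"] in \<open>auto simp: depends_upto_def\<close>)
  have Ni: "integrable M (\<lambda>\<omega>. ?N (\<lambda>k. \<xi> k \<omega>))"
    by (intro Bochner_Integration.integrable_sum Bochner_Integration.integrable_add Ai Bi)
  have N0: "(\<integral>\<omega>. ?N (\<lambda>k. \<xi> k \<omega>) \<partial>M) = 0"
    by (simp add: Bochner_Integration.integral_sum Bochner_Integration.integral_add
         Bochner_Integration.integrable_sum Ai Bi up(2)[OF A'(1)] up(3)[OF A'(2)])
  have Hi: "integrable M (\<lambda>\<omega>. H (\<lambda>k. \<xi> k \<omega>))" by (rule up(1)[OF H])
  have "(\<integral>\<omega>. H (\<lambda>k. \<xi> k \<omega>) \<partial>M) - v = (\<integral>\<omega>. H (\<lambda>k. \<xi> k \<omega>) - v - ?N (\<lambda>k. \<xi> k \<omega>) \<partial>M)"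
    using Hi Ni N0 by (simp add: Bochner_Integration.integral_diff prob_space)
  also have "\<bar>\<dots>\<bar> \<le> (\<integral>\<omega>. R \<partial>M)"
  proof (rule integral_abs_bound[THEN order_trans], rule integral_mono)
    fix \<omega> assume "\<omega> \<in> space M"
    then have "sign_seq (\<lambda>k. \<xi> k \<omega>)" using \<xi> by (auto simp: sign_noise_def sign_seq_def)
    from R[OF this] show "\<bar>H (\<lambda>k. \<xi> k \<omega>) - v - ?N (\<lambda>k. \<xi> k \<omega>)\<bar> \<le> R" .
  qed (use Hi Ni in auto)
  finally show ?thesis by (simp add: prob_space)
qed

section \<open>Errors of a single step\<close>

lemma sum_Basis_vec:
  "(\<Sum>b\<in>(Basis :: (real^'d) set). F b) = (\<Sum>i\<in>UNIV. F (axis i 1))"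
proof -
  have "(Basis :: (real^'d) set) = range (\<lambda>i. axis i 1)" by (auto simp: Basis_vec_def)
  moreover have "sum F (range (\<lambda>i. axis i 1)) = (\<Sum>i\<in>UNIV. F (axis i 1))"
    by (subst sum.reindex) (auto simp: inj_on_def axis_eq_axis)
  ultimately show ?thesis by simp
qed

lemma sum_Basis_time_space:
  "(\<Sum>b\<in>(Basis :: (real \<times> (real^'d)) set). F b) = F (1, 0) + (\<Sum>i\<in>UNIV. F (0, axis i 1))"
proof -
  have B: "(Basis :: (real \<times> (real^'d)) set) = insert (1, 0) ((\<lambda>b. (0, b)) ` Basis)"
    by (simp add: Basis_prod_def)
  have "(1, 0) \<notin> (\<lambda>b. (0::real, b)) ` (Basis :: (real^'d) set)" by auto
  moreover have "sum F ((\<lambda>b. (0, b)) ` Basis) = (\<Sum>i\<in>UNIV. F (0, axis i 1))"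
    by (subst sum.reindex) (auto simp: inj_on_def sum_Basis_vec)
  moreover have "finite ((\<lambda>b. (0::real, b)) ` (Basis :: (real^'d) set))" by simp
  ultimately show ?thesis by (subst B) simp
qed

lemma jet1_add: "jet1 D z (v + w) = jet1 D z v + jet1 D z w"
  by (simp add: jet1_def inner_add_left distrib_right sum.distrib)

lemma jet1_scaleR: "jet1 D z (a *\<^sub>R v) = a * jet1 D z v"
  by (simp add: jet1_def sum_distrib_left mult.assoc)

lemma jet2_add_left: "jet2 D z (v + v') w = jet2 D z v w + jet2 D z v' w"
  by (simp add: jet2_def inner_add_left distrib_right sum.distrib)

lemma jet2_add_right: "jet2 D z v (w + w') = jet2 D z v w + jet2 D z v w'"
  by (simp add: jet2_def inner_add_left distrib_right distrib_left sum.distrib)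

lemma jet2_scaleR_left: "jet2 D z (a *\<^sub>R v) w = a * jet2 D z v w"
  by (simp add: jet2_def sum_distrib_left mult_ac)

lemma jet2_scaleR_right: "jet2 D z v (a *\<^sub>R w) = a * jet2 D z v w"
  by (simp add: jet2_def sum_distrib_left mult_ac)

lemma taylor2_self: "taylor2 D z z = D [] z"
  by (simp add: taylor2_def jet1_def jet2_def)

abbreviation e_t :: "real \<times> (real^'d)" where "e_t \<equiv> (1, 0)"

abbreviation e_x :: "'d \<Rightarrow> real \<times> (real^'d)" where "e_x i \<equiv> (0, axis i 1)"

lemma jet1_split:
  fixes z :: "real \<times> (real^'d)"
  shows "jet1 D z (\<tau>, p) = \<tau> * D [e_t] z + (\<Sum>i\<in>UNIV. p $ i * D [e_x i] z)"
  by (simp add: jet1_def sum_Basis_time_space inner_axis)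

lemma jet2_space:
  fixes z :: "real \<times> (real^'d)"
  shows "jet2 D z (0, p) (0, q) = (\<Sum>i\<in>UNIV. \<Sum>j\<in>UNIV. p $ i * q $ j * D [e_x j, e_x i] z)"
  by (simp add: jet2_def sum_Basis_time_space inner_axis)

lemma norm_sign_vector:
  fixes e :: "real^'d"
  assumes "\<And>i. e $ i \<in> {-1, 1}"
  shows "norm e \<le> CARD('d)"
proof -
  have "norm e \<le> (\<Sum>i\<in>UNIV. \<bar>e $ i\<bar>)" by (rule norm_le_l1_cart)
  also have "\<dots> = (\<Sum>i\<in>(UNIV::'d set). 1)"
  proof (rule sum.cong[OF refl])
    show "\<bar>e $ i\<bar> = 1" for i using assms[of i] by auto
  qed
  finally show ?thesis by simp
qed

text \<open>
  \<open>D js\<close> is the partial derivative \<open>js\<close> of the solution, continuously extended to the closed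
  cylinder, and \<open>M\<close> is a common bound for everything that occurs.
\<close>

locale projected_euler =
  fixes G :: "(real^'d) set"
    and T :: real
    and \<nu> :: "real^'d \<Rightarrow> real^'d"
    and b :: "real \<Rightarrow> real^'d \<Rightarrow> real^'d"
    and \<sigma> :: "real \<Rightarrow> real^'d \<Rightarrow> real^'d^'d"
    and c g \<gamma> \<psi> :: "real \<Rightarrow> real^'d \<Rightarrow> real"
    and \<mu> \<phi> :: "real^'d \<Rightarrow> real"
    and D :: "(real \<times> (real^'d)) list \<Rightarrow> real \<times> (real^'d) \<Rightarrow> real"
    and \<delta> M m :: real
  assumes T_pos: "0 < T"
    and const: "0 < \<delta>" "\<delta> \<le> 1" "1 \<le> M" "0 < m"
    and base_change: "\<And>z p y. z \<in> {0..T} \<times> closure G \<Longrightarrow> p \<in> {0..T} \<times> closure G \<Longrightarrow> dist z p < \<delta> \<Longrightarrow>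
      \<bar>taylor2 D z y - taylor2 D p y\<bar> \<le> M * (dist z p + dist p y) ^ 3"
    and D_bound: "\<And>z. z \<in> {0..T} \<times> closure G \<Longrightarrow> \<bar>D [] z\<bar> \<le> M"
    and jet1_bound: "\<And>z v. z \<in> {0..T} \<times> closure G \<Longrightarrow> \<bar>jet1 D z v\<bar> \<le> M * norm v"
    and jet2_bound: "\<And>z v w. z \<in> {0..T} \<times> closure G \<Longrightarrow> \<bar>jet2 D z v w\<bar> \<le> M * norm v * norm w"
    and coeff_bound: "\<And>t x. t \<in> {0..T} \<Longrightarrow> x \<in> closure G \<Longrightarrow> norm (b t x) \<le> M"
      "\<And>t x e. t \<in> {0..T} \<Longrightarrow> x \<in> closure G \<Longrightarrow> norm (\<sigma> t x *v e) \<le> M * norm e"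
      "\<And>t x. t \<in> {0..T} \<Longrightarrow> x \<in> closure G \<Longrightarrow> \<bar>c t x\<bar> \<le> M"
      "\<And>t x. t \<in> {0..T} \<Longrightarrow> x \<in> closure G \<Longrightarrow> \<bar>g t x\<bar> \<le> M"
    and boundary_bound: "\<And>t z. t \<in> {0..T} \<Longrightarrow> z \<in> frontier G \<Longrightarrow> \<bar>\<gamma> t z\<bar> \<le> M"
      "\<And>t z. t \<in> {0..T} \<Longrightarrow> z \<in> frontier G \<Longrightarrow> \<bar>\<psi> t z\<bar> \<le> M"
      "\<And>z. z \<in> frontier G \<Longrightarrow> m \<le> \<mu> z" "\<And>z. z \<in> frontier G \<Longrightarrow> \<mu> z \<le> M"
    and pde: "\<And>t x. t \<in> {0..T} \<Longrightarrow> x \<in> closure G \<Longrightarrow>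
      D [e_t] (t, x) + gen b \<sigma> t x (\<chi> i. D [e_x i] (t, x)) (\<chi> i j. D [e_x j, e_x i] (t, x))
        + c t x * D [] (t, x) + g t x = 0"
    and boundary_condition: "\<And>t z. t \<in> {0..T} \<Longrightarrow> z \<in> frontier G \<Longrightarrow>
      - \<mu> z * gen b \<sigma> t z (\<chi> i. D [e_x i] (t, z)) (\<chi> i j. D [e_x j, e_x i] (t, z))
        + \<nu> z \<bullet> (\<chi> i. D [e_x i] (t, z)) + \<gamma> t z * D [] (t, z) = \<psi> t z"
    and terminal: "\<And>x. x \<in> closure G \<Longrightarrow> D [] (T, x) = \<phi> x"
    and \<phi>_lipschitz: "\<And>x y. x \<in> closure G \<Longrightarrow> dist x y < \<delta> \<Longrightarrow> \<bar>\<phi> y - \<phi> x\<bar> \<le> M * dist x y"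
    and projection: "\<And>X. X \<notin> closure G \<Longrightarrow> closest_point (frontier G) X \<in> frontier G"
      "\<And>X. X \<notin> closure G \<Longrightarrow>
        X = closest_point (frontier G) X - infdist X (frontier G) *\<^sub>R \<nu> (closest_point (frontier G) X)"
    and normal_norm: "\<And>z. z \<in> frontier G \<Longrightarrow> norm (\<nu> z) = 1"
begin

definition proj :: "real^'d \<Rightarrow> real^'d" where
  "proj X = (if X \<in> closure G then X else closest_point (frontier G) X)"

text \<open>
  The solution, extended past the boundary by its Taylor polynomial at the projection: this avoids
  constructing a smooth extension.
\<close>

definition V :: "real \<Rightarrow> real^'d \<Rightarrow> real" where
  "V t X = taylor2 D (t, proj X) (t, X)"

text \<open>Twice the second-order part of the generator applied to the solution, which is also the
  mean of \<open>jet2\<close> in the random direction \<open>\<sigma> t x *v e\<close>.\<close>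

definition trace_part :: "real \<Rightarrow> real^'d \<Rightarrow> real" where
  "trace_part t x =
    (\<Sum>i\<in>UNIV. \<Sum>j\<in>UNIV. (\<sigma> t x ** transpose (\<sigma> t x)) $ i $ j * D [e_x j, e_x i] (t, x))"

text \<open>The random terms of order \<open>sqrt h\<close> and \<open>h\<close> in the Taylor
  expansion over an Euler step, the quadratic one centred by its mean.\<close>

definition noise_part :: "real \<Rightarrow> real \<Rightarrow> real^'d \<Rightarrow> real^'d \<Rightarrow> real" where
  "noise_part h t x e = sqrt h * jet1 D (t, x) (0, \<sigma> t x *v e)
     + h / 2 * (jet2 D (t, x) (0, \<sigma> t x *v e) (0, \<sigma> t x *v e)
        - trace_part t x)"

text \<open>The length of an Euler step in units of \<open>sqrt h\<close>: \<open>M\<close> for the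
  drift, as \<open>h \<le> sqrt h\<close>, and \<open>M\<close> times the dimension for the
  diffusion, by \<open>norm_sign_vector\<close>.\<close>

definition q :: real where "q = M * (1 + CARD('d))"

lemma q_ge: "M \<le> q" "1 \<le> q"
proof -
  show "M \<le> q" using const mult_left_mono[of 1 "1 + real CARD('d)" M] by (simp add: q_def)
  then show "1 \<le> q" using const by simp
qed

lemma V_inside: "x \<in> closure G \<Longrightarrow> V t x = D [] (t, x)"
  by (simp add: V_def proj_def taylor2_self)

lemma proj_in: "proj X \<in> closure G"
  using projection(1)[of X] by (auto simp: proj_def frontier_def)

lemma frontier_closure: "z \<in> frontier G \<Longrightarrow> z \<in> closure G"
  by (simp add: frontier_def)

lemma dist_proj:
  assumes "X \<notin> closure G"
  shows "dist X (proj X) = infdist X (frontier G)"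
proof -
  let ?P = "closest_point (frontier G) X"
  have "X - ?P = - (infdist X (frontier G) *\<^sub>R \<nu> ?P)"
    by (subst (1) projection(2)[OF assms]) simp
  then have "norm (X - ?P) = norm (infdist X (frontier G) *\<^sub>R \<nu> ?P)" by simp
  then show ?thesis using assms normal_norm[OF projection(1)[OF assms]]
    by (simp add: proj_def dist_norm infdist_nonneg)
qed

lemma dist_proj_le: "x \<in> closure G \<Longrightarrow> dist X (proj X) \<le> dist X x"
  using dist_proj[of X] infdist_frontier_le[of x G X] by (cases "X \<in> closure G") (auto simp: proj_def)

section \<open>One Euler step\<close>

lemma euler_increment:
  assumes h: "0 < h" "h \<le> 1" and tx: "t \<in> {0..T}" "x \<in> closure G" and e: "\<And>i. e $ i \<in> {-1, 1}"
  shows "norm (\<sigma> t x *v e) \<le> q" "norm (h *\<^sub>R b t x + sqrt h *\<^sub>R (\<sigma> t x *v e)) \<le> q * sqrt h"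
proof -
  have d: "norm (\<sigma> t x *v e) \<le> M * CARD('d)"
    using coeff_bound(2)[OF tx, of e] norm_sign_vector[OF e] const
    by (meson mult_left_mono order_trans zero_le_one)
  then show "norm (\<sigma> t x *v e) \<le> q" using const by (simp add: q_def distrib_left)
  have hs: "h \<le> sqrt h" using h by (simp add: real_le_rsqrt power2_eq_square mult_left_le_one_le)
  have "norm (h *\<^sub>R b t x + sqrt h *\<^sub>R (\<sigma> t x *v e)) \<le> h * norm (b t x) + sqrt h * norm (\<sigma> t x *v e)"
    using h by (intro order_trans[OF norm_triangle_ineq]) simp
  also have "\<dots> \<le> sqrt h * M + sqrt h * (M * CARD('d))"
    using hs h d coeff_bound(1)[OF tx] const by (intro add_mono mult_mono) auto
  finally show "norm (h *\<^sub>R b t x + sqrt h *\<^sub>R (\<sigma> t x *v e)) \<le> q * sqrt h"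
    by (simp add: q_def algebra_simps)
qed

text \<open>The differential equation solved for the second-order term; \<open>jet1\<close> in
  direction \<open>(1, b t x)\<close> collects the time derivative and the drift. It serves both to
  bound \<open>trace_part\<close> and to remove the terms of order \<open>h\<close> from an Euler
  step.\<close>

lemma half_trace_eq:
  assumes tx: "t \<in> {0..T}" "x \<in> closure G"
  shows "trace_part t x / 2
    = - jet1 D (t, x) (1, b t x) - c t x * D [] (t, x) - g t x"
  using pde[OF tx] by (simp add: gen_def jet1_split trace_part_def)

text \<open>The size of the noise matters twice, although its mean is 0: within a step, for the
  change of the value that \<open>c\<close> multiplies, and in the last step, where an error of
  order \<open>sqrt h\<close> is allowed.\<close>

lemma noise_part_bound:
  assumes h: "0 < h" "h \<le> 1" and tx: "t \<in> {0..T}" "x \<in> closure G" and e: "\<And>i. e $ i \<in> {-1, 1}"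
  shows "\<bar>noise_part h t x e\<bar> \<le> 6 * q ^ 3 * sqrt h"
proof -
  let ?w = "(0::real, \<sigma> t x *v e)"
  let ?tr = "trace_part t x"
  have z: "(t, x) \<in> {0..T} \<times> closure G" using tx by simp
  have q: "1 \<le> q" "M \<le> q" "0 < q" using q_ge by auto
  have q2: "q \<le> q\<^sup>2" "q\<^sup>2 \<le> q ^ 3" using q by (auto simp: self_le_power power_increasing)
  have nw: "norm ?w \<le> q" using euler_increment(1)[OF h tx e] by (simp add: norm_Pair)
  have hs: "h \<le> sqrt h" using h by (simp add: real_le_rsqrt power2_eq_square mult_left_le_one_le)
  have "\<bar>jet1 D (t, x) ?w\<bar> \<le> M * norm ?w" by (rule jet1_bound[OF z])
  also have "\<dots> \<le> q * q" using nw q const by (intro mult_mono) auto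
  finally have 1: "\<bar>jet1 D (t, x) ?w\<bar> \<le> q\<^sup>2" by (simp add: power2_eq_square)
  have "\<bar>jet2 D (t, x) ?w ?w\<bar> \<le> M * norm ?w * norm ?w" by (rule jet2_bound[OF z])
  also have "\<dots> \<le> q * q * q" using nw q const by (intro mult_mono) auto
  finally have 2: "\<bar>jet2 D (t, x) ?w ?w\<bar> \<le> q ^ 3" by (simp add: power3_eq_cube)
  have "norm (1::real, b t x) \<le> 1 + M"
    using norm_Pair_le[of "1::real" "b t x"] coeff_bound(1)[OF tx] by simp
  then have "\<bar>jet1 D (t, x) (1, b t x)\<bar> \<le> M * (1 + M)"
    using jet1_bound[OF z, of "(1, b t x)"] const by (meson mult_left_mono order_trans zero_le_one)
  moreover have "\<bar>c t x * D [] (t, x)\<bar> \<le> M * M"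
    unfolding abs_mult using coeff_bound(3)[OF tx] D_bound[OF z] const by (intro mult_mono) auto
  moreover have "\<bar>g t x\<bar> \<le> M" by (rule coeff_bound(4)[OF tx])
  ultimately have "\<bar>?tr / 2\<bar> \<le> M * (1 + M) + M * M + M" unfolding half_trace_eq[OF tx] by linarith
  also have "\<dots> = 2 * M + 2 * M\<^sup>2" by (simp add: power2_eq_square algebra_simps)
  also have "\<dots> \<le> 2 * q + 2 * q\<^sup>2" using q const by (intro add_mono mult_left_mono power_mono) auto
  also have "\<dots> \<le> 4 * q ^ 3" using q2 by linarith
  finally have 3: "\<bar>?tr / 2\<bar> \<le> 4 * q ^ 3" .
  have "\<bar>noise_part h t x e\<bar> \<le> sqrt h * \<bar>jet1 D (t, x) ?w\<bar> + h * (\<bar>jet2 D (t, x) ?w ?w\<bar> / 2 + \<bar>?tr / 2\<bar>)"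
  proof -
    have "noise_part h t x e = sqrt h * jet1 D (t, x) ?w + h * (jet2 D (t, x) ?w ?w / 2 - ?tr / 2)"
      by (simp add: noise_part_def algebra_simps)
    also have "\<bar>\<dots>\<bar> \<le> \<bar>sqrt h * jet1 D (t, x) ?w\<bar> + \<bar>h * (jet2 D (t, x) ?w ?w / 2 - ?tr / 2)\<bar>"
      by (rule abs_triangle_ineq)
    also have "\<dots> \<le> sqrt h * \<bar>jet1 D (t, x) ?w\<bar> + h * (\<bar>jet2 D (t, x) ?w ?w\<bar> / 2 + \<bar>?tr / 2\<bar>)"
      unfolding abs_mult using h abs_triangle_ineq4[of "jet2 D (t, x) ?w ?w / 2" "?tr / 2"]
      by (intro add_mono mult_mono) auto
    finally show ?thesis .
  qed
  \<comment> \<open>In total 1 + 1/2 + 4 times \<open>q ^ 3\<close>, rounded up to 6.\<close>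
  also have "\<dots> \<le> sqrt h * q ^ 3 + sqrt h * (q ^ 3 / 2 + 4 * q ^ 3)"
    using 1 2 3 q2 h hs by (intro add_mono mult_mono) auto
  also have "\<dots> \<le> 6 * q ^ 3 * sqrt h"
    using q h by (simp add: algebra_simps)
  finally show ?thesis .
qed

lemma cube_sqrt: "0 \<le> h \<Longrightarrow> sqrt h ^ 3 = h * sqrt h"
  by (simp add: power3_eq_cube)

text \<open>\<open>V\<close> at the new point is replaced by the polynomial with base
  \<open>(t, x)\<close>, at a cubic cost. By \<open>half_trace_eq\<close> the terms of that
  polynomial up to order \<open>h\<close> are the old value, the noise and
  \<open>- h * (c t x * D [] (t, x) + g t x)\<close>. The updates of \<open>Y\<close> and
  \<open>Z\<close> cancel the last of these, up to \<open>h * c t x\<close> times the change of the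
  value, which is of order \<open>sqrt h\<close>.\<close>

lemma interior_step:
  "\<exists>K\<ge>0. \<forall>h t x e. 0 < h \<longrightarrow> h \<le> 1 \<longrightarrow> sqrt h * (1 + 3 * q) < \<delta> \<longrightarrow> 0 \<le> t \<longrightarrow> t + h \<le> T \<longrightarrow>
     x \<in> closure G \<longrightarrow> (\<forall>i. e $ i \<in> {-1, 1}) \<longrightarrow>
     \<bar>V (t + h) (x + h *\<^sub>R b t x + sqrt h *\<^sub>R (\<sigma> t x *v e)) * (1 + h * c t x) + h * g t x - V t x
       - noise_part h t x e\<bar> \<le> K * (h * sqrt h)"
proof -
  \<comment> \<open>\<open>K1\<close> collects the change of base point and the quadratic terms
    \<open>E\<close> below; \<open>K\<close> adds the product of \<open>h * c t x\<close> with the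
    change of the value.\<close>
  define K1 where "K1 = M * (1 + 3 * q) ^ 3 + 3 * M * (1 + q)\<^sup>2"
  define K where "K = K1 + M * (6 * q ^ 3 + 2 * M\<^sup>2 + K1)"
  have q: "1 \<le> q" "M \<le> q" "0 < q" using q_ge by auto
  have M: "0 < M" using const by simp
  have K10: "0 \<le> K1" using q M by (simp add: K1_def)
  have K0: "0 \<le> K" using K10 q M by (simp add: K_def)
  show ?thesis
  proof (intro exI[of _ K] conjI K0 allI impI)
    fix h t :: real and x e :: "real^'d"
    assume h: "0 < h" "h \<le> 1" "sqrt h * (1 + 3 * q) < \<delta>" and t: "0 \<le> t" "t + h \<le> T"
      and x: "x \<in> closure G" and "\<forall>i. e $ i \<in> {-1, 1}"
    then have e: "\<And>i. e $ i \<in> {-1, 1}" by blast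
    have tx: "t \<in> {0..T}" using t h by simp
    let ?z = "(t, x)"
    have z: "?z \<in> {0..T} \<times> closure G" using tx x by simp
    define y where "y = x + h *\<^sub>R b t x + sqrt h *\<^sub>R (\<sigma> t x *v e)"
    let ?p = "(t + h, proj y)"
    have p: "?p \<in> {0..T} \<times> closure G" using t h proj_in by simp
    have hs: "h \<le> sqrt h" using h by (simp add: real_le_rsqrt power2_eq_square mult_left_le_one_le)
    have sh: "0 < sqrt h" "sqrt h \<le> 1" "sqrt h * sqrt h = h" using h by auto
    have inc: "norm (\<sigma> t x *v e) \<le> q" "dist y x \<le> q * sqrt h"
      using euler_increment[OF h(1,2) tx x e] by (auto simp: y_def dist_norm add.assoc)
    have dp: "dist y (proj y) \<le> q * sqrt h" using dist_proj_le[OF x, of y] inc by simp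
    have "dist x (proj y) \<le> 2 * q * sqrt h"
      using dist_triangle[of x "proj y" y] inc(2) dp by (simp add: dist_commute)
    then have dzp: "dist ?z ?p \<le> h + 2 * q * sqrt h"
      using norm_Pair_le[of "t - (t + h)" "x - proj y"] h by (simp add: dist_norm)
    have dpy: "dist ?p (t + h, y) \<le> q * sqrt h"
      using dp by (simp add: dist_Pair_Pair dist_commute)
    \<comment> \<open>Time contributes \<open>h \<le> sqrt h\<close>, the way from \<open>x\<close>
      to the projection \<open>2 * q * sqrt h\<close>, and the way from there to \<open>y\<close>
      another \<open>q * sqrt h\<close>.\<close>
    have dsum: "dist ?z ?p + dist ?p (t + h, y) \<le> (1 + 3 * q) * sqrt h"
      using dzp dpy hs by (simp add: algebra_simps)
    then have "dist ?z ?p < \<delta>" using h(3) zero_le_dist[of ?p "(t + h, y)"] unfolding mult.commute[of "1 + 3 * q"] by linarith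
    then have "\<bar>taylor2 D ?z (t + h, y) - V (t + h) y\<bar> \<le> M * (dist ?z ?p + dist ?p (t + h, y)) ^ 3"
      unfolding V_def using base_change[OF z p] by blast
    also have "\<dots> \<le> M * ((1 + 3 * q) * sqrt h) ^ 3"
      using dsum M by (intro mult_left_mono power_mono) auto
    also have "\<dots> = M * (1 + 3 * q) ^ 3 * (h * sqrt h)"
      using h by (simp add: power_mult_distrib cube_sqrt)
    finally have bc: "\<bar>taylor2 D ?z (t + h, y) - V (t + h) y\<bar> \<le> M * (1 + 3 * q) ^ 3 * (h * sqrt h)" .
    let ?w0 = "(0::real, \<sigma> t x *v e)" and ?w1 = "(1::real, b t x)"
    have v: "(t + h, y) - ?z = h *\<^sub>R ?w1 + sqrt h *\<^sub>R ?w0" by (simp add: y_def)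
    \<comment> \<open>The quadratic terms with at least one factor from the time shift and drift,
      hence of order \<open>h * sqrt h\<close> or smaller.\<close>
    define E where "E = sqrt h * h * (jet2 D ?z ?w0 ?w1 + jet2 D ?z ?w1 ?w0) + h * h * jet2 D ?z ?w1 ?w1"
    have "jet2 D ?z (h *\<^sub>R ?w1 + sqrt h *\<^sub>R ?w0) (h *\<^sub>R ?w1 + sqrt h *\<^sub>R ?w0)
        = (sqrt h * sqrt h) * jet2 D ?z ?w0 ?w0 + E"
      by (simp only: E_def jet2_add_left jet2_add_right jet2_scaleR_left jet2_scaleR_right)
        (simp add: algebra_simps)
    then have tay: "taylor2 D ?z (t + h, y) =
        D [] ?z + h * jet1 D ?z ?w1 + sqrt h * jet1 D ?z ?w0 + h / 2 * jet2 D ?z ?w0 ?w0 + E / 2"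
      unfolding taylor2_def v jet1_add jet1_scaleR sh(3) by simp
    have n0: "norm ?w0 \<le> 1 + q" using inc by (simp add: norm_Pair)
    have n1: "norm ?w1 \<le> 1 + q"
      using norm_Pair_le[of "1::real" "b t x"] coeff_bound(1)[OF tx x] q by simp
    have J: "\<bar>jet2 D ?z v w\<bar> \<le> M * (1 + q)\<^sup>2" if "norm v \<le> 1 + q" "norm w \<le> 1 + q" for v w
    proof -
      have "\<bar>jet2 D ?z v w\<bar> \<le> M * norm v * norm w" by (rule jet2_bound[OF z])
      also have "\<dots> \<le> M * (1 + q) * (1 + q)" using that M q by (intro mult_mono) auto
      finally show ?thesis by (simp add: power2_eq_square mult_ac)
    qed
    have "\<bar>E\<bar> \<le> sqrt h * h * (\<bar>jet2 D ?z ?w0 ?w1\<bar> + \<bar>jet2 D ?z ?w1 ?w0\<bar>) + h * h * \<bar>jet2 D ?z ?w1 ?w1\<bar>"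
    proof -
      have "\<bar>E\<bar> \<le> \<bar>sqrt h * h * (jet2 D ?z ?w0 ?w1 + jet2 D ?z ?w1 ?w0)\<bar> + \<bar>h * h * jet2 D ?z ?w1 ?w1\<bar>"
        unfolding E_def by (rule abs_triangle_ineq)
      also have "\<dots> \<le> sqrt h * h * (\<bar>jet2 D ?z ?w0 ?w1\<bar> + \<bar>jet2 D ?z ?w1 ?w0\<bar>) + h * h * \<bar>jet2 D ?z ?w1 ?w1\<bar>"
        unfolding abs_mult using h abs_triangle_ineq by (intro add_mono mult_mono) auto
      finally show ?thesis .
    qed
    also have "\<dots> \<le> sqrt h * h * (M * (1 + q)\<^sup>2 + M * (1 + q)\<^sup>2) + sqrt h * h * (M * (1 + q)\<^sup>2)"
      using h hs M by (intro add_mono mult_mono J n0 n1) auto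
    also have "\<dots> = 3 * M * (1 + q)\<^sup>2 * (h * sqrt h)" by (simp add: algebra_simps)
    finally have Eb: "\<bar>E\<bar> \<le> 3 * M * (1 + q)\<^sup>2 * (h * sqrt h)" .
    let ?V = "V (t + h) y" and ?u = "D [] ?z"
    have Npart: "h * jet1 D ?z ?w1 + sqrt h * jet1 D ?z ?w0 + h / 2 * jet2 D ?z ?w0 ?w0
        = noise_part h t x e - h * (c t x * ?u + g t x)"
    proof -
      have "noise_part h t x e = sqrt h * jet1 D ?z ?w0 + h / 2 * jet2 D ?z ?w0 ?w0
          - h * (trace_part t x / 2)"
        by (simp add: noise_part_def algebra_simps)
      then show ?thesis unfolding half_trace_eq[OF tx x] by (simp add: algebra_simps)
    qed
    \<comment> \<open>The defect of the step if \<open>c t x\<close> multiplied the old value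
      instead of the new one.\<close>
    define R where "R = ?V - ?u - noise_part h t x e + h * (c t x * ?u + g t x)"
    have "R = (?V - taylor2 D ?z (t + h, y)) + E / 2" using tay Npart by (simp add: R_def)
    then have "\<bar>R\<bar> \<le> \<bar>taylor2 D ?z (t + h, y) - ?V\<bar> + \<bar>E\<bar>" by linarith
    also have "\<dots> \<le> K1 * (h * sqrt h)" using bc Eb by (simp add: K1_def algebra_simps)
    finally have Rb: "\<bar>R\<bar> \<le> K1 * (h * sqrt h)" .
    have ub: "\<bar>c t x * ?u + g t x\<bar> \<le> 2 * M\<^sup>2"
    proof -
      have "\<bar>c t x * ?u\<bar> \<le> M * M"
        unfolding abs_mult using coeff_bound(3)[OF tx x] D_bound[OF z] M by (intro mult_mono) auto
      moreover have "\<bar>g t x\<bar> \<le> M * M"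
      proof -
        have "M * 1 \<le> M * M" using const by (intro mult_left_mono) auto
        then show ?thesis using coeff_bound(4)[OF tx x] by simp
      qed
      ultimately show ?thesis by (simp add: power2_eq_square)
    qed
    have diff: "\<bar>?V - ?u\<bar> \<le> (6 * q ^ 3 + 2 * M\<^sup>2 + K1) * sqrt h"
    proof -
      have "h * sqrt h \<le> 1 * sqrt h" using h by (intro mult_right_mono) auto
      then have "K1 * (h * sqrt h) \<le> K1 * (1 * sqrt h)" using K10 by (intro mult_left_mono)
      then have "\<bar>R\<bar> \<le> K1 * sqrt h" using Rb by simp
      moreover have "\<bar>h * (c t x * ?u + g t x)\<bar> \<le> sqrt h * (2 * M\<^sup>2)"
        unfolding abs_mult using ub hs h by (intro mult_mono) auto
      moreover have "\<bar>noise_part h t x e\<bar> \<le> 6 * q ^ 3 * sqrt h" by (rule noise_part_bound[OF h(1,2) tx x e])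
      moreover have "?V - ?u = R + noise_part h t x e - h * (c t x * ?u + g t x)" by (simp add: R_def)
      ultimately have "\<bar>?V - ?u\<bar> \<le> K1 * sqrt h + 6 * q ^ 3 * sqrt h + sqrt h * (2 * M\<^sup>2)" by linarith
      then show ?thesis by (simp add: algebra_simps)
    qed
    have "\<bar>h * (c t x * (?V - ?u))\<bar> \<le> h * (M * ((6 * q ^ 3 + 2 * M\<^sup>2 + K1) * sqrt h))"
      unfolding abs_mult using h M coeff_bound(3)[OF tx x] diff by (intro mult_mono) auto
    moreover have "?V * (1 + h * c t x) + h * g t x - V t x - noise_part h t x e = R + h * (c t x * (?V - ?u))"
      by (simp add: R_def V_inside[OF x] algebra_simps)
    ultimately have "\<bar>?V * (1 + h * c t x) + h * g t x - V t x - noise_part h t x e\<bar>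
        \<le> K1 * (h * sqrt h) + h * (M * ((6 * q ^ 3 + 2 * M\<^sup>2 + K1) * sqrt h))" using Rb by linarith
    also have "\<dots> = K * (h * sqrt h)" by (simp add: K_def algebra_simps)
    finally show "\<bar>V (t + h) (x + h *\<^sub>R b t x + sqrt h *\<^sub>R (\<sigma> t x *v e)) * (1 + h * c t x) + h * g t x - V t x
       - noise_part h t x e\<bar> \<le> K * (h * sqrt h)" by (simp add: y_def)
  qed
qed

section \<open>One projection\<close>

text \<open>\<open>X\<close> lies on the normal line through \<open>P\<close>, so the polynomial is
  quadratic in \<open>r\<close>, and its linear coefficient is the normal derivative that occurs in
  the boundary condition.\<close>

lemma V_outside:
  assumes t: "t \<in> {0..T}" and X: "X \<notin> closure G" "P = closest_point (frontier G) X" "r = infdist X (frontier G)"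
  shows "\<bar>V t X - (D [] (t, P) - r * (\<nu> P \<bullet> (\<chi> i. D [e_x i] (t, P))))\<bar> \<le> M * r\<^sup>2"
    "\<bar>\<nu> P \<bullet> (\<chi> i. D [e_x i] (t, P))\<bar> \<le> M"
proof -
  have P: "P \<in> frontier G" using X projection by simp
  have z: "(t, P) \<in> {0..T} \<times> closure G" using t frontier_closure[OF P] by simp
  have XP: "X = P - r *\<^sub>R \<nu> P" using projection(2)[OF X(1)] X by simp
  have nv: "norm (0::real, \<nu> P) = 1" using normal_norm[OF P] by (simp add: norm_Pair)
  have j1: "jet1 D (t, P) (0, \<nu> P) = \<nu> P \<bullet> (\<chi> i. D [e_x i] (t, P))"
    by (simp add: jet1_split inner_vec_def)
  have v: "(t, X) - (t, P) = (- r) *\<^sub>R (0, \<nu> P)" using XP by simp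
  have "V t X = D [] (t, P) - r * (\<nu> P \<bullet> (\<chi> i. D [e_x i] (t, P))) + r\<^sup>2 * jet2 D (t, P) (0, \<nu> P) (0, \<nu> P) / 2"
  proof -
    have "V t X = taylor2 D (t, P) (t, X)" using X by (simp add: V_def proj_def)
    also have "\<dots> = D [] (t, P) + (- r) * (\<nu> P \<bullet> (\<chi> i. D [e_x i] (t, P)))
        + (- r) * ((- r) * jet2 D (t, P) (0, \<nu> P) (0, \<nu> P)) / 2"
      unfolding taylor2_def v jet1_scaleR jet2_scaleR_left jet2_scaleR_right j1 by (rule refl)
    finally show ?thesis by (simp add: power2_eq_square)
  qed
  moreover have "\<bar>jet2 D (t, P) (0, \<nu> P) (0, \<nu> P)\<bar> \<le> M" using jet2_bound[OF z, of "(0, \<nu> P)" "(0, \<nu> P)"] nv by simp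
  then have "\<bar>r\<^sup>2 * jet2 D (t, P) (0, \<nu> P) (0, \<nu> P)\<bar> \<le> r\<^sup>2 * M" unfolding abs_mult by (intro mult_mono) auto
  ultimately show "\<bar>V t X - (D [] (t, P) - r * (\<nu> P \<bullet> (\<chi> i. D [e_x i] (t, P))))\<bar> \<le> M * r\<^sup>2"
    by (simp add: mult.commute)
  show "\<bar>\<nu> P \<bullet> (\<chi> i. D [e_x i] (t, P))\<bar> \<le> M" using jet1_bound[OF z, of "(0, \<nu> P)"] nv j1 by simp
qed

text \<open>This is \<open>base_change\<close> with \<open>y = p\<close>, where the second
  polynomial reduces to the value. It covers the times 0 and \<open>T\<close> and the boundary,
  where the derivatives are continuous extensions.\<close>

lemma time_expansion:
  assumes t: "0 \<le> t" "t + s \<le> T" and s: "0 \<le> s" "s < \<delta>" and x: "x \<in> closure G"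
  shows "\<bar>D [] (t + s, x) - (D [] (t, x) + s * D [e_t] (t, x))\<bar> \<le> 2 * M * s\<^sup>2" "\<bar>D [e_t] (t, x)\<bar> \<le> M"
proof -
  let ?z = "(t, x)" and ?p = "(t + s, x)"
  have z: "?z \<in> {0..T} \<times> closure G" "?p \<in> {0..T} \<times> closure G" using t s x by auto
  have d: "dist ?z ?p = s" using s by (simp add: dist_Pair_Pair dist_real_def)
  have "\<bar>taylor2 D ?z ?p - taylor2 D ?p ?p\<bar> \<le> M * (dist ?z ?p + dist ?p ?p) ^ 3"
    using s d by (intro base_change z) auto
  then have "\<bar>taylor2 D ?z ?p - D [] ?p\<bar> \<le> M * s ^ 3" by (simp add: d taylor2_self)
  also have "\<dots> \<le> M * s\<^sup>2" using s const by (intro mult_left_mono power_decreasing) auto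
  finally have 1: "\<bar>taylor2 D ?z ?p - D [] ?p\<bar> \<le> M * s\<^sup>2" .
  have ne: "norm (e_t :: real \<times> (real^'d)) = 1" by (simp add: norm_Pair)
  have v: "?p - ?z = s *\<^sub>R e_t" by simp
  have "taylor2 D ?z ?p = D [] ?z + s * D [e_t] ?z + s\<^sup>2 * jet2 D ?z e_t e_t / 2"
    unfolding taylor2_def v jet1_scaleR jet2_scaleR_left jet2_scaleR_right by (simp add: jet1_split power2_eq_square)
  moreover have "\<bar>s\<^sup>2 * jet2 D ?z e_t e_t\<bar> \<le> s\<^sup>2 * M"
    unfolding abs_mult using jet2_bound[OF z(1), of e_t e_t] ne by (intro mult_mono) auto
  ultimately show "\<bar>D [] (t + s, x) - (D [] (t, x) + s * D [e_t] (t, x))\<bar> \<le> 2 * M * s\<^sup>2"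
    using 1 by (simp add: mult.commute)
  show "\<bar>D [e_t] (t, x)\<bar> \<le> M" using jet1_bound[OF z(1), of e_t] ne by (simp add: jet1_split)
qed

text \<open>Sorted by powers of \<open>r\<close>, the first-order coefficient is the left-hand side
  of \<open>bnd\<close> and vanishes. The two Taylor errors remain, together with the product of the
  relative change of \<open>Y\<close> and the change of the value in time.\<close>

lemma projection_step:
  "\<exists>K\<ge>0. \<forall>t X P r. X \<notin> closure G \<longrightarrow> P = closest_point (frontier G) X \<longrightarrow> r = infdist X (frontier G) \<longrightarrow>
     M * r < \<delta> \<longrightarrow> 0 \<le> t \<longrightarrow> t + r * \<mu> P \<le> T \<longrightarrow>
     \<bar>V (t + r * \<mu> P) P * (1 + r * \<gamma> t P + r * \<mu> P * c t P) - r * \<psi> t P + r * \<mu> P * g t P - V t X\<bar> \<le> K * r\<^sup>2"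
proof -
  \<comment> \<open>In this order: \<open>E2\<close>, then \<open>E1\<close> by way of
    \<open>s \<le> M * r\<close>, then the product of the two changes.\<close>
  define K where "K = M + 2 * M ^ 3 + (M + M\<^sup>2) * (M\<^sup>2 + 2 * M ^ 3)"
  have M: "1 \<le> M" "0 < M" using const by auto
  show ?thesis
  proof (intro exI[of _ K] conjI allI impI)
    show "0 \<le> K" using M by (simp add: K_def)
    fix t r :: real and X P :: "real^'d"
    assume X: "X \<notin> closure G" "P = closest_point (frontier G) X" "r = infdist X (frontier G)"
      and r: "M * r < \<delta>" and t: "0 \<le> t" "t + r * \<mu> P \<le> T"
    have P: "P \<in> frontier G" using X projection by simp
    note Pc = frontier_closure[OF P]
    have r0: "0 \<le> r" using X by (simp add: infdist_nonneg)
    have "r \<le> M * r" using M r0 mult_right_mono[of 1 M r] by simp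
    then have r1: "r \<le> 1" using r const by simp
    define s where "s = r * \<mu> P"
    have \<mu>: "0 < \<mu> P" "\<mu> P \<le> M" using boundary_bound(3,4)[OF P] const by auto
    have s: "0 \<le> s" "s \<le> M * r" using r0 \<mu> mult_left_mono[of "\<mu> P" M r] by (auto simp: s_def mult.commute)
    have sd: "s < \<delta>" using s r by simp
    have tT: "t \<in> {0..T}" using t s by (simp add: s_def)
    let ?d = "D [] (t, P)" and ?dt = "D [e_t] (t, P)" and ?dn = "\<nu> P \<bullet> (\<chi> i. D [e_x i] (t, P))"
    define E1 where "E1 = V (t + s) P - (?d + s * ?dt)"
    define E2 where "E2 = V t X - (?d - r * ?dn)"
    have sM: "s\<^sup>2 \<le> M\<^sup>2 * r\<^sup>2" using power_mono[OF s(2) s(1), of 2] by (simp add: power_mult_distrib)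
    have "\<bar>E1\<bar> \<le> 2 * M * s\<^sup>2"
      unfolding E1_def V_inside[OF Pc] using t s sd Pc by (intro time_expansion) (auto simp: s_def)
    also have "\<dots> \<le> 2 * M * (M\<^sup>2 * r\<^sup>2)" using sM M by (intro mult_left_mono) auto
    finally have E1: "\<bar>E1\<bar> \<le> 2 * M ^ 3 * r\<^sup>2" by (simp add: power2_eq_square power3_eq_cube mult.assoc)
    have E2: "\<bar>E2\<bar> \<le> M * r\<^sup>2" unfolding E2_def by (rule V_outside(1)[OF tT X])
    have dt: "\<bar>?dt\<bar> \<le> M" using t s sd Pc by (intro time_expansion(2)[of t s]) (auto simp: s_def)
    let ?k = "\<gamma> t P + \<mu> P * c t P"
    have k: "\<bar>?k\<bar> \<le> M + M\<^sup>2"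
    proof -
      have "\<bar>\<mu> P * c t P\<bar> \<le> M * M"
        unfolding abs_mult using \<mu> coeff_bound(3)[OF tT Pc] M by (intro mult_mono) auto
      then show ?thesis using boundary_bound(1)[OF tT P] by (simp add: power2_eq_square)
    qed
    have incr: "\<bar>s * ?dt + E1\<bar> \<le> (M\<^sup>2 + 2 * M ^ 3) * r"
    proof -
      have "\<bar>s * ?dt\<bar> \<le> (M * r) * M" unfolding abs_mult using s dt r0 M by (intro mult_mono) auto
      moreover have "r\<^sup>2 \<le> r" using r0 r1 by (simp add: power2_eq_square mult_left_le_one_le)
      then have "2 * M ^ 3 * r\<^sup>2 \<le> 2 * M ^ 3 * r" using M by (intro mult_left_mono) auto
      ultimately have "\<bar>s * ?dt + E1\<bar> \<le> (M * r) * M + 2 * M ^ 3 * r" using E1 by linarith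
      then show ?thesis by (simp add: power2_eq_square algebra_simps)
    qed
    \<comment> \<open>The generator is eliminated between the differential equation and the boundary
      condition.\<close>
    have bnd: "\<mu> P * ?dt + ?k * ?d + ?dn - \<psi> t P + \<mu> P * g t P = 0"
    proof -
      let ?A = "gen b \<sigma> t P (\<chi> i. D [e_x i] (t, P)) (\<chi> i j. D [e_x j, e_x i] (t, P))"
      have "?A = - (?dt + c t P * ?d + g t P)" using pde[OF tT Pc] by linarith
      from boundary_condition[OF tT P, unfolded this] show ?thesis by (simp add: algebra_simps)
    qed
    have "V (t + s) P * (1 + r * \<gamma> t P + s * c t P) - r * \<psi> t P + s * g t P - V t X
        = r * (\<mu> P * ?dt + ?k * ?d + ?dn - \<psi> t P + \<mu> P * g t P) + E1 - E2 + r * (?k * (s * ?dt + E1))"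
      by (simp add: E1_def E2_def s_def algebra_simps)
    also have "\<dots> = E1 - E2 + r * (?k * (s * ?dt + E1))" by (simp only: bnd mult_zero_right add_0)
    finally have eq: "V (t + s) P * (1 + r * \<gamma> t P + s * c t P) - r * \<psi> t P + s * g t P - V t X
        = E1 - E2 + r * (?k * (s * ?dt + E1))" .
    have "\<bar>r * (?k * (s * ?dt + E1))\<bar> \<le> r * ((M + M\<^sup>2) * ((M\<^sup>2 + 2 * M ^ 3) * r))"
      unfolding abs_mult[of r] abs_mult[of ?k] using r0 k incr M by (intro mult_mono) auto
    then have "\<bar>V (t + s) P * (1 + r * \<gamma> t P + s * c t P) - r * \<psi> t P + s * g t P - V t X\<bar>
        \<le> 2 * M ^ 3 * r\<^sup>2 + M * r\<^sup>2 + r * ((M + M\<^sup>2) * ((M\<^sup>2 + 2 * M ^ 3) * r))"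
      unfolding eq using E1 E2 by linarith
    also have "\<dots> = K * r\<^sup>2" by (simp add: K_def power2_eq_square algebra_simps)
    finally show "\<bar>V (t + r * \<mu> P) P * (1 + r * \<gamma> t P + r * \<mu> P * c t P) - r * \<psi> t P + r * \<mu> P * g t P - V t X\<bar> \<le> K * r\<^sup>2"
      by (simp add: s_def)
  qed
qed

section \<open>The step that passes the final time\<close>

lemma terminal_time:
  assumes "0 \<le> t" "t \<le> T" "T - t < \<delta>" "x \<in> closure G"
  shows "\<bar>\<phi> x - D [] (t, x)\<bar> \<le> 3 * M * (T - t)"
proof -
  let ?s = "T - t"
  have "\<bar>D [] (t + ?s, x) - (D [] (t, x) + ?s * D [e_t] (t, x))\<bar> \<le> 2 * M * ?s\<^sup>2"
    using assms by (intro time_expansion) auto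
  moreover have "?s\<^sup>2 \<le> ?s * 1" unfolding power2_eq_square using assms const by (intro mult_left_mono) auto
  then have "2 * M * ?s\<^sup>2 \<le> 2 * M * ?s" using const by (intro mult_left_mono) auto
  moreover have "\<bar>?s * D [e_t] (t, x)\<bar> \<le> ?s * M"
    unfolding abs_mult using assms by (intro mult_mono time_expansion(2)[of t ?s]) auto
  moreover have "D [] (t + ?s, x) = \<phi> x" using terminal[OF assms(4)] by simp
  ultimately show ?thesis by (simp add: algebra_simps)
qed

text \<open>Such a step occurs once per path, so every contribution may be estimated crudely. The
  new point may lie outside the domain, where \<open>\<phi>\<close> is the extended function,
  controlled by its Lipschitz bound.\<close>

lemma interior_final_step:
  "\<exists>K\<ge>0. \<forall>h t x e. 0 < h \<longrightarrow> h \<le> 1 \<longrightarrow> sqrt h * (1 + 3 * q) < \<delta> \<longrightarrow> 0 \<le> t \<longrightarrow> t \<le> T \<longrightarrow> T \<le> t + h \<longrightarrow>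
     x \<in> closure G \<longrightarrow> (\<forall>i. e $ i \<in> {-1, 1}) \<longrightarrow>
     \<bar>\<phi> (x + h *\<^sub>R b t x + sqrt h *\<^sub>R (\<sigma> t x *v e)) * (1 + h * c t x) + h * g t x - V t x\<bar> \<le> K * sqrt h"
proof -
  define K where "K = M * q + 3 * M + (M * q + 4 * M) * M + M"
  have q: "1 \<le> q" "M \<le> q" "0 < q" using q_ge by auto
  have M: "0 < M" using const by simp
  show ?thesis
  proof (intro exI[of _ K] conjI allI impI)
    show "0 \<le> K" using q M by (simp add: K_def)
    fix h t :: real and x e :: "real^'d"
    assume h: "0 < h" "h \<le> 1" "sqrt h * (1 + 3 * q) < \<delta>" and t: "0 \<le> t" "t \<le> T" "T \<le> t + h"
      and x: "x \<in> closure G" and "\<forall>i. e $ i \<in> {-1, 1}"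
    then have e: "\<And>i. e $ i \<in> {-1, 1}" by blast
    have tx: "t \<in> {0..T}" using t by simp
    have hs: "h \<le> sqrt h" using h by (simp add: real_le_rsqrt power2_eq_square mult_left_le_one_le)
    have s1: "sqrt h \<le> 1" using h by simp
    define y where "y = x + h *\<^sub>R b t x + sqrt h *\<^sub>R (\<sigma> t x *v e)"
    have "dist y x \<le> q * sqrt h"
      using euler_increment[OF h(1,2) tx x e] by (auto simp: y_def dist_norm add.assoc)
    then have inc: "dist x y \<le> q * sqrt h" by (simp add: dist_commute)
    have small: "sqrt h < \<delta>" "q * sqrt h < \<delta>" using h(3) q h by (auto simp: algebra_simps intro: le_less_trans[OF _ h(3)])
    have "\<bar>\<phi> y - \<phi> x\<bar> \<le> M * dist x y" using inc small by (intro \<phi>_lipschitz x) auto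
    also have "\<dots> \<le> M * (q * sqrt h)" using inc M by (intro mult_left_mono) auto
    finally have 1: "\<bar>\<phi> y - \<phi> x\<bar> \<le> M * q * sqrt h" by simp
    have "\<bar>\<phi> x - D [] (t, x)\<bar> \<le> 3 * M * (T - t)" using t hs small x by (intro terminal_time) auto
    also have "\<dots> \<le> 3 * M * sqrt h" using t hs M by (intro mult_left_mono) auto
    finally have 2: "\<bar>\<phi> x - D [] (t, x)\<bar> \<le> 3 * M * sqrt h" .
    have "M * q * sqrt h \<le> M * q * 1" "3 * M * sqrt h \<le> 3 * M * 1" using M q s1 by (auto intro!: mult_left_mono)
    then have \<phi>y: "\<bar>\<phi> y\<bar> \<le> M * q + 4 * M"
      using 1 2 D_bound[of "(t, x)"] tx x by simp
    have "\<bar>\<phi> y * (h * c t x)\<bar> \<le> (M * q + 4 * M) * (sqrt h * M)"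
      unfolding abs_mult using \<phi>y hs h coeff_bound(3)[OF tx x] M q by (intro mult_mono) auto
    moreover have "\<bar>h * g t x\<bar> \<le> sqrt h * M"
      unfolding abs_mult using hs h coeff_bound(4)[OF tx x] M by (intro mult_mono) auto
    moreover have "\<phi> y * (1 + h * c t x) + h * g t x - V t x
        = (\<phi> y - \<phi> x) + (\<phi> x - D [] (t, x)) + \<phi> y * (h * c t x) + h * g t x"
      by (simp add: V_inside[OF x] algebra_simps)
    ultimately have "\<bar>\<phi> y * (1 + h * c t x) + h * g t x - V t x\<bar>
        \<le> M * q * sqrt h + 3 * M * sqrt h + (M * q + 4 * M) * (sqrt h * M) + sqrt h * M"
      using 1 2 by linarith
    also have "\<dots> = K * sqrt h" by (simp add: K_def algebra_simps)
    finally show "\<bar>\<phi> (x + h *\<^sub>R b t x + sqrt h *\<^sub>R (\<sigma> t x *v e)) * (1 + h * c t x) + h * g t x - V t x\<bar> \<le> K * sqrt h"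
      by (simp add: y_def)
  qed
qed

text \<open>Here \<open>T - t \<le> M * r\<close>, and every term is of order \<open>r\<close>; an
  error of first order is affordable once.\<close>

lemma projection_final_step:
  "\<exists>K\<ge>0. \<forall>t X P r. X \<notin> closure G \<longrightarrow> P = closest_point (frontier G) X \<longrightarrow> r = infdist X (frontier G) \<longrightarrow>
     M * r < \<delta> \<longrightarrow> 0 \<le> t \<longrightarrow> t \<le> T \<longrightarrow> T \<le> t + r * \<mu> P \<longrightarrow>
     \<bar>\<phi> P * (1 + r * \<gamma> t P + r * \<mu> P * c t P) - r * \<psi> t P + r * \<mu> P * g t P - V t X\<bar> \<le> K * r"
proof -
  define K where "K = 3 * M\<^sup>2 + M * (M + M\<^sup>2) + M + M\<^sup>2 + 2 * M"
  have M: "1 \<le> M" "0 < M" using const by auto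
  show ?thesis
  proof (intro exI[of _ K] conjI allI impI)
    show "0 \<le> K" using M by (simp add: K_def)
    fix t r :: real and X P :: "real^'d"
    assume X: "X \<notin> closure G" "P = closest_point (frontier G) X" "r = infdist X (frontier G)"
      and r: "M * r < \<delta>" and t: "0 \<le> t" "t \<le> T" "T \<le> t + r * \<mu> P"
    have P: "P \<in> frontier G" using X projection by simp
    note Pc = frontier_closure[OF P]
    have r0: "0 \<le> r" using X by (simp add: infdist_nonneg)
    have "r \<le> M * r" using M r0 mult_right_mono[of 1 M r] by simp
    then have r1: "r \<le> 1" using r const by simp
    have \<mu>: "0 < \<mu> P" "\<mu> P \<le> M" using boundary_bound(3,4)[OF P] const by auto
    have Tt: "T - t \<le> M * r" using t \<mu> r0 mult_left_mono[of "\<mu> P" M r] by (simp add: mult.commute)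
    have tT: "t \<in> {0..T}" using t by simp
    let ?d = "D [] (t, P)" and ?dn = "\<nu> P \<bullet> (\<chi> i. D [e_x i] (t, P))"
    have "\<bar>\<phi> P - ?d\<bar> \<le> 3 * M * (T - t)" using t Tt r Pc by (intro terminal_time) auto
    also have "\<dots> \<le> 3 * M * (M * r)" using Tt M by (intro mult_left_mono) auto
    finally have 1: "\<bar>\<phi> P - ?d\<bar> \<le> 3 * M * (M * r)" .
    have "M * r\<^sup>2 \<le> M * r" using r0 r1 M by (simp add: power2_eq_square mult_left_le_one_le)
    then have "\<bar>V t X - (?d - r * ?dn)\<bar> \<le> M * r" using V_outside(1)[OF tT X] by linarith
    moreover have "\<bar>r * ?dn\<bar> \<le> r * M" unfolding abs_mult using r0 V_outside(2)[OF tT X] by (intro mult_mono) auto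
    ultimately have 2: "\<bar>V t X - ?d\<bar> \<le> 2 * M * r" by (simp add: algebra_simps)
    let ?k = "\<gamma> t P + \<mu> P * c t P"
    have k: "\<bar>?k\<bar> \<le> M + M\<^sup>2"
    proof -
      have "\<bar>\<mu> P * c t P\<bar> \<le> M * M"
        unfolding abs_mult using \<mu> coeff_bound(3)[OF tT Pc] M by (intro mult_mono) auto
      then show ?thesis using boundary_bound(1)[OF tT P] by (simp add: power2_eq_square)
    qed
    have \<phi>P: "\<bar>\<phi> P\<bar> \<le> M" using D_bound[of "(T, P)"] terminal[OF Pc] Pc T_pos by simp
    have 3: "\<bar>r * (\<phi> P * ?k)\<bar> \<le> r * (M * (M + M\<^sup>2))"
      unfolding abs_mult[of r] abs_mult[of "\<phi> P"] using r0 k \<phi>P M by (intro mult_mono) auto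
    have 4: "\<bar>r * (\<mu> P * g t P)\<bar> \<le> r * (M * M)"
      unfolding abs_mult using r0 \<mu> coeff_bound(4)[OF tT Pc] M by (intro mult_mono) auto
    have 5: "\<bar>r * \<psi> t P\<bar> \<le> r * M" unfolding abs_mult using r0 boundary_bound(2)[OF tT P] by (intro mult_mono) auto
    have "\<phi> P * (1 + r * \<gamma> t P + r * \<mu> P * c t P) - r * \<psi> t P + r * \<mu> P * g t P - V t X
        = (\<phi> P - ?d) - (V t X - ?d) + r * (\<phi> P * ?k) - r * \<psi> t P + r * (\<mu> P * g t P)"
      by (simp add: algebra_simps)
    then have "\<bar>\<phi> P * (1 + r * \<gamma> t P + r * \<mu> P * c t P) - r * \<psi> t P + r * \<mu> P * g t P - V t X\<bar>
        \<le> 3 * M * (M * r) + 2 * M * r + r * (M * (M + M\<^sup>2)) + r * M + r * (M * M)"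
      using 1 2 3 4 5 by linarith
    also have "\<dots> = K * r" by (simp add: K_def power2_eq_square algebra_simps)
    finally show "\<bar>\<phi> P * (1 + r * \<gamma> t P + r * \<mu> P * c t P) - r * \<psi> t P + r * \<mu> P * g t P - V t X\<bar> \<le> K * r" .
  qed
qed

end

lemma pe_chain_cong:
  "(\<And>j. 1 \<le> j \<Longrightarrow> j \<le> k \<Longrightarrow> e j = e' j) \<Longrightarrow>
    pe_chain G b \<sigma> c g \<mu> \<gamma> \<psi> h e t0 x k = pe_chain G b \<sigma> c g \<mu> \<gamma> \<psi> h e' t0 x k"
  by (induction k) auto

context projected_euler
begin

section \<open>One-step bounds in units of elapsed time\<close>

text \<open>The third condition keeps the two base points of an Euler step within
  \<open>\<delta>\<close> of each other; the fourth does the same for the time shift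
  \<open>r * \<mu> P \<le> M * r\<close> of a projection.\<close>

definition small :: "real \<Rightarrow> bool" where
  "small h \<longleftrightarrow> 0 < h \<and> h \<le> 1 \<and> sqrt h * (1 + 3 * q) < \<delta> \<and> M * (q * sqrt h) < \<delta>"

text \<open>The distance is that of one Euler step: the chain leaves \<open>closure G\<close> by
  such a step only, and is projected at once.\<close>

definition near :: "real \<Rightarrow> real^'d \<Rightarrow> bool" where
  "near h X \<longleftrightarrow> X \<in> closure G \<or> infdist X (frontier G) \<le> q * sqrt h"

text \<open>A growth rate per elapsed time. \<open>c\<close> contributes \<open>M\<close>;
  \<open>\<gamma>\<close> acts over the distance \<open>r\<close>, which is at most
  \<open>r * \<mu> P / m\<close>, whence the denominator.\<close>

definition growth :: real where "growth = M + M * (1 + M) / m"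

lemma near_euler:
  assumes "0 < h" "h \<le> 1" "t \<in> {0..T}" "x \<in> closure G" "\<And>i. e $ i \<in> {-1, 1}"
  shows "near h (x + h *\<^sub>R b t x + sqrt h *\<^sub>R (\<sigma> t x *v e))" (is "near h ?y")
proof -
  have "dist ?y x \<le> q * sqrt h" using euler_increment(2)[OF assms] by (simp add: dist_norm add.assoc)
  then show ?thesis using infdist_frontier_le[OF assms(4), of ?y]
    by (cases "?y \<in> closure G") (auto simp: near_def intro: order_trans)
qed

lemma growth_ge: "M \<le> growth" "0 \<le> growth"
  using const by (auto simp: growth_def intro: add_nonneg_nonneg)

lemma abs_one_plus_le_exp: "\<bar>a\<bar> \<le> a' \<Longrightarrow> \<bar>1 + a\<bar> \<le> exp (a'::real)"
  using exp_ge_add_one_self[of a'] by linarith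

text \<open>All increments of \<open>Y\<close> and \<open>Z\<close> are proportional to
  \<open>Y\<close>, so the errors for unit weight get the factor \<open>Y\<close>. The noise is
  subtracted in the last step as well, which gives the noise along a path one uniform
  formula.\<close>

lemma interior_one_step:
  "\<exists>K\<ge>0. \<forall>h e t X Y Z Y' Z' y. small h \<longrightarrow> (\<forall>i. e $ i \<in> {-1, 1}) \<longrightarrow> 0 \<le> t \<longrightarrow> t \<le> T \<longrightarrow> X \<in> closure G \<longrightarrow>
     y = X + h *\<^sub>R b t X + sqrt h *\<^sub>R (\<sigma> t X *v e) \<longrightarrow> Y' = Y + h * c t X * Y \<longrightarrow> Z' = Z + h * g t X * Y \<longrightarrow>
     \<bar>Y'\<bar> \<le> \<bar>Y\<bar> * exp (growth * h) \<and> near h y \<and>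
     (t + h \<le> T \<longrightarrow> \<bar>V (t + h) y * Y' + Z' - (V t X * Y + Z) - Y * noise_part h t X e\<bar> \<le> K * sqrt h * \<bar>Y\<bar> * h) \<and>
     (T \<le> t + h \<longrightarrow> \<bar>\<phi> y * Y' + Z' - (V t X * Y + Z) - Y * noise_part h t X e\<bar> \<le> K * sqrt h * \<bar>Y\<bar>)"
proof -
  obtain K1 where K1: "0 \<le> K1" and step: "\<forall>h t x e. 0 < h \<longrightarrow> h \<le> 1 \<longrightarrow> sqrt h * (1 + 3 * q) < \<delta> \<longrightarrow> 0 \<le> t \<longrightarrow> t + h \<le> T \<longrightarrow>
     x \<in> closure G \<longrightarrow> (\<forall>i. e $ i \<in> {-1, 1}) \<longrightarrow>
     \<bar>V (t + h) (x + h *\<^sub>R b t x + sqrt h *\<^sub>R (\<sigma> t x *v e)) * (1 + h * c t x) + h * g t x - V t x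
       - noise_part h t x e\<bar> \<le> K1 * (h * sqrt h)"
    using interior_step by blast
  obtain K2 where K2: "0 \<le> K2" and final: "\<forall>h t x e. 0 < h \<longrightarrow> h \<le> 1 \<longrightarrow> sqrt h * (1 + 3 * q) < \<delta> \<longrightarrow> 0 \<le> t \<longrightarrow> t \<le> T \<longrightarrow> T \<le> t + h \<longrightarrow>
     x \<in> closure G \<longrightarrow> (\<forall>i. e $ i \<in> {-1, 1}) \<longrightarrow>
     \<bar>\<phi> (x + h *\<^sub>R b t x + sqrt h *\<^sub>R (\<sigma> t x *v e)) * (1 + h * c t x) + h * g t x - V t x\<bar> \<le> K2 * sqrt h"
    using interior_final_step by blast
  \<comment> \<open>The summand \<open>6 * q ^ 3\<close> pays for subtracting the noise in the last
    step.\<close>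
  define K where "K = K1 + (K2 + 6 * q ^ 3)"
  have q: "1 \<le> q" using q_ge by simp
  have K: "0 \<le> K" "K1 \<le> K" "K2 + 6 * q ^ 3 \<le> K" using K1 K2 q by (auto simp: K_def)
  show ?thesis
  proof (intro exI[of _ K] conjI allI impI)
    show "0 \<le> K" by (rule K)
    fix h t Y Z Y' Z' :: real and e X y :: "real^'d"
    assume "small h" and e: "\<forall>i. e $ i \<in> {-1, 1}" and t: "0 \<le> t" "t \<le> T" and X: "X \<in> closure G"
      and y: "y = X + h *\<^sub>R b t X + sqrt h *\<^sub>R (\<sigma> t X *v e)" and Y': "Y' = Y + h * c t X * Y"
      and Z': "Z' = Z + h * g t X * Y"
    then have h: "0 < h" "h \<le> 1" "sqrt h * (1 + 3 * q) < \<delta>" by (auto simp: small_def)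
    have tx: "t \<in> {0..T}" using t by simp
    show "near h y" unfolding y using e by (intro near_euler h tx X) auto
    have "\<bar>h * c t X\<bar> \<le> growth * h"
      using coeff_bound(3)[OF tx X] growth_ge h by (simp add: abs_mult mult.commute mult_left_mono)
    then have "\<bar>1 + h * c t X\<bar> \<le> exp (growth * h)" by (rule abs_one_plus_le_exp)
    moreover have "Y' = Y * (1 + h * c t X)" by (simp add: Y' algebra_simps)
    ultimately show "\<bar>Y'\<bar> \<le> \<bar>Y\<bar> * exp (growth * h)" by (simp add: abs_mult mult_left_mono)
    show "\<bar>V (t + h) y * Y' + Z' - (V t X * Y + Z) - Y * noise_part h t X e\<bar> \<le> K * sqrt h * \<bar>Y\<bar> * h" if "t + h \<le> T"
    proof -
      let ?r = "V (t + h) y * (1 + h * c t X) + h * g t X - V t X - noise_part h t X e"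
      have "V (t + h) y * Y' + Z' - (V t X * Y + Z) - Y * noise_part h t X e = Y * ?r"
        by (simp add: Y' Z' algebra_simps)
      moreover have "\<bar>?r\<bar> \<le> K1 * (h * sqrt h)" unfolding y using step h t that X e by blast
      then have "\<bar>?r\<bar> \<le> K * (h * sqrt h)" using K h by (meson mult_right_mono order_trans mult_nonneg_nonneg less_imp_le real_sqrt_ge_zero)
      then have "\<bar>Y\<bar> * \<bar>?r\<bar> \<le> \<bar>Y\<bar> * (K * (h * sqrt h))" by (rule mult_left_mono) simp
      ultimately show ?thesis by (simp add: abs_mult mult_ac)
    qed
    show "\<bar>\<phi> y * Y' + Z' - (V t X * Y + Z) - Y * noise_part h t X e\<bar> \<le> K * sqrt h * \<bar>Y\<bar>" if "T \<le> t + h"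
    proof -
      let ?r = "\<phi> y * (1 + h * c t X) + h * g t X - V t X" and ?n = "noise_part h t X e"
      have "\<phi> y * Y' + Z' - (V t X * Y + Z) - Y * ?n = Y * (?r - ?n)"
        by (simp add: Y' Z' algebra_simps)
      moreover have "\<bar>?r\<bar> \<le> K2 * sqrt h" unfolding y using final h t that X e by blast
      moreover have "\<bar>?n\<bar> \<le> 6 * q ^ 3 * sqrt h" using e by (intro noise_part_bound h tx X) auto
      ultimately have "\<bar>?r - ?n\<bar> \<le> (K2 + 6 * q ^ 3) * sqrt h" by (simp add: distrib_right)
      also have "\<dots> \<le> K * sqrt h" using K h by (intro mult_right_mono) auto
      finally have "\<bar>Y\<bar> * \<bar>?r - ?n\<bar> \<le> \<bar>Y\<bar> * (K * sqrt h)" by (rule mult_left_mono) simp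
      then show ?thesis using \<open>\<phi> y * Y' + Z' - (V t X * Y + Z) - Y * ?n = Y * (?r - ?n)\<close>
        by (simp add: abs_mult mult_ac)
    qed
  qed
qed

text \<open>The square of \<open>r\<close> is split: one factor is at most
  \<open>q * sqrt h\<close>, because the chain overshoots by one Euler step only, the other at most
  \<open>r * \<mu> P / m\<close>, a multiple of the elapsed time.\<close>

lemma projection_one_step:
  "\<exists>K\<ge>0. \<forall>h t X Y Z P r Y' Z'. small h \<longrightarrow> 0 \<le> t \<longrightarrow> t \<le> T \<longrightarrow> X \<notin> closure G \<longrightarrow> near h X \<longrightarrow>
     P = closest_point (frontier G) X \<longrightarrow> r = infdist X (frontier G) \<longrightarrow>
     Y' = Y + r * \<gamma> t P * Y + r * \<mu> P * c t P * Y \<longrightarrow> Z' = Z - r * \<psi> t P * Y + r * \<mu> P * g t P * Y \<longrightarrow>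
     P \<in> closure G \<and> 0 \<le> r * \<mu> P \<and> \<bar>Y'\<bar> \<le> \<bar>Y\<bar> * exp (growth * (r * \<mu> P)) \<and>
     (t + r * \<mu> P \<le> T \<longrightarrow> \<bar>V (t + r * \<mu> P) P * Y' + Z' - (V t X * Y + Z)\<bar> \<le> K * sqrt h * \<bar>Y\<bar> * (r * \<mu> P)) \<and>
     (T \<le> t + r * \<mu> P \<longrightarrow> \<bar>\<phi> P * Y' + Z' - (V t X * Y + Z)\<bar> \<le> K * sqrt h * \<bar>Y\<bar>)"
proof -
  obtain K1 where K1: "0 \<le> K1" and step: "\<forall>t X P r. X \<notin> closure G \<longrightarrow> P = closest_point (frontier G) X \<longrightarrow> r = infdist X (frontier G) \<longrightarrow>
     M * r < \<delta> \<longrightarrow> 0 \<le> t \<longrightarrow> t + r * \<mu> P \<le> T \<longrightarrow>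
     \<bar>V (t + r * \<mu> P) P * (1 + r * \<gamma> t P + r * \<mu> P * c t P) - r * \<psi> t P + r * \<mu> P * g t P - V t X\<bar> \<le> K1 * r\<^sup>2"
    using projection_step by blast
  obtain K2 where K2: "0 \<le> K2" and final: "\<forall>t X P r. X \<notin> closure G \<longrightarrow> P = closest_point (frontier G) X \<longrightarrow> r = infdist X (frontier G) \<longrightarrow>
     M * r < \<delta> \<longrightarrow> 0 \<le> t \<longrightarrow> t \<le> T \<longrightarrow> T \<le> t + r * \<mu> P \<longrightarrow>
     \<bar>\<phi> P * (1 + r * \<gamma> t P + r * \<mu> P * c t P) - r * \<psi> t P + r * \<mu> P * g t P - V t X\<bar> \<le> K2 * r"
    using projection_final_step by blast
  define K where "K = K1 * q / m + K2 * q"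
  have q: "1 \<le> q" using q_ge by simp
  have m: "0 < m" and M: "1 \<le> M" using const by auto
  have K: "0 \<le> K" "K1 * q / m \<le> K" "K2 * q \<le> K" using K1 K2 q m by (auto simp: K_def)
  show ?thesis
  proof (intro exI[of _ K] conjI allI impI)
    show "0 \<le> K" by (rule K)
    fix h t Y Z r Y' Z' :: real and X P :: "real^'d"
    assume h: "small h" and t: "0 \<le> t" "t \<le> T" and X: "X \<notin> closure G" and nX: "near h X"
      and P: "P = closest_point (frontier G) X" and r: "r = infdist X (frontier G)"
      and Y': "Y' = Y + r * \<gamma> t P * Y + r * \<mu> P * c t P * Y"
      and Z': "Z' = Z - r * \<psi> t P * Y + r * \<mu> P * g t P * Y"
    have h0: "0 < h" using h by (simp add: small_def)
    have tx: "t \<in> {0..T}" using t by simp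
    have Pf: "P \<in> frontier G" using projection(1)[OF X] P by simp
    then show Pc: "P \<in> closure G" by (rule frontier_closure)
    have \<mu>: "m \<le> \<mu> P" "0 < \<mu> P" using boundary_bound(3)[OF Pf] m by auto
    have r0: "0 \<le> r" by (simp add: r infdist_nonneg)
    have rq: "r \<le> q * sqrt h" using nX X by (simp add: near_def r)
    then have "M * r \<le> M * (q * sqrt h)" using M by (intro mult_left_mono) auto
    then have Mr: "M * r < \<delta>" using h by (simp add: small_def)
    have rm: "r \<le> r * \<mu> P / m" using \<mu> m r0 by (simp add: pos_le_divide_eq mult_left_mono)
    show "0 \<le> r * \<mu> P" using r0 \<mu> by simp
    let ?k = "r * \<gamma> t P + r * \<mu> P * c t P"
    have "\<bar>?k\<bar> \<le> growth * (r * \<mu> P)"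
    proof -
      have "\<bar>r * \<gamma> t P\<bar> \<le> r * M" unfolding abs_mult using r0 boundary_bound(1)[OF tx Pf] by (intro mult_mono) auto
      also have "\<dots> \<le> (r * \<mu> P / m) * M" using rm M by (intro mult_right_mono) auto
      also have "\<dots> \<le> (r * \<mu> P / m) * (M * (1 + M))" using r0 \<mu> m M by (intro mult_left_mono) auto
      finally have 1: "\<bar>r * \<gamma> t P\<bar> \<le> (r * \<mu> P / m) * (M * (1 + M))" .
      have "\<bar>r * \<mu> P * c t P\<bar> \<le> (r * \<mu> P) * M"
        unfolding abs_mult[of "r * \<mu> P"] using r0 \<mu> coeff_bound(3)[OF tx Pc] by (intro mult_mono) auto
      with 1 have "\<bar>?k\<bar> \<le> (r * \<mu> P / m) * (M * (1 + M)) + (r * \<mu> P) * M" by linarith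
      also have "\<dots> = growth * (r * \<mu> P)" by (simp add: growth_def algebra_simps)
      finally show ?thesis .
    qed
    then have "\<bar>1 + ?k\<bar> \<le> exp (growth * (r * \<mu> P))" by (rule abs_one_plus_le_exp)
    moreover have "Y' = Y * (1 + ?k)" by (simp add: Y' algebra_simps)
    ultimately show "\<bar>Y'\<bar> \<le> \<bar>Y\<bar> * exp (growth * (r * \<mu> P))" by (simp add: abs_mult mult_left_mono)
    show "\<bar>V (t + r * \<mu> P) P * Y' + Z' - (V t X * Y + Z)\<bar> \<le> K * sqrt h * \<bar>Y\<bar> * (r * \<mu> P)" if "t + r * \<mu> P \<le> T"
    proof -
      let ?r = "V (t + r * \<mu> P) P * (1 + r * \<gamma> t P + r * \<mu> P * c t P) - r * \<psi> t P + r * \<mu> P * g t P - V t X"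
      have eq: "V (t + r * \<mu> P) P * Y' + Z' - (V t X * Y + Z) = Y * ?r" by (simp add: Y' Z' algebra_simps)
      have "\<bar>?r\<bar> \<le> K1 * r\<^sup>2" using step X P r Mr t that by blast
      also have "\<dots> \<le> K1 * ((q * sqrt h) * (r * \<mu> P / m))"
        unfolding power2_eq_square using K1 rq rm r0 q h0 by (intro mult_left_mono mult_mono) auto
      also have "\<dots> = (K1 * q / m) * (sqrt h * (r * \<mu> P))" by simp
      also have "\<dots> \<le> K * (sqrt h * (r * \<mu> P))" using K r0 \<mu> h0 by (intro mult_right_mono) auto
      finally have "\<bar>Y\<bar> * \<bar>?r\<bar> \<le> \<bar>Y\<bar> * (K * (sqrt h * (r * \<mu> P)))" by (rule mult_left_mono) simp
      then show ?thesis unfolding eq abs_mult by (simp add: mult_ac)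
    qed
    show "\<bar>\<phi> P * Y' + Z' - (V t X * Y + Z)\<bar> \<le> K * sqrt h * \<bar>Y\<bar>" if "T \<le> t + r * \<mu> P"
    proof -
      let ?r = "\<phi> P * (1 + r * \<gamma> t P + r * \<mu> P * c t P) - r * \<psi> t P + r * \<mu> P * g t P - V t X"
      have eq: "\<phi> P * Y' + Z' - (V t X * Y + Z) = Y * ?r" by (simp add: Y' Z' algebra_simps)
      have "\<bar>?r\<bar> \<le> K2 * r" using final X P r Mr t that by blast
      also have "\<dots> \<le> K2 * (q * sqrt h)" using rq K2 by (rule mult_left_mono)
      also have "\<dots> \<le> K * sqrt h" using K h0 mult_right_mono[OF K(3), of "sqrt h"] by simp
      finally have "\<bar>Y\<bar> * \<bar>?r\<bar> \<le> \<bar>Y\<bar> * (K * sqrt h)" by (rule mult_left_mono) simp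
      then show ?thesis unfolding eq abs_mult by (simp add: mult_ac)
    qed
  qed
qed

end

section \<open>Errors along a path\<close>

context projected_euler
begin

definition value_of :: "real \<times> (real^'d) \<times> real \<times> real \<Rightarrow> real" where
  "value_of = (\<lambda>(t, X, Y, Z). V t X * Y + Z)"

definition payoff :: "real \<times> (real^'d) \<times> real \<times> real \<Rightarrow> real" where
  "payoff = (\<lambda>(t, X, Y, Z). \<phi> X * Y + Z)"

text \<open>Zero outside \<open>closure G\<close>, because a projection uses no sign.\<close>

definition state_noise :: "real \<Rightarrow> real \<times> (real^'d) \<times> real \<times> real \<Rightarrow> real^'d \<Rightarrow> real" where
  "state_noise h = (\<lambda>(t, X, Y, Z) e. if X \<in> closure G then Y * noise_part h t X e else 0)"

text \<open>A potential for counting steps: an Euler step may raise it by one, a projection lowers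
  it by one. Twice the elapsed time of an Euler step pays for the step itself and for the projection
  that may follow.\<close>

definition exterior :: "real \<times> (real^'d) \<times> real \<times> real \<Rightarrow> nat" where
  "exterior = (\<lambda>(t, X, Y, Z). if X \<in> closure G then 0 else 1)"

definition admissible :: "real \<Rightarrow> real \<times> (real^'d) \<times> real \<times> real \<Rightarrow> bool" where
  "admissible h = (\<lambda>(t, X, Y, Z). 0 \<le> t \<and> near h X)"

abbreviation step :: "real \<Rightarrow> real^'d \<Rightarrow> real \<times> (real^'d) \<times> real \<times> real \<Rightarrow> real \<times> (real^'d) \<times> real \<times> real" where
  "step \<equiv> pe_step G b \<sigma> c g \<mu> \<gamma> \<psi>"

abbreviation chain :: "real \<Rightarrow> (nat \<Rightarrow> real^'d) \<Rightarrow> real \<Rightarrow> real^'d \<Rightarrow> nat \<Rightarrow> real \<times> (real^'d) \<times> real \<times> real" where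
  "chain \<equiv> pe_chain G b \<sigma> c g \<mu> \<gamma> \<psi>"

text \<open>Every error but that of the last step carries the elapsed time as a factor, so the
  errors telescope along a path; for the same reason the growth of \<open>Y\<close> is an
  exponential in the elapsed time.\<close>

definition step_bounds :: "real \<Rightarrow> real \<Rightarrow> real^'d \<Rightarrow> real \<times> (real^'d) \<times> real \<times> real \<Rightarrow>
    real \<times> (real^'d) \<times> real \<times> real \<Rightarrow> bool" where
  "step_bounds K h e s s' \<longleftrightarrow> admissible h s' \<and> fst s \<le> fst s' \<and>
     h * (1 + real (exterior s') - real (exterior s)) \<le> 2 * (fst s' - fst s) \<and>
     \<bar>fst (snd (snd s'))\<bar> \<le> \<bar>fst (snd (snd s))\<bar> * exp (growth * (fst s' - fst s)) \<and>
     (fst s' \<le> T \<longrightarrow> \<bar>value_of s' - value_of s - state_noise h s e\<bar>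
        \<le> K * sqrt h * \<bar>fst (snd (snd s))\<bar> * (fst s' - fst s)) \<and>
     (T \<le> fst s' \<longrightarrow> \<bar>payoff s' - value_of s - state_noise h s e\<bar> \<le> K * sqrt h * \<bar>fst (snd (snd s))\<bar>)"

text \<open>\<open>n\<close> is the stopping index. Its bound is the same for all signs, which later
  permits truncation at a fixed number of steps.\<close>

definition path_bounds :: "real \<Rightarrow> real \<Rightarrow> (nat \<Rightarrow> real^'d) \<Rightarrow> real \<Rightarrow> real^'d \<Rightarrow> bool" where
  "path_bounds C h e t0 x \<longleftrightarrow>
    (\<exists>n. 0 < n \<and> real n * h \<le> 2 * T + h \<and> (\<forall>j<n. fst (chain h e t0 x j) < T) \<and> T \<le> fst (chain h e t0 x n) \<and>
      \<bar>payoff (chain h e t0 x n) - D [] (t0, x) - (\<Sum>j<n. state_noise h (chain h e t0 x j) (e (Suc j)))\<bar> \<le> C * sqrt h)"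

text \<open>
  The third conjunct of \<open>step_bounds\<close> bounds the number of steps: a projection may take almost no time,
  but it is always followed by an Euler step.
\<close>

lemma one_step:
  "\<exists>K\<ge>0. \<forall>h e s s'. small h \<longrightarrow> (\<forall>i. e $ i \<in> {-1, 1}) \<longrightarrow> admissible h s \<longrightarrow> fst s \<le> T \<longrightarrow> s' = step h e s \<longrightarrow>
     step_bounds K h e s s'"
proof -
  obtain K1 where K1: "0 \<le> K1" and int: "\<forall>h e t X Y Z Y' Z' y. small h \<longrightarrow> (\<forall>i. e $ i \<in> {-1, 1}) \<longrightarrow> 0 \<le> t \<longrightarrow> t \<le> T \<longrightarrow> X \<in> closure G \<longrightarrow>
     y = X + h *\<^sub>R b t X + sqrt h *\<^sub>R (\<sigma> t X *v e) \<longrightarrow> Y' = Y + h * c t X * Y \<longrightarrow> Z' = Z + h * g t X * Y \<longrightarrow>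
     \<bar>Y'\<bar> \<le> \<bar>Y\<bar> * exp (growth * h) \<and> near h y \<and>
     (t + h \<le> T \<longrightarrow> \<bar>V (t + h) y * Y' + Z' - (V t X * Y + Z) - Y * noise_part h t X e\<bar> \<le> K1 * sqrt h * \<bar>Y\<bar> * h) \<and>
     (T \<le> t + h \<longrightarrow> \<bar>\<phi> y * Y' + Z' - (V t X * Y + Z) - Y * noise_part h t X e\<bar> \<le> K1 * sqrt h * \<bar>Y\<bar>)"
    using interior_one_step by blast
  obtain K2 where K2: "0 \<le> K2" and ext: "\<forall>h t X Y Z P r Y' Z'. small h \<longrightarrow> 0 \<le> t \<longrightarrow> t \<le> T \<longrightarrow> X \<notin> closure G \<longrightarrow> near h X \<longrightarrow>
     P = closest_point (frontier G) X \<longrightarrow> r = infdist X (frontier G) \<longrightarrow>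
     Y' = Y + r * \<gamma> t P * Y + r * \<mu> P * c t P * Y \<longrightarrow> Z' = Z - r * \<psi> t P * Y + r * \<mu> P * g t P * Y \<longrightarrow>
     P \<in> closure G \<and> 0 \<le> r * \<mu> P \<and> \<bar>Y'\<bar> \<le> \<bar>Y\<bar> * exp (growth * (r * \<mu> P)) \<and>
     (t + r * \<mu> P \<le> T \<longrightarrow> \<bar>V (t + r * \<mu> P) P * Y' + Z' - (V t X * Y + Z)\<bar> \<le> K2 * sqrt h * \<bar>Y\<bar> * (r * \<mu> P)) \<and>
     (T \<le> t + r * \<mu> P \<longrightarrow> \<bar>\<phi> P * Y' + Z' - (V t X * Y + Z)\<bar> \<le> K2 * sqrt h * \<bar>Y\<bar>)"
    using projection_one_step by blast
  define K where "K = max K1 K2"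
  have mono: "K1 * sqrt h * a \<le> K * sqrt h * a" "K2 * sqrt h * a \<le> K * sqrt h * a" if "0 < h" "0 \<le> a" for h a
    using that by (auto simp: K_def intro!: mult_right_mono)
  show ?thesis
  proof (intro exI[of _ K] conjI[of "0 \<le> K"] allI impI)
    show "0 \<le> K" using K1 by (simp add: K_def)
    fix h and e :: "real^'d" and s s'
    assume h: "small h" and e: "\<forall>i. e $ i \<in> {-1, 1}" and s: "admissible h s" and sT: "fst s \<le> T" and s': "s' = step h e s"
    obtain t X Y Z where st: "s = (t, X, Y, Z)" by (cases s)
    have h0: "0 < h" using h by (simp add: small_def)
    have t: "0 \<le> t" "t \<le> T" "near h X" using s sT by (auto simp: st admissible_def)
    show "step_bounds K h e s s'"
    proof (cases "X \<in> closure G")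
      case True
      define y where "y = X + h *\<^sub>R b t X + sqrt h *\<^sub>R (\<sigma> t X *v e)"
      define Y' where "Y' = Y + h * c t X * Y"
      define Z' where "Z' = Z + h * g t X * Y"
      have s'': "s' = (t + h, y, Y', Z')" using True by (simp add: s' st pe_step_def y_def Y'_def Z'_def)
      note I = int[rule_format, OF h _ t(1,2) True y_def Y'_def Z'_def, OF e[rule_format]]
      have "exterior s' \<le> 1" "exterior s = 0" using True by (auto simp: exterior_def st s'')
      then have "h * (1 + real (exterior s') - real (exterior s)) \<le> h * 2" using h0 by (intro mult_left_mono) auto
      then show ?thesis
        using I h0 t True mono(1)[OF h0, of "\<bar>Y\<bar> * h"] mono(1)[OF h0, of "\<bar>Y\<bar>"]
        by (auto simp: step_bounds_def st s'' admissible_def value_of_def payoff_def state_noise_def mult.assoc intro: order_trans)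
    next
      case False
      define P where "P = closest_point (frontier G) X"
      define r where "r = infdist X (frontier G)"
      define Y' where "Y' = Y + r * \<gamma> t P * Y + r * \<mu> P * c t P * Y"
      define Z' where "Z' = Z - r * \<psi> t P * Y + r * \<mu> P * g t P * Y"
      have s'': "s' = (t + r * \<mu> P, P, Y', Z')"
        using False by (simp add: s' st pe_step_def Let_def P_def r_def Y'_def Z'_def)
      note I = ext[rule_format, OF h t(1,2) False t(3) P_def r_def Y'_def Z'_def]
      have "exterior s' = 0" "exterior s = 1" using False I by (auto simp: exterior_def st s'')
      then show ?thesis
        using I h0 t False mono(2)[OF h0, of "\<bar>Y\<bar> * (r * \<mu> P)"] mono(2)[OF h0, of "\<bar>Y\<bar>"]
        by (auto simp: step_bounds_def st s'' admissible_def value_of_def payoff_def state_noise_def near_def mult.assoc intro: order_trans)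
    qed
  qed
qed

text \<open>Summation of \<open>step_bounds\<close>: the factors for \<open>Y\<close> multiply to at
  most \<open>exp (growth * T)\<close>, the errors add up to a multiple of the total time, and the
  last step is paid once.\<close>

lemma path_estimate:
  assumes t0: "0 \<le> t0" "t0 < T" and x: "x \<in> closure G"
  shows "\<exists>C\<ge>0. \<forall>h e. small h \<longrightarrow> sign_seq e \<longrightarrow> path_bounds C h e t0 x"
proof -
  obtain K where K: "0 \<le> K" and one: "\<forall>h e s s'. small h \<longrightarrow> (\<forall>i. e $ i \<in> {-1, 1}) \<longrightarrow> admissible h s \<longrightarrow> fst s \<le> T \<longrightarrow> s' = step h e s \<longrightarrow>
     step_bounds K h e s s'"
    using one_step by blast
  define B where "B = exp (growth * T)"
  have B: "0 < B" by (simp add: B_def)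
  define C where "C = K * B * T + K * B"
  have C0: "0 \<le> C" using K B T_pos by (simp add: C_def)
  show ?thesis
  proof (intro exI[of _ C] conjI C0 allI impI)
    fix h :: real and e :: "nat \<Rightarrow> real^'d"
    assume h: "small h" and e: "sign_seq e"
    have h0: "0 < h" using h by (simp add: small_def)
    define S where "S = chain h e t0 x"
    define Y where "Y k = \<bar>fst (snd (snd (S k)))\<bar>" for k
    define N where "N j = state_noise h (S j) (e (Suc j))" for j
    have S0: "S 0 = (t0, x, 1, 0)" and SS: "S (Suc k) = step h (e (Suc k)) (S k)" for k by (simp_all add: S_def)
    have ee: "\<forall>i. e (Suc k) $ i \<in> {-1, 1}" for k using e by (simp add: sign_seq_def)
    \<comment> \<open>Only indices before the final time is reached are covered; the potential is
      carried along because it bounds \<open>k\<close>.\<close>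
    have inv: "admissible h (S k) \<and> t0 \<le> fst (S k) \<and> h * (real k + real (exterior (S k))) \<le> 2 * (fst (S k) - t0) \<and>
       Y k \<le> exp (growth * (fst (S k) - t0)) \<and>
       \<bar>value_of (S k) - D [] (t0, x) - (\<Sum>j<k. N j)\<bar> \<le> K * sqrt h * B * (fst (S k) - t0)"
      if "\<forall>j\<le>k. fst (S j) < T" for k
      using that
    proof (induction k)
      case 0
      show ?case using t0 x by (simp add: S0 admissible_def near_def exterior_def Y_def value_of_def V_inside)
    next
      case (Suc k)
      then have IH: "admissible h (S k)" "t0 \<le> fst (S k)" "h * (real k + real (exterior (S k))) \<le> 2 * (fst (S k) - t0)"
        "Y k \<le> exp (growth * (fst (S k) - t0))"
        "\<bar>value_of (S k) - D [] (t0, x) - (\<Sum>j<k. N j)\<bar> \<le> K * sqrt h * B * (fst (S k) - t0)"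
        by auto
      have lt: "fst (S k) < T" "fst (S (Suc k)) < T" using Suc.prems by auto
      note I = one[rule_format, OF h ee[rule_format] IH(1) less_imp_le[OF lt(1)] SS, unfolded step_bounds_def]
      let ?d = "fst (S (Suc k)) - fst (S k)"
      have "h * (real (Suc k) + real (exterior (S (Suc k)))) =
          h * (1 + real (exterior (S (Suc k))) - real (exterior (S k))) + h * (real k + real (exterior (S k)))"
        by (simp add: algebra_simps)
      also have "\<dots> \<le> 2 * (fst (S (Suc k)) - t0)" using I IH(3) by argo
      finally have steps: "h * (real (Suc k) + real (exterior (S (Suc k)))) \<le> 2 * (fst (S (Suc k)) - t0)" .
      have "Y (Suc k) \<le> Y k * exp (growth * ?d)" using I by (simp add: Y_def)
      also have "\<dots> \<le> exp (growth * (fst (S k) - t0)) * exp (growth * ?d)" using IH(4) by (rule mult_right_mono) simp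
      also have "\<dots> = exp (growth * (fst (S (Suc k)) - t0))" by (simp add: exp_add[symmetric] algebra_simps)
      finally have Ybd: "Y (Suc k) \<le> exp (growth * (fst (S (Suc k)) - t0))" .
      have "growth * (fst (S k) - t0) \<le> growth * T" using lt t0 growth_ge by (intro mult_left_mono) auto
      then have YB: "Y k \<le> B" using IH(4) unfolding B_def by (meson exp_le_cancel_iff order_trans)
      have "\<bar>value_of (S (Suc k)) - value_of (S k) - N k\<bar> \<le> K * sqrt h * Y k * ?d"
        using I lt by (simp add: Y_def N_def)
      also have "\<dots> \<le> K * sqrt h * B * ?d" using YB I K h0 by (intro mult_right_mono mult_left_mono) auto
      finally have "\<bar>value_of (S (Suc k)) - value_of (S k) - N k\<bar> \<le> K * sqrt h * B * ?d" .
      with IH(5) have "\<bar>value_of (S (Suc k)) - D [] (t0, x) - (\<Sum>j<Suc k. N j)\<bar>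
          \<le> K * sqrt h * B * (fst (S k) - t0) + K * sqrt h * B * ?d" by simp
      also have "\<dots> = K * sqrt h * B * (fst (S (Suc k)) - t0)" by (simp add: algebra_simps)
      finally show ?case using I IH(2) steps Ybd by auto
    qed
    have elapsed: "h * real k \<le> 2 * T" if "h * (real k + real l) \<le> 2 * (a - t0)" "a < T" for k l :: nat and a
    proof -
      have "h * real k \<le> h * (real k + real l)" using h0 by simp
      also have "\<dots> \<le> 2 * (a - t0)" by (rule that(1))
      also have "\<dots> \<le> 2 * T" using that(2) t0 by simp
      finally show ?thesis .
    qed
    \<comment> \<open>If the final time were never reached, the potential bound would hold for every
      \<open>k\<close> and limit it by \<open>2 * T / h\<close>.\<close>
    have "\<exists>n. T \<le> fst (S n)"
    proof (rule ccontr)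
      assume "\<not> ?thesis"
      then have lt: "fst (S k) < T" for k by (simp add: not_le)
      obtain k :: nat where k: "2 * T / h < real k" using reals_Archimedean2 by blast
      have "h * (real k + real (exterior (S k))) \<le> 2 * (fst (S k) - t0)" using inv lt by blast
      then have "h * real k \<le> 2 * T" using lt by (rule elapsed)
      then show False using k h0 by (simp add: field_simps)
    qed
    then obtain n where n: "T \<le> fst (S n)" "\<forall>j<n. fst (S j) < T"
      using exists_least_iff[of "\<lambda>n. T \<le> fst (S n)"] by (auto simp: not_le)
    have "n \<noteq> 0" using n t0 S0 by (cases n) auto
    \<comment> \<open>Index \<open>k\<close> is the last one before the final time, where the
      invariant still applies.\<close>
    then obtain k where k: "n = Suc k" using not0_implies_Suc by blast
    have "\<forall>j\<le>k. fst (S j) < T" using n k by auto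
    note J = inv[OF this]
    have lt: "fst (S k) < T" using n k by auto
    have adm: "admissible h (S k)" using J by blast
    note I = one[rule_format, OF h ee[rule_format] adm less_imp_le[OF lt] SS, unfolded step_bounds_def]
    have "growth * (fst (S k) - t0) \<le> growth * T" using lt t0 growth_ge by (intro mult_left_mono) auto
    then have YB: "Y k \<le> B" using J unfolding B_def by (meson exp_le_cancel_iff order_trans)
    have "\<bar>payoff (S n) - value_of (S k) - N k\<bar> \<le> K * sqrt h * Y k" using I n by (simp add: k Y_def N_def)
    also have "\<dots> \<le> K * sqrt h * B" using YB K h0 by (intro mult_left_mono) auto
    finally have last: "\<bar>payoff (S n) - value_of (S k) - N k\<bar> \<le> K * sqrt h * B" .
    have "K * sqrt h * B * (fst (S k) - t0) \<le> K * sqrt h * B * T" using lt t0 K B h0 by (intro mult_left_mono) auto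
    then have "\<bar>value_of (S k) - D [] (t0, x) - (\<Sum>j<k. N j)\<bar> \<le> K * sqrt h * B * T" using J by linarith
    with last have "\<bar>payoff (S n) - D [] (t0, x) - (\<Sum>j<n. N j)\<bar> \<le> K * sqrt h * B * T + K * sqrt h * B"
      by (simp add: k)
    also have "\<dots> = C * sqrt h" by (simp add: C_def algebra_simps)
    finally have est: "\<bar>payoff (S n) - D [] (t0, x) - (\<Sum>j<n. N j)\<bar> \<le> C * sqrt h" .
    \<comment> \<open>The step from \<open>k\<close> to \<open>n\<close> accounts for the extra
      \<open>h\<close> in \<open>path_bounds\<close>.\<close>
    have "h * real k \<le> 2 * T" using J lt by (blast intro: elapsed)
    then have "real n * h \<le> 2 * T + h" by (simp add: k algebra_simps)
    then show "path_bounds C h e t0 x"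
      using n est k unfolding path_bounds_def S_def N_def by blast
  qed
qed

section \<open>From paths to expectations\<close>

text \<open>In the quadratic form the terms with equal indices have \<open>e $ k * e $ k = 1\<close>
  and add up to \<open>trace_part\<close>, so centring removes them exactly. The linear and
  off-diagonal terms remain, in the shape required by
  \<open>sign_noise_expectation_bound\<close>.\<close>

lemma noise_part_expand:
  assumes e: "\<And>i. e $ i \<in> {-1, 1}"
  shows "noise_part h t x e =
    (\<Sum>k\<in>UNIV. (sqrt h * (\<Sum>i\<in>UNIV. \<sigma> t x $ i $ k * D [e_x i] (t, x))) * e $ k)
    + (\<Sum>k\<in>UNIV. \<Sum>l\<in>UNIV - {k}. (h / 2 * (\<Sum>i\<in>UNIV. \<Sum>j\<in>UNIV. \<sigma> t x $ i $ k * \<sigma> t x $ j $ l * D [e_x j, e_x i] (t, x)))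
         * e $ k * e $ l)"
proof -
  let ?B = "\<lambda>k l. \<Sum>i\<in>UNIV. \<Sum>j\<in>UNIV. \<sigma> t x $ i $ k * \<sigma> t x $ j $ l * D [e_x j, e_x i] (t, x)"
  have 1: "jet1 D (t, x) (0, \<sigma> t x *v e) = (\<Sum>k\<in>UNIV. (\<Sum>i\<in>UNIV. \<sigma> t x $ i $ k * D [e_x i] (t, x)) * e $ k)"
    unfolding jet1_split matrix_vector_mult_def
    by (simp add: sum_distrib_right sum_distrib_left, subst sum.swap) (simp add: mult_ac)
  have 2: "jet2 D (t, x) (0, \<sigma> t x *v e) (0, \<sigma> t x *v e) = (\<Sum>k\<in>UNIV. \<Sum>l\<in>UNIV. ?B k l * e $ k * e $ l)"
  proof -
    let ?F = "\<lambda>i j k l. \<sigma> t x $ i $ k * \<sigma> t x $ j $ l * D [e_x j, e_x i] (t, x) * e $ k * e $ l"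
    have "jet2 D (t, x) (0, \<sigma> t x *v e) (0, \<sigma> t x *v e) =
        (\<Sum>i\<in>UNIV. \<Sum>j\<in>UNIV. \<Sum>k\<in>UNIV. \<Sum>l\<in>UNIV. ?F i j k l)"
      unfolding jet2_space matrix_vector_mult_def
      by (simp only: vec_lambda_beta sum_product) (simp add: sum_distrib_left mult_ac)
    also have "\<dots> = (\<Sum>i\<in>UNIV. \<Sum>k\<in>UNIV. \<Sum>j\<in>UNIV. \<Sum>l\<in>UNIV. ?F i j k l)"
      by (intro sum.cong refl sum.swap)
    also have "\<dots> = (\<Sum>k\<in>UNIV. \<Sum>i\<in>UNIV. \<Sum>j\<in>UNIV. \<Sum>l\<in>UNIV. ?F i j k l)"
      by (rule sum.swap)
    also have "\<dots> = (\<Sum>k\<in>UNIV. \<Sum>i\<in>UNIV. \<Sum>l\<in>UNIV. \<Sum>j\<in>UNIV. ?F i j k l)"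
      by (intro sum.cong refl sum.swap)
    also have "\<dots> = (\<Sum>k\<in>UNIV. \<Sum>l\<in>UNIV. \<Sum>i\<in>UNIV. \<Sum>j\<in>UNIV. ?F i j k l)"
      by (intro sum.cong refl sum.swap)
    finally show ?thesis by (simp add: sum_distrib_right)
  qed
  \<comment> \<open>The trace as a sum of quadratic forms over the columns of
    \<open>\<sigma>\<close>.\<close>
  have 3: "trace_part t x = (\<Sum>k\<in>UNIV. ?B k k)"
  proof -
    have "trace_part t x =
        (\<Sum>i\<in>UNIV. \<Sum>j\<in>UNIV. \<Sum>k\<in>UNIV. \<sigma> t x $ i $ k * \<sigma> t x $ j $ k * D [e_x j, e_x i] (t, x))"
      by (simp add: trace_part_def matrix_matrix_mult_def transpose_def sum_distrib_right)
    also have "\<dots> = (\<Sum>i\<in>UNIV. \<Sum>k\<in>UNIV. \<Sum>j\<in>UNIV. \<sigma> t x $ i $ k * \<sigma> t x $ j $ k * D [e_x j, e_x i] (t, x))"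
      by (intro sum.cong refl sum.swap)
    also have "\<dots> = (\<Sum>k\<in>UNIV. ?B k k)" by (rule sum.swap)
    finally show ?thesis .
  qed
  have ee: "e $ k * e $ k = 1" for k using e[of k] by auto
  have 4: "(\<Sum>l\<in>UNIV. ?B k l * e $ k * e $ l) = ?B k k + (\<Sum>l\<in>UNIV - {k}. ?B k l * e $ k * e $ l)" for k
    using ee[of k] by (subst sum.remove[of UNIV k]) (simp_all add: mult.assoc)
  have "noise_part h t x e = sqrt h * (\<Sum>k\<in>UNIV. (\<Sum>i\<in>UNIV. \<sigma> t x $ i $ k * D [e_x i] (t, x)) * e $ k)
      + h / 2 * (\<Sum>k\<in>UNIV. \<Sum>l\<in>UNIV - {k}. ?B k l * e $ k * e $ l)"
    unfolding noise_part_def 1 2 3 4 sum.distrib by simp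
  also have "\<dots> = (\<Sum>k\<in>UNIV. (sqrt h * (\<Sum>i\<in>UNIV. \<sigma> t x $ i $ k * D [e_x i] (t, x))) * e $ k)
      + (\<Sum>k\<in>UNIV. \<Sum>l\<in>UNIV - {k}. (h / 2 * ?B k l) * e $ k * e $ l)"
  proof -
    have "sqrt h * (\<Sum>k\<in>UNIV. (\<Sum>i\<in>UNIV. \<sigma> t x $ i $ k * D [e_x i] (t, x)) * e $ k)
      = (\<Sum>k\<in>UNIV. (sqrt h * (\<Sum>i\<in>UNIV. \<sigma> t x $ i $ k * D [e_x i] (t, x))) * e $ k)"
      by (subst sum_distrib_left) (simp only: mult.assoc)
    moreover have "h / 2 * (\<Sum>k\<in>UNIV. \<Sum>l\<in>UNIV - {k}. ?B k l * e $ k * e $ l)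
      = (\<Sum>k\<in>UNIV. \<Sum>l\<in>UNIV - {k}. (h / 2 * ?B k l) * e $ k * e $ l)"
      by (subst sum_distrib_left, rule sum.cong[OF refl], subst sum_distrib_left) (simp only: mult.assoc)
    ultimately show ?thesis by (simp only:)
  qed
  finally show ?thesis .
qed

text \<open>The pathwise bound becomes a bound in mean once the random number of noise terms is
  turned into the fixed number \<open>N\<close>, by coefficients that vanish after stopping and at
  projections.\<close>

lemma weak_error:
  assumes t0: "0 \<le> t0" "t0 < T" and x: "x \<in> closure G"
  shows "\<exists>C\<ge>0. \<forall>h. small h \<longrightarrow> (\<forall>(P :: 'w measure) \<xi>. sign_noise P \<xi> \<longrightarrow>
    \<bar>(\<integral>\<omega>. pe_terminal T \<phi> (chain h (\<lambda>k. \<xi> k \<omega>) t0 x) \<partial>P) - D [] (t0, x)\<bar> \<le> C * sqrt h)"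
proof -
  obtain C where C: "0 \<le> C" and path: "\<forall>h e. small h \<longrightarrow> sign_seq e \<longrightarrow> path_bounds C h e t0 x"
    using path_estimate[OF assms] by blast
  have "\<bar>(\<integral>\<omega>. pe_terminal T \<phi> (chain h (\<lambda>k. \<xi> k \<omega>) t0 x) \<partial>P) - D [] (t0, x)\<bar> \<le> C * sqrt h"
    if h: "small h" and \<xi>: "sign_noise P \<xi>" for h and P :: "'w measure" and \<xi> :: "nat \<Rightarrow> 'w \<Rightarrow> real^'d"
  proof -
    have h0: "0 < h" using h by (simp add: small_def)
    \<comment> \<open>The bound on the stopping index from \<open>path_bounds\<close>, rounded
      up.\<close>
    define N where "N = nat \<lceil>(2 * T + h) / h\<rceil>"
    have N: "n \<le> N" if "real n * h \<le> 2 * T + h" for n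
    proof -
      have "real n \<le> (2 * T + h) / h" using that h0 by (simp add: pos_le_divide_eq)
      then show ?thesis unfolding N_def by linarith
    qed
    define S where "S e = chain h e t0 x" for e
    \<comment> \<open>Step \<open>k\<close> is an Euler step taken before the final time. This is
      read off the states up to \<open>k\<close>, so the coefficients \<open>A k\<close> and
      \<open>B k\<close> are independent of sign \<open>Suc k\<close>.\<close>
    define run where "run k e \<longleftrightarrow> (\<forall>j\<le>k. fst (S e j) < T) \<and> fst (snd (S e k)) \<in> closure G" for k e
    define A where "A k e i = (if run k e then
        (case S e k of (t, X, Y, Z) \<Rightarrow> Y * (sqrt h * (\<Sum>j\<in>UNIV. \<sigma> t X $ j $ i * D [e_x j] (t, X)))) else 0)" for k e i
    define B where "B k e l l' = (if run k e then
        (case S e k of (t, X, Y, Z) \<Rightarrow> Y * (h / 2 * (\<Sum>i\<in>UNIV. \<Sum>j\<in>UNIV. \<sigma> t X $ i $ l * \<sigma> t X $ j $ l' * D [e_x j, e_x i] (t, X)))) else 0)"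
      for k e l l'
    \<comment> \<open>Truncating at \<open>N\<close> makes this depend on finitely many signs for all \<open>e\<close>, not just sign sequences.\<close>
    define H where "H e = pe_terminal T \<phi> (\<lambda>k. S e (min k N))" for e
    have cong: "S e j = S e' j" if "\<forall>k\<in>{1..n}. e k = e' k" "j \<le> n" for e e' j n
      unfolding S_def using that by (intro pe_chain_cong) auto
    have depH: "depends_upto N H"
      unfolding depends_upto_def
    proof (intro allI impI)
      fix e e' :: "nat \<Rightarrow> real^'d" assume "\<forall>k\<in>{1..N}. e k = e' k"
      then have "(\<lambda>k. S e (min k N)) = (\<lambda>k. S e' (min k N))" by (intro ext cong[of N]) auto
      then show "H e = H e'" by (simp add: H_def)
    qed
    have depR: "run k e = run k e'" "S e k = S e' k" if "\<forall>j\<in>{1..k}. e j = e' j" for k e e'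
      using cong[OF that] by (auto simp: run_def)
    have depA: "depends_upto k (A k)" "depends_upto k (B k)" for k
      unfolding depends_upto_def A_def B_def using depR by (metis (no_types, lifting))+
    have estim: "\<bar>pe_terminal T \<phi> (S e) - D [] (t0, x) - (\<Sum>k<N. (\<Sum>i\<in>UNIV. A k e i * e (Suc k) $ i)
        + (\<Sum>i\<in>UNIV. \<Sum>j\<in>UNIV - {i}. B k e i j * e (Suc k) $ i * e (Suc k) $ j))\<bar> \<le> C * sqrt h"
      "H e = pe_terminal T \<phi> (S e)" if e: "sign_seq e" for e
    proof -
      obtain n where n: "0 < n" "real n * h \<le> 2 * T + h" "\<forall>j<n. fst (S e j) < T" "T \<le> fst (S e n)"
        "\<bar>payoff (S e n) - D [] (t0, x) - (\<Sum>j<n. state_noise h (S e j) (e (Suc j)))\<bar> \<le> C * sqrt h"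
        using path h e unfolding path_bounds_def S_def by blast
      note nN = N[OF n(2)]
      have ee: "\<And>i. e (Suc k) $ i \<in> {-1, 1}" for k using e by (simp add: sign_seq_def)
      have stop: "stop_index T (S e) = n"
        unfolding stop_index_def using n(3,4) by (intro Least_equality) (auto simp: not_less[symmetric])
      \<comment> \<open>As \<open>n \<le> N\<close>, the truncated chain agrees with the original
        one up to the stopping index.\<close>
      have "stop_index T (\<lambda>k. S e (min k N)) = n"
        unfolding stop_index_def
      proof (rule Least_equality)
        show "T \<le> fst (S e (min n N))" using n(4) nN by simp
        show "n \<le> y" if "T \<le> fst (S e (min y N))" for y
        proof (rule ccontr)
          assume "\<not> n \<le> y"
          then have "min y N < n" using nN by simp
          then show False using n(3) that by (auto simp: not_le[symmetric])
        qed
      qed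
      then show "H e = pe_terminal T \<phi> (S e)" using stop nN by (simp add: H_def pe_terminal_def)
      have pay: "pe_terminal T \<phi> (S e) = payoff (S e n)" by (simp add: pe_terminal_def stop payoff_def)
      have noise: "(\<Sum>i\<in>UNIV. A k e i * e (Suc k) $ i) + (\<Sum>i\<in>UNIV. \<Sum>j\<in>UNIV - {i}. B k e i j * e (Suc k) $ i * e (Suc k) $ j)
          = (if k < n then state_noise h (S e k) (e (Suc k)) else 0)" for k
      proof (cases "run k e")
        case True
        then have "k < n" using n(4) by (auto simp: run_def not_less not_le[symmetric] intro: leI)
        obtain t X Y Z where s: "S e k = (t, X, Y, Z)" by (cases "S e k")
        have X: "X \<in> closure G" using True by (simp add: run_def s)
        define a where "a i = sqrt h * (\<Sum>j\<in>UNIV. \<sigma> t X $ j $ i * D [e_x j] (t, X))" for i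
        define \<beta> where "\<beta> l l' = h / 2 * (\<Sum>i\<in>UNIV. \<Sum>j\<in>UNIV. \<sigma> t X $ i $ l * \<sigma> t X $ j $ l' * D [e_x j, e_x i] (t, X))" for l l'
        have "noise_part h t X (e (Suc k)) = (\<Sum>i\<in>UNIV. a i * e (Suc k) $ i)
            + (\<Sum>i\<in>UNIV. \<Sum>j\<in>UNIV - {i}. \<beta> i j * e (Suc k) $ i * e (Suc k) $ j)"
          unfolding a_def \<beta>_def by (rule noise_part_expand[OF ee])
        moreover have "A k e i = Y * a i" "B k e i j = Y * \<beta> i j" for i j
          using True by (simp_all add: A_def B_def s a_def \<beta>_def)
        ultimately show ?thesis using \<open>k < n\<close> X
          by (simp add: s state_noise_def distrib_left sum_distrib_left mult.assoc)
      next
        case False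
        have "state_noise h (S e k) (e (Suc k)) = 0" if "k < n"
          using False n(3) that by (cases "S e k") (auto simp: run_def state_noise_def)
        then show ?thesis using False by (simp add: A_def B_def)
      qed
      have "(\<Sum>k<N. if k < n then state_noise h (S e k) (e (Suc k)) else 0) = (\<Sum>k<n. state_noise h (S e k) (e (Suc k)))"
        using nN by (intro sum.mono_neutral_cong_right) auto
      then show "\<bar>pe_terminal T \<phi> (S e) - D [] (t0, x) - (\<Sum>k<N. (\<Sum>i\<in>UNIV. A k e i * e (Suc k) $ i)
        + (\<Sum>i\<in>UNIV. \<Sum>j\<in>UNIV - {i}. B k e i j * e (Suc k) $ i * e (Suc k) $ j))\<bar> \<le> C * sqrt h"
        unfolding noise pay using n(5) by simp
    qed
    have "(\<integral>\<omega>. pe_terminal T \<phi> (chain h (\<lambda>k. \<xi> k \<omega>) t0 x) \<partial>P) = (\<integral>\<omega>. H (\<lambda>k. \<xi> k \<omega>) \<partial>P)"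
    proof (rule Bochner_Integration.integral_cong[OF refl])
      fix \<omega> assume "\<omega> \<in> space P"
      then have "sign_seq (\<lambda>k. \<xi> k \<omega>)" using \<xi> by (auto simp: sign_noise_def sign_seq_def)
      then show "pe_terminal T \<phi> (chain h (\<lambda>k. \<xi> k \<omega>) t0 x) = H (\<lambda>k. \<xi> k \<omega>)" using estim(2) by (simp add: S_def)
    qed
    moreover have "\<bar>(\<integral>\<omega>. H (\<lambda>k. \<xi> k \<omega>) \<partial>P) - D [] (t0, x)\<bar> \<le> C * sqrt h"
    proof (rule sign_noise_expectation_bound[OF \<xi> depH depA])
      show "\<bar>H e - D [] (t0, x) - (\<Sum>k<N. (\<Sum>i\<in>UNIV. A k e i * e (Suc k) $ i)
        + (\<Sum>i\<in>UNIV. \<Sum>j\<in>UNIV - {i}. B k e i j * e (Suc k) $ i * e (Suc k) $ j))\<bar> \<le> C * sqrt h" if "sign_seq e" for e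
        unfolding estim(2)[OF that] by (rule estim(1)[OF that])
    qed
    ultimately show ?thesis by simp
  qed
  then show ?thesis using C by blast
qed

end

section \<open>The weak error\<close>

text \<open>The equations hold for one family of derivatives of the solution, the regularity is
  given for another. They agree inside by uniqueness of derivatives, and on the closed cylinder
  because both are continuous there.\<close>

lemma C12_derivs_unique:
  fixes G :: "(real^'d) set"
  assumes T: "0 < T" and G: "open G" and v: "C12_derivs T G u vt vx vxx"
    and D: "partials k ({0<..<T} \<times> G) (\<lambda>(t, y). u t y) D" "2 \<le> k"
    and cont: "\<And>js. set js \<subseteq> Basis \<Longrightarrow> length js \<le> k \<Longrightarrow> continuous_on ({0..T} \<times> closure G) (D js)"
    and tx: "t \<in> {0..T}" "x \<in> closure G"
  shows "D [e_t] (t, x) = vt t x" "D [e_x i] (t, x) = vx t x $ i" "D [e_x j, e_x i] (t, x) = vxx t x $ i $ j"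
proof -
  have D0: "D [] = (\<lambda>(t, y). u t y)" using D(1) by (simp add: partials_def)
  have bas: "(e_t :: real \<times> (real^'d)) \<in> Basis" "(e_x i :: real \<times> (real^'d)) \<in> Basis" for i
    by (auto simp: Basis_prod_def)
  have clU: "closure ({0<..<T} \<times> G) = {0..T} \<times> closure G" using T by (simp add: closure_Times)
  have ext: "f (t, x) = f' (t, x)"
    if "continuous_on ({0..T} \<times> closure G) f" "continuous_on ({0..T} \<times> closure G) f'"
      "\<And>t x. t \<in> {0<..<T} \<Longrightarrow> x \<in> G \<Longrightarrow> f (t, x) = f' (t, x)" for f f' :: "real \<times> (real^'d) \<Rightarrow> real"
  proof -
    have "f (t, x) - f' (t, x) = 0"
      by (rule continuous_constant_on_closure[where S="{0<..<T} \<times> G" and f="\<lambda>z. f z - f' z"])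
        (use that tx in \<open>auto simp: clU intro!: continuous_intros\<close>)
    then show ?thesis by simp
  qed
  have der: "((\<lambda>s. D js ((t, x) + s *\<^sub>R e)) has_real_derivative D (e # js) (t, x)) (at 0)"
    if "set js \<subseteq> Basis" "length js < 2" "e \<in> Basis" "t \<in> {0<..<T}" "x \<in> G" for js e t x
    using D that unfolding partials_def by fastforce
  have vd: "((\<lambda>s. u s x) has_real_derivative vt t x) (at t)"
    "((\<lambda>s. u t (x + s *\<^sub>R axis i 1)) has_real_derivative vx t x $ i) (at 0)"
    "((\<lambda>s. vx t (x + s *\<^sub>R axis j 1) $ i) has_real_derivative vxx t x $ i $ j) (at 0)"
    if "t \<in> {0<..<T}" "x \<in> G" for t x i j
    using v that unfolding C12_derivs_def by blast+
  have vc: "continuous_on ({0..T} \<times> closure G) (\<lambda>(t, x). vt t x)"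
    "continuous_on ({0..T} \<times> closure G) (\<lambda>(t, x). vx t x)"
    "continuous_on ({0..T} \<times> closure G) (\<lambda>(t, x). vxx t x)"
    using v unfolding C12_derivs_def by blast+
  have vc': "continuous_on ({0..T} \<times> closure G) (\<lambda>(t, x). vx t x $ i)"
    "continuous_on ({0..T} \<times> closure G) (\<lambda>(t, x). vxx t x $ i $ j)" for i j
    using continuous_on_component[OF vc(2), of i]
      continuous_on_component[OF continuous_on_component[OF vc(3), of i], of j]
    by (simp_all add: case_prod_beta)
  have in1: "D [e_t] (t, x) = vt t x" if "t \<in> {0<..<T}" "x \<in> G" for t x
  proof -
    have "((\<lambda>s. u (s + t) x) has_real_derivative D [e_t] (t, x)) (at 0)"
      using der[of "[]" e_t t x] bas that by (simp add: D0 add.commute)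
    then have "((\<lambda>s. u s x) has_real_derivative D [e_t] (t, x)) (at t)"
      using DERIV_shift[of "\<lambda>s. u s x" "D [e_t] (t, x)" 0 t] by simp
    then show ?thesis using vd(1)[OF that] by (rule DERIV_unique)
  qed
  have in2: "D [e_x i] (t, x) = vx t x $ i" if "t \<in> {0<..<T}" "x \<in> G" for t x i
  proof -
    have "((\<lambda>s. u t (x + s *\<^sub>R axis i 1)) has_real_derivative D [e_x i] (t, x)) (at 0)"
      using der[of "[]" "e_x i" t x] bas that by (simp add: D0)
    then show ?thesis using vd(2)[OF that] by (rule DERIV_unique)
  qed
  have in3: "D [e_x j, e_x i] (t, x) = vxx t x $ i $ j" if tx: "t \<in> {0<..<T}" "x \<in> G" for t x i j
  proof -
    have "((\<lambda>s. D [e_x i] (t, x + s *\<^sub>R axis j 1)) has_real_derivative D [e_x j, e_x i] (t, x)) (at 0)"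
      using der[of "[e_x i]" "e_x j" t x] bas tx by simp
    \<comment> \<open>\<open>in2\<close> identifies the first derivatives in \<open>G\<close> only,
      so the line has to stay in \<open>G\<close> for small parameters.\<close>
    moreover have "open ((\<lambda>s. x + s *\<^sub>R axis j 1) -` G :: real set)"
      by (intro open_vimage G continuous_intros)
    ultimately have "((\<lambda>s. vx t (x + s *\<^sub>R axis j 1) $ i) has_real_derivative D [e_x j, e_x i] (t, x)) (at 0)"
      by (rule has_field_derivative_transform_within_open) (use tx in2 in auto)
    then show ?thesis using vd(3)[OF tx] by (rule DERIV_unique)
  qed
  show "D [e_t] (t, x) = vt t x"
    using ext[OF cont vc(1)] in1 bas D(2) by simp
  show "D [e_x i] (t, x) = vx t x $ i"
    using ext[OF cont vc'(1)] in2 bas D(2) by simp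
  show "D [e_x j, e_x i] (t, x) = vxx t x $ i $ j"
    using ext[OF cont vc'(2)] in3 bas D(2) by simp
qed

lemma jet_bounds:
  fixes z :: "'a::euclidean_space"
  assumes "\<And>js. set js \<subseteq> Basis \<Longrightarrow> length js \<le> 2 \<Longrightarrow> \<bar>D js z\<bar> \<le> M"
  shows "\<bar>jet1 D z v\<bar> \<le> real DIM('a) * M * norm v" "\<bar>jet2 D z v w\<bar> \<le> (real DIM('a))\<^sup>2 * M * norm v * norm w"
proof -
  have "\<bar>jet1 D z v\<bar> \<le> (\<Sum>b\<in>(Basis::'a set). norm v * M)"
    unfolding jet1_def
  proof (intro order_trans[OF sum_abs] sum_mono)
    fix b :: 'a assume bas: "b \<in> Basis"
    show "\<bar>(v \<bullet> b) * D [b] z\<bar> \<le> norm v * M"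
      unfolding abs_mult using bas by (intro mult_mono Basis_le_norm assms) auto
  qed
  then show "\<bar>jet1 D z v\<bar> \<le> real DIM('a) * M * norm v" by (simp add: mult_ac)
  have "\<bar>jet2 D z v w\<bar> \<le> (\<Sum>b\<in>(Basis::'a set). \<Sum>c\<in>(Basis::'a set). norm v * norm w * M)"
    unfolding jet2_def
  proof (intro order_trans[OF sum_abs] sum_mono)
    fix b c :: 'a assume bas: "b \<in> Basis" "c \<in> Basis"
    show "\<bar>(v \<bullet> b) * (w \<bullet> c) * D [c, b] z\<bar> \<le> norm v * norm w * M"
      unfolding abs_mult using bas by (intro mult_mono Basis_le_norm assms) auto
  qed
  then show "\<bar>jet2 D z v w\<bar> \<le> (real DIM('a))\<^sup>2 * M * norm v * norm w"
    by (simp add: power2_eq_square mult_ac)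
qed

lemma continuous_compact_bound:
  fixes F :: "'a::topological_space \<Rightarrow> real"
  assumes "compact S" "continuous_on S F"
  shows "\<exists>B\<ge>0. \<forall>z\<in>S. \<bar>F z\<bar> \<le> B"
proof -
  obtain B where "\<forall>z\<in>S. \<bar>F z\<bar> \<le> B"
    using compact_imp_bounded[OF compact_continuous_image[OF assms(2,1)]] by (auto simp: bounded_iff)
  then have "\<forall>z\<in>S. \<bar>F z\<bar> \<le> \<bar>B\<bar>" by fastforce
  then show ?thesis by (intro exI[of _ "\<bar>B\<bar>"]) simp
qed

lemma parabolic_holder_bounded:
  fixes G :: "(real^'d) set"
  assumes "parabolic_holder \<epsilon> T G v" "bounded G"
  shows "\<exists>B\<ge>0. \<forall>t\<in>{0..T}. \<forall>x\<in>closure G. \<bar>v t x\<bar> \<le> B"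
proof -
  have "continuous_on ({0..T} \<times> closure G) (\<lambda>(t, x). v t x)"
    using assms(1) unfolding parabolic_holder_def C12_derivs_def by blast
  moreover have "compact ({0..T} \<times> closure G)" using assms(2) by (intro compact_Times) auto
  ultimately show ?thesis using continuous_compact_bound by fastforce
qed

text \<open>\<open>N\<close> may fail to be convex, so the mean value argument is confined to balls
  inside \<open>N\<close> around points of \<open>S\<close>; compactness gives them a common
  radius.\<close>

lemma Ck_bounded_derivs_lipschitz:
  fixes N :: "'a::euclidean_space set"
  assumes N: "open N" "compact S" "S \<subseteq> N" and \<phi>: "Ck_bounded_derivs k N \<phi>" "1 \<le> k"
  shows "\<exists>\<delta>>0. \<exists>L\<ge>0. \<forall>x\<in>S. \<forall>y. dist x y < \<delta> \<longrightarrow> \<bar>\<phi> y - \<phi> x\<bar> \<le> L * dist x y"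
proof -
  obtain D where D: "partials k N \<phi> D"
    "\<And>js. set js \<subseteq> Basis \<Longrightarrow> length js \<le> k \<Longrightarrow> continuous_on N (D js)"
    "\<And>js. set js \<subseteq> Basis \<Longrightarrow> 1 \<le> length js \<Longrightarrow> length js \<le> k \<Longrightarrow> bounded (D js ` N)"
    using \<phi>(1) unfolding Ck_bounded_derivs_def by blast
  have D0: "D [] = \<phi>" using D by (simp add: partials_def)
  have "\<exists>B. \<forall>x\<in>N. \<bar>D [b] x\<bar> \<le> B" if "b \<in> Basis" for b
    using D(3)[of "[b]"] that \<phi>(2) by (auto simp: bounded_iff)
  then obtain B where B: "\<And>b x. b \<in> Basis \<Longrightarrow> x \<in> N \<Longrightarrow> \<bar>D [b] x\<bar> \<le> B b" by metis
  define L where "L = (\<Sum>b\<in>(Basis::'a set). \<bar>B b\<bar>)"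
  obtain \<delta> where \<delta>: "\<delta> > 0" "(\<Union>x\<in>S. ball x \<delta>) \<subseteq> N"
    using compact_subset_open_imp_ball_epsilon_subset[OF N(2,1,3)] by blast
  have "\<bar>\<phi> y - \<phi> x\<bar> \<le> L * dist x y" if "x \<in> S" "dist x y < \<delta>" for x y
  proof -
    have sub: "ball x \<delta> \<subseteq> N" using \<delta> that by blast
    have "(\<phi> has_derivative (\<lambda>v. \<Sum>b\<in>Basis. (v \<bullet> b) * D [b] w)) (at w)" if "w \<in> ball x \<delta>" for w
      unfolding D0[symmetric]
      using that sub \<phi>(2) D(2) by (intro partials_has_derivative[OF N(1) D(1)]) auto
    then have "\<bar>\<phi> y - \<phi> x\<bar> \<le> L * dist y x"
      unfolding L_def using B sub that \<delta>(1)
      by (intro bounded_partials_lipschitz[OF convex_ball[of x \<delta>], of \<phi> "\<lambda>b. D [b]" B]) (auto simp: subset_iff)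
    then show ?thesis by (simp add: dist_commute)
  qed
  moreover have "0 \<le> L" by (simp add: L_def sum_nonneg)
  ultimately show ?thesis using \<delta>(1) by blast
qed

lemma norm_matrix_vector_le:
  fixes A :: "real^'d^'d"
  assumes "\<And>i j. \<bar>A $ i $ j\<bar> \<le> B i j"
  shows "norm (A *v e) \<le> (\<Sum>i\<in>UNIV. \<Sum>j\<in>UNIV. B i j) * norm e"
proof -
  have "norm (A *v e) \<le> (\<Sum>i\<in>UNIV. \<bar>(A *v e) $ i\<bar>)" by (rule norm_le_l1_cart)
  also have "\<dots> \<le> (\<Sum>i\<in>UNIV. \<Sum>j\<in>UNIV. B i j * norm e)"
  proof (rule sum_mono)
    fix i
    have "\<bar>(A *v e) $ i\<bar> = \<bar>\<Sum>j\<in>UNIV. A $ i $ j * e $ j\<bar>" by (simp add: matrix_vector_mult_def)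
    also have "\<dots> \<le> (\<Sum>j\<in>UNIV. B i j * norm e)"
    proof (intro order_trans[OF sum_abs] sum_mono)
      fix j
      have "0 \<le> B i j" using assms[of i j] by linarith
      then show "\<bar>A $ i $ j * e $ j\<bar> \<le> B i j * norm e"
        unfolding abs_mult using assms component_le_norm_cart by (intro mult_mono) auto
    qed
    finally show "\<bar>(A *v e) $ i\<bar> \<le> (\<Sum>j\<in>UNIV. B i j * norm e)" .
  qed
  finally show ?thesis by (simp add: sum_distrib_right)
qed

theorem theorem5p1:
  fixes G :: "(real^'d) set"
    and T \<epsilon> t0 :: real
    and \<nu> :: "real^'d \<Rightarrow> real^'d"
    and b :: "real \<Rightarrow> real^'d \<Rightarrow> real^'d"
    and \<sigma> :: "real \<Rightarrow> real^'d \<Rightarrow> real^'d^'d"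
    and c g \<gamma> \<psi> u :: "real \<Rightarrow> real^'d \<Rightarrow> real"
    and \<mu> \<phi> :: "real^'d \<Rightarrow> real"
    and x :: "real^'d"
  assumes domain: "open G" "connected G" "bounded G"
    and eps: "0 < \<epsilon>" "\<epsilon> < 1"
    and boundary: "holder_boundary 4 \<epsilon> G"
    and T: "0 < T"
    and normal: "\<And>z. z \<in> frontier G \<Longrightarrow> inward_unit_normal G z (\<nu> z)"
    and b: "\<And>i. parabolic_holder \<epsilon> T G (\<lambda>t y. b t y $ i)"
    and \<sigma>: "\<And>i j. parabolic_holder \<epsilon> T G (\<lambda>t y. \<sigma> t y $ i $ j)"
    and c: "parabolic_holder \<epsilon> T G c"
    and g: "parabolic_holder \<epsilon> T G g"
    and \<gamma>: "boundary_parabolic_holder \<epsilon> T G \<gamma>"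
    and \<psi>: "boundary_parabolic_holder \<epsilon> T G \<psi>"
    and \<mu>: "boundary_holder 2 \<epsilon> G \<mu>" "\<And>z. z \<in> frontier G \<Longrightarrow> \<mu> z > 0"
    and \<phi>: "holder_space 4 \<epsilon> G \<phi>"
    and \<phi>_ext: "\<exists>N. open N \<and> closure G \<subseteq> N \<and> Ck_bounded_derivs 4 N \<phi>"
    and u_sol: "bvp_solution T G \<nu> b \<sigma> c g \<mu> \<gamma> \<psi> \<phi> u"
    and u_unique: "\<And>v. bvp_solution T G \<nu> b \<sigma> c g \<mu> \<gamma> \<psi> \<phi> v \<Longrightarrow>
                     (\<forall>t\<in>{0..T}. \<forall>y\<in>closure G. v t y = u t y)"
    and u_reg: "holder_space 4 \<epsilon> ({0<..<T} \<times> G) (\<lambda>(t, y). u t y)"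
    and start: "0 \<le> t0" "t0 < T" "x \<in> G"
  shows "\<exists>C>0. \<exists>h0\<in>{0<..<1}. \<forall>h\<in>{0<..<h0}. \<forall>(M :: 'w measure) \<xi>. sign_noise M \<xi> \<longrightarrow>
           \<bar>(\<integral>\<omega>. pe_terminal T \<phi> (pe_chain G b \<sigma> c g \<mu> \<gamma> \<psi> h (\<lambda>k. \<xi> k \<omega>) t0 x) \<partial>M) - u t0 x\<bar>
             \<le> C * sqrt h"
proof -
  let ?Q = "{0..T} \<times> closure G" and ?U = "{0<..<T} \<times> G"
  have clG: "compact (closure G)" using domain by simp
  have frG: "compact (frontier G)" using domain by (simp add: compact_frontier_bounded)
  have clQ: "compact ?Q" using clG by (intro compact_Times) auto
  have clU: "closure ?U = ?Q" using T by (simp add: closure_Times)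
  have oU: "open ?U" using domain by (intro open_Times) auto
  have bU: "bounded ?U" using domain by (intro bounded_Times) auto
  obtain D where D: "partials 4 ?U (\<lambda>(t, y). u t y) D"
    and Dc': "\<And>js. set js \<subseteq> Basis \<Longrightarrow> length js \<le> 4 \<Longrightarrow> continuous_on (closure ?U) (D js)"
    using u_reg unfolding holder_space_def by blast
  note Dc = Dc'[unfolded clU]
  have D0: "D [] (t, y) = u t y" for t y using D by (simp add: partials_def)
  obtain \<delta>1 K where K: "0 < \<delta>1" "0 \<le> K" "segment_connected \<delta>1 K G"
    using holder_boundary_segment_connected[OF domain(1,3) boundary] by auto
  \<comment> \<open>The cylinder inherits the detours of \<open>G\<close>, the time interval being
    convex.\<close>
  have seg: "segment_connected \<delta>1 K ?U" using K by (intro segment_connected_Times) auto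
  have "\<exists>C\<ge>0. \<forall>z\<in>closure ?U. \<forall>p\<in>closure ?U. \<forall>y. dist z p < \<delta>1 \<longrightarrow>
      \<bar>taylor2 D z y - taylor2 D p y\<bar> \<le> C * (dist z p + dist p y) ^ 3"
    by (rule taylor2_base_change[OF oU D _ Dc' bU seg K(1,2)]) simp_all
  then obtain B1 where B1: "0 \<le> B1" "\<forall>z\<in>?Q. \<forall>p\<in>?Q. \<forall>y. dist z p < \<delta>1 \<longrightarrow>
      \<bar>taylor2 D z y - taylor2 D p y\<bar> \<le> B1 * (dist z p + dist p y) ^ 3"
    unfolding clU by blast
  let ?J = "{js :: (real \<times> (real^'d)) list. set js \<subseteq> Basis \<and> length js \<le> 2}"
  have finJ: "finite ?J" by (rule finite_lists_length_le) simp
  have "\<exists>B\<ge>0. \<forall>z\<in>?Q. \<bar>D js z\<bar> \<le> B" if "js \<in> ?J" for js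
    using that by (intro continuous_compact_bound clQ Dc) auto
  then have "\<forall>js\<in>?J. \<exists>B. 0 \<le> B \<and> (\<forall>z\<in>?Q. \<bar>D js z\<bar> \<le> B)" by blast
  from bchoice[OF this] obtain BD where BD: "\<forall>js\<in>?J. 0 \<le> BD js \<and> (\<forall>z\<in>?Q. \<bar>D js z\<bar> \<le> BD js)" by blast
  define B2 where "B2 = (\<Sum>js\<in>?J. BD js)"
  have B2: "\<bar>D js z\<bar> \<le> B2" if "set js \<subseteq> Basis" "length js \<le> 2" "z \<in> ?Q" for js z
  proof -
    have "\<bar>D js z\<bar> \<le> BD js" using BD that by auto
    also have "\<dots> \<le> B2" unfolding B2_def using that BD finJ by (intro member_le_sum) auto
    finally show ?thesis .
  qed
  have B20: "0 \<le> B2" unfolding B2_def using BD by (intro sum_nonneg) auto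
  define n where "n = real DIM(real \<times> (real^'d))"
  have "\<forall>i. \<exists>B\<ge>0. \<forall>t\<in>{0..T}. \<forall>y\<in>closure G. \<bar>b t y $ i\<bar> \<le> B"
    using parabolic_holder_bounded[OF b domain(3)] by blast
  from choice[OF this] obtain Bb where
    Bb: "\<forall>i. 0 \<le> Bb i \<and> (\<forall>t\<in>{0..T}. \<forall>y\<in>closure G. \<bar>b t y $ i\<bar> \<le> Bb i)" by blast
  have "\<forall>p. \<exists>B\<ge>0. \<forall>t\<in>{0..T}. \<forall>y\<in>closure G. \<bar>\<sigma> t y $ fst p $ snd p\<bar> \<le> B"
    using parabolic_holder_bounded[OF \<sigma> domain(3)] by blast
  from choice[OF this] obtain Bs where
    Bs: "\<forall>p. 0 \<le> Bs p \<and> (\<forall>t\<in>{0..T}. \<forall>y\<in>closure G. \<bar>\<sigma> t y $ fst p $ snd p\<bar> \<le> Bs p)" by blast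
  obtain Bc where Bc: "0 \<le> Bc" "\<And>t y. t \<in> {0..T} \<Longrightarrow> y \<in> closure G \<Longrightarrow> \<bar>c t y\<bar> \<le> Bc"
    using parabolic_holder_bounded[OF c domain(3)] by blast
  obtain Bg where Bg: "0 \<le> Bg" "\<And>t y. t \<in> {0..T} \<Longrightarrow> y \<in> closure G \<Longrightarrow> \<bar>g t y\<bar> \<le> Bg"
    using parabolic_holder_bounded[OF g domain(3)] by blast
  have clS: "compact ({0..T} \<times> frontier G)" using frG by (intro compact_Times) auto
  obtain B\<gamma> where B\<gamma>: "0 \<le> B\<gamma>" "\<And>t z. t \<in> {0..T} \<Longrightarrow> z \<in> frontier G \<Longrightarrow> \<bar>\<gamma> t z\<bar> \<le> B\<gamma>"
    using continuous_compact_bound[OF clS boundary_parabolic_holder_continuous[OF \<gamma> domain(1)]] by auto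
  obtain B\<psi> where B\<psi>: "0 \<le> B\<psi>" "\<And>t z. t \<in> {0..T} \<Longrightarrow> z \<in> frontier G \<Longrightarrow> \<bar>\<psi> t z\<bar> \<le> B\<psi>"
    using continuous_compact_bound[OF clS boundary_parabolic_holder_continuous[OF \<psi> domain(1)]] by auto
  note \<mu>c = boundary_holder_continuous[OF \<mu>(1) domain(1)]
  obtain B\<mu> where B\<mu>: "0 \<le> B\<mu>" "\<And>z. z \<in> frontier G \<Longrightarrow> \<bar>\<mu> z\<bar> \<le> B\<mu>"
    using continuous_compact_bound[OF frG \<mu>c] by auto
  \<comment> \<open>\<open>G\<close> is nonempty and bounded, hence not the whole space. Nearest
    points and the minimum of \<open>\<mu>\<close> presuppose a nonempty frontier.\<close>
  have frne: "frontier G \<noteq> {}"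
    using frontier_eq_empty[of G] start(3) domain(3) not_bounded_UNIV by blast
  \<comment> \<open>By compactness \<open>\<mu>\<close> attains its minimum, whose positivity gives
    the constant \<open>m\<close>.\<close>
  obtain z0 where z0: "z0 \<in> frontier G" "\<And>z. z \<in> frontier G \<Longrightarrow> \<mu> z0 \<le> \<mu> z"
    using continuous_attains_inf[OF frG frne \<mu>c] by blast
  obtain N where N: "open N" "closure G \<subseteq> N" "Ck_bounded_derivs 4 N \<phi>" using \<phi>_ext by blast
  obtain \<delta>2 L where L: "0 < \<delta>2" "0 \<le> L" "\<And>y y'. y \<in> closure G \<Longrightarrow> dist y y' < \<delta>2 \<Longrightarrow> \<bar>\<phi> y' - \<phi> y\<bar> \<le> L * dist y y'"
    using Ck_bounded_derivs_lipschitz[OF N(1) clG N(2,3)] by auto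
  define \<delta> where "\<delta> = min 1 (min \<delta>1 \<delta>2)"
  define m where "m = \<mu> z0"
  define Sb where "Sb = (\<Sum>i\<in>UNIV. Bb i)"
  define Ss where "Ss = (\<Sum>i\<in>UNIV. \<Sum>j\<in>UNIV. Bs (i, j))"
  \<comment> \<open>As a sum of 1 and nonnegative constants, \<open>M\<close> dominates each of them
    and serves as the common bound of the locale.\<close>
  define M where "M = 1 + B1 + B2 + n * B2 + n\<^sup>2 * B2 + Sb + Ss + Bc + Bg + B\<gamma> + B\<psi> + B\<mu> + L"
  have nn: "0 \<le> n" "0 \<le> n * B2" "0 \<le> n\<^sup>2 * B2" "0 \<le> Sb" "0 \<le> Ss"
    using B20 Bb Bs by (auto simp: n_def Sb_def Ss_def intro!: sum_nonneg)
  note pos = nn B1(1) B20 Bc(1) Bg(1) B\<gamma>(1) B\<psi>(1) B\<mu>(1) L(2)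
  have leM: "1 \<le> M" "B1 \<le> M" "B2 \<le> M" "n * B2 \<le> M" "n\<^sup>2 * B2 \<le> M" "Sb \<le> M" "Ss \<le> M" "Bc \<le> M"
    "Bg \<le> M" "B\<gamma> \<le> M" "B\<psi> \<le> M" "B\<mu> \<le> M" "L \<le> M"
    using pos by (simp_all add: M_def)
  obtain vt vx vxx where v: "C12_derivs T G u vt vx vxx"
    and pde: "\<And>t y. t \<in> {0..T} \<Longrightarrow> y \<in> closure G \<Longrightarrow> vt t y + gen b \<sigma> t y (vx t y) (vxx t y) + c t y * u t y + g t y = 0"
    and final: "\<And>y. y \<in> closure G \<Longrightarrow> u T y = \<phi> y"
    and bc: "\<And>t z. t \<in> {0..T} \<Longrightarrow> z \<in> frontier G \<Longrightarrow>
        - \<mu> z * gen b \<sigma> t z (vx t z) (vxx t z) + \<nu> z \<bullet> vx t z + \<gamma> t z * u t z = \<psi> t z"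
    using u_sol unfolding bvp_solution_def by blast
  have four: "(2::nat) \<le> 4" by simp
  \<comment> \<open>The derivatives in the equations are exchanged for the family \<open>D\<close>
    that the Taylor polynomials use.\<close>
  have vt: "D [e_t] (t, y) = vt t y" and vx: "(\<chi> i. D [e_x i] (t, y)) = vx t y"
    and vxx: "(\<chi> i j. D [e_x j, e_x i] (t, y)) = vxx t y" if "t \<in> {0..T}" "y \<in> closure G" for t y
    using C12_derivs_unique[OF T domain(1) v D four Dc that] by (simp_all add: vec_eq_iff)
  have frcl: "z \<in> closure G" if "z \<in> frontier G" for z using that by (simp add: frontier_def)
  interpret E: projected_euler G T \<nu> b \<sigma> c g \<gamma> \<psi> \<mu> \<phi> D \<delta> M m
  proof
    show "0 < T" by fact
    show "0 < \<delta>" "\<delta> \<le> 1" using K L by (auto simp: \<delta>_def)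
    show "1 \<le> M" by fact
    show "0 < m" using \<mu>(2) z0 by (simp add: m_def)
    show "\<bar>taylor2 D z y - taylor2 D p y\<bar> \<le> M * (dist z p + dist p y) ^ 3"
      if "z \<in> ?Q" "p \<in> ?Q" "dist z p < \<delta>" for z p y
    proof -
      have "\<bar>taylor2 D z y - taylor2 D p y\<bar> \<le> B1 * (dist z p + dist p y) ^ 3"
        by (rule B1(2)[rule_format]) (use that in \<open>auto simp: \<delta>_def\<close>)
      also have "\<dots> \<le> M * (dist z p + dist p y) ^ 3" using leM by (intro mult_right_mono) auto
      finally show ?thesis .
    qed
    show "\<bar>D [] z\<bar> \<le> M" if "z \<in> ?Q" for z using B2[OF _ _ that, of "[]"] leM by simp
    show "\<bar>jet1 D z w\<bar> \<le> M * norm w" if "z \<in> ?Q" for z w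
    proof -
      have "\<bar>jet1 D z w\<bar> \<le> n * B2 * norm w" unfolding n_def by (rule jet_bounds) (use B2 that in auto)
      also have "\<dots> \<le> M * norm w" using leM by (intro mult_right_mono) auto
      finally show ?thesis .
    qed
    show "\<bar>jet2 D z w w'\<bar> \<le> M * norm w * norm w'" if "z \<in> ?Q" for z w w'
    proof -
      have "\<bar>jet2 D z w w'\<bar> \<le> n\<^sup>2 * B2 * norm w * norm w'" unfolding n_def by (rule jet_bounds) (use B2 that in auto)
      also have "\<dots> \<le> M * norm w * norm w'" using leM by (intro mult_right_mono) auto
      finally show ?thesis .
    qed
    fix t :: real assume t: "t \<in> {0..T}"
    show "norm (b t y) \<le> M" if "y \<in> closure G" for y
    proof -
      have "norm (b t y) \<le> (\<Sum>i\<in>UNIV. \<bar>b t y $ i\<bar>)" by (rule norm_le_l1_cart)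
      also have "\<dots> \<le> Sb" unfolding Sb_def using Bb t that by (intro sum_mono) auto
      finally show ?thesis using leM by linarith
    qed
    show "norm (\<sigma> t y *v e) \<le> M * norm e" if "y \<in> closure G" for y e
    proof -
      have "norm (\<sigma> t y *v e) \<le> Ss * norm e" unfolding Ss_def using Bs[rule_format, of "(_, _)"] t that by (intro norm_matrix_vector_le) simp
      also have "\<dots> \<le> M * norm e" using leM by (intro mult_right_mono) auto
      finally show ?thesis .
    qed
    show "\<bar>c t y\<bar> \<le> M" "\<bar>g t y\<bar> \<le> M" if "y \<in> closure G" for y
      using Bc(2)[OF t that] Bg(2)[OF t that] leM by linarith+
    show "\<bar>\<gamma> t z\<bar> \<le> M" "\<bar>\<psi> t z\<bar> \<le> M" if "z \<in> frontier G" for z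
      using B\<gamma>(2)[OF t that] B\<psi>(2)[OF t that] leM by linarith+
    show "D [e_t] (t, y) + gen b \<sigma> t y (\<chi> i. D [e_x i] (t, y)) (\<chi> i j. D [e_x j, e_x i] (t, y))
        + c t y * D [] (t, y) + g t y = 0" if "y \<in> closure G" for y
      unfolding vt[OF t that] vx[OF t that] vxx[OF t that] D0 by (rule pde[OF t that])
    show "- \<mu> z * gen b \<sigma> t z (\<chi> i. D [e_x i] (t, z)) (\<chi> i j. D [e_x j, e_x i] (t, z))
        + \<nu> z \<bullet> (\<chi> i. D [e_x i] (t, z)) + \<gamma> t z * D [] (t, z) = \<psi> t z" if "z \<in> frontier G" for z
      unfolding vx[OF t frcl[OF that]] vxx[OF t frcl[OF that]] D0 by (rule bc[OF t that])
  next
    show "m \<le> \<mu> z" "\<mu> z \<le> M" if "z \<in> frontier G" for z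
      using z0(2)[OF that] B\<mu>(2)[OF that] leM by (auto simp: m_def)
    show "D [] (T, y) = \<phi> y" if "y \<in> closure G" for y using final[OF that] by (simp add: D0)
    show "\<bar>\<phi> y' - \<phi> y\<bar> \<le> M * dist y y'" if "y \<in> closure G" "dist y y' < \<delta>" for y y'
    proof -
      have "\<bar>\<phi> y' - \<phi> y\<bar> \<le> L * dist y y'" using that by (intro L) (auto simp: \<delta>_def)
      also have "\<dots> \<le> M * dist y y'" using leM by (intro mult_right_mono) auto
      finally show ?thesis .
    qed
    have cf: "closed (frontier G)" by (rule frontier_closed)
    show cp: "closest_point (frontier G) X \<in> frontier G" for X by (rule closest_point_in_set[OF cf frne])
    \<comment> \<open>The relation between \<open>X\<close> and its projection, which the method
      presupposes, follows for every exterior point from the choice of a nearest frontier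
      point.\<close>
    show "X = closest_point (frontier G) X - infdist X (frontier G) *\<^sub>R \<nu> (closest_point (frontier G) X)"
      if "X \<notin> closure G" for X
      unfolding infdist_closest_point[OF cf frne]
      by (rule exterior_point_eq_normal_shift[OF domain(1) boundary _ that cp closest_point_le[OF cf] normal[OF cp]]) simp_all
    show "norm (\<nu> z) = 1" if "z \<in> frontier G" for z using normal[OF that] by (simp add: inward_unit_normal_def)
  qed
  obtain C where C: "0 \<le> C" and est: "\<forall>h. E.small h \<longrightarrow> (\<forall>(P :: 'w measure) \<xi>. sign_noise P \<xi> \<longrightarrow>
    \<bar>(\<integral>\<omega>. pe_terminal T \<phi> (pe_chain G b \<sigma> c g \<mu> \<gamma> \<psi> h (\<lambda>k. \<xi> k \<omega>) t0 x) \<partial>P) - D [] (t0, x)\<bar> \<le> C * sqrt h)"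
    using E.weak_error[OF start(1,2), of x] start(3) closure_subset[of G] by blast
  \<comment> \<open>A single threshold for both conditions in \<open>small\<close> that involve
    \<open>\<delta>\<close>: they follow from \<open>sqrt h * R < \<delta>\<close>.\<close>
  define R where "R = 1 + 3 * E.q + M * E.q"
  have q: "1 \<le> E.q" by (rule E.q_ge)
  have Mq: "0 \<le> M * E.q" using q leM by simp
  have R: "0 < R" "1 + 3 * E.q \<le> R" "M * E.q \<le> R" using q Mq by (auto simp: R_def)
  \<comment> \<open>The second bound is the threshold \<open>sqrt h * R < \<delta>\<close> solved
    for \<open>h\<close>; the first keeps \<open>h0\<close> below 1.\<close>
  define h0 where "h0 = min (1 / 2) ((\<delta> / R)\<^sup>2)"
  have h0: "h0 \<in> {0<..<1}" using R E.const by (auto simp: h0_def)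
  have small: "E.small h" if "h \<in> {0<..<h0}" for h
  proof -
    have h: "0 < h" "h < 1" "h < (\<delta> / R)\<^sup>2" using that by (auto simp: h0_def)
    have "sqrt h < sqrt ((\<delta> / R)\<^sup>2)" by (rule real_sqrt_less_mono[OF h(3)])
    then have "sqrt h < \<delta> / R" using R E.const by simp
    then have sR: "sqrt h * R < \<delta>" using R by (simp add: pos_less_divide_eq)
    have "sqrt h * (1 + 3 * E.q) \<le> sqrt h * R" "sqrt h * (M * E.q) \<le> sqrt h * R"
      using R h by (auto intro!: mult_left_mono)
    then have "sqrt h * (1 + 3 * E.q) < \<delta>" "sqrt h * (M * E.q) < \<delta>" using sR by linarith+
    moreover have "M * (E.q * sqrt h) = sqrt h * (M * E.q)" by simp
    ultimately show ?thesis using h unfolding E.small_def by linarith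
  qed
  \<comment> \<open>\<open>C\<close> may be 0, while a positive constant is asked for.\<close>
  show ?thesis
  proof (intro exI[of _ "C + 1"] conjI bexI[of _ h0] ballI allI impI)
    show "0 < C + 1" using C by simp
    show "h0 \<in> {0<..<1}" by (rule h0)
    fix h and P :: "'w measure" and \<xi> :: "nat \<Rightarrow> 'w \<Rightarrow> real^'d"
    assume h: "h \<in> {0<..<h0}" and \<xi>: "sign_noise P \<xi>"
    have "\<bar>(\<integral>\<omega>. pe_terminal T \<phi> (pe_chain G b \<sigma> c g \<mu> \<gamma> \<psi> h (\<lambda>k. \<xi> k \<omega>) t0 x) \<partial>P) - u t0 x\<bar> \<le> C * sqrt h"
      using est small[OF h] \<xi> by (simp add: D0)
    also have "\<dots> \<le> (C + 1) * sqrt h" using h by (intro mult_right_mono) auto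
    finally show "\<bar>(\<integral>\<omega>. pe_terminal T \<phi> (pe_chain G b \<sigma> c g \<mu> \<gamma> \<psi> h (\<lambda>k. \<xi> k \<omega>) t0 x) \<partial>P) - u t0 x\<bar>
        \<le> (C + 1) * sqrt h" .
  qed
qed

end
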